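(* Let $(J,\xi)$ be a Markov additive process on $E\times\mathbb{R}$ ($E$ finite, $J$ irreducible) with matrix exponent $F$, and let $Y_t=\exp(\xi_t)$ be the price of an asset. Let $T>0$, let $r\in\mathbb{R}$ be the interest rate, and let $H:(0,\infty)\to\mathbb{R}$ be the payoff function of a European option. Suppose there exists $s\in\mathbb{R}$ such that $\mathbb{E}[Y_T^{-s}]<\infty$ and the Mellin transform $\{\mathcal{M}H\}(s)$ exists. Let $C_H(\alpha,y,T)=e^{-rT}\mathbb{E}_{(\alpha,\log y)}[H(Y_T)]$ for $(\alpha,y)\in E\times(0,\infty)$. Then the Mellin transform of $C_H(\alpha,y,T)$ with respect to $y$ is $$\{\mathcal{M}C_H(\alpha,\cdot,T)\}(z)=e^{-rT}\{\mathcal{M}H\}(z)\sum_{\beta\in E}\big(e^{TF(-z)}\big)_{\alpha,\beta}$$ for all $\alpha\in E$ and all $z\in\mathbb{C}$ with $\mathrm{Re}(z)=s$.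
   Context: The Mellin transform of $f:(0,\infty)\to\mathbb{R}$ is $\{\mathcal{M}f\}(u)=\int_0^\infty x^{u-1}f(x)\,dx$; it "exists" at $u$ when the integral converges absolutely. Let $E$ be a finite set. A càdlàg process $(J_t,\xi_t)_{t\ge0}$ in $E\times\mathbb{R}$ adapted to $(\mathcal{F}_t)$ is a Markov additive process (MAP) if for all bounded continuous $f:E\times\mathbb{R}\to\mathbb{R}^+$ and $s,t>0$, $\mathbb{E}[f(J_{t+s},\xi_{t+s}-\xi_t)\mid\mathcal{F}_t]=\mathbb{E}_{J_t,0}[f(J_s,\xi_s)]$, where $\mathbb{E}_{\alpha,x}$ is expectation given $(J_0,\xi_0)=(\alpha,x)$; $\mathbb{E}$ is expectation with a deterministic $\xi_0$ and an arbitrary fixed initial law of $J_0$. $J$ is an irreducible continuous-time Markov chain with rates $q_{\alpha,\beta}$ ($\alpha\neq\beta$), $q_\alpha=\sum_{\beta\ne\alpha}q_{\alpha,\beta}$; while $J$ is in state $\alpha$, $\xi$ evolves as an independent copy of a Lévy process $\xi^{(\alpha)}$; when $J$ jumps from $\alpha$ to $\beta$, $\xi$ makes an additional independent jump distributed as $U_{\alpha,\beta}$ (with $U_{\alpha,\beta}=0$ if $q_{\alpha,\beta}=0$). The matrix exponent $F(z)\in\mathbb{C}^{E\times E}$ has entries $F(z)_{\alpha,\alpha}=\psi_\alpha(z)-q_\alpha$, $F(z)_{\alpha,\beta}=q_{\alpha,\beta}G_{\alpha,\beta}(z)$ ($\alpha\ne\beta$), with $\psi_\alpha$ the Laplace exponent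 of $\xi^{(\alpha)}$ ($\mathbb{E}[e^{z\xi^{(\alpha)}_t}]=e^{t\psi_\alpha(z)}$) and $G_{\alpha,\beta}(z)=\mathbb{E}[e^{zU_{\alpha,\beta}}]$; it satisfies $\mathbb{E}_{\alpha,0}[e^{z\xi_t};J_t=\beta]=(e^{tF(z)})_{\alpha,\beta}$. *)

theory Defs
  imports "HOL-Probability.Probability"
begin

section \<open>Mellin transform and matrix exponential\<close>

text \<open>Only the values of \<open>f\<close> on the positive half-line matter; \<open>f\<close> stands for a function
  \<open>(0,\<infinity>) \<rightarrow> \<real>\<close>.  As integrability with respect to \<open>lborel\<close> includes Borel measurability,
  \<open>mellin_exists f u\<close> entails that \<open>f\<close> is Borel on the positive half-line.\<close>

definition mellin_exists :: "(real \<Rightarrow> real) \<Rightarrow> complex \<Rightarrow> bool" where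
  "mellin_exists f u \<longleftrightarrow>
     set_integrable lborel {0<..} (\<lambda>x. complex_of_real x powr (u - 1) * complex_of_real (f x))"

definition mellin :: "(real \<Rightarrow> real) \<Rightarrow> complex \<Rightarrow> complex" where
  "mellin f u = (LINT x:{0<..}|lborel. complex_of_real x powr (u - 1) * complex_of_real (f x))"

text \<open>The type of square matrices is not an instance of the normed algebra classes (its
  \<open>*\<close> is componentwise), so \<open>exp\<close> is not available for it.\<close>

definition matrix_exp :: "complex ^ 'n ^ 'n \<Rightarrow> complex ^ 'n ^ 'n" where
  "matrix_exp A = (\<Sum>n. (1 / fact n) *\<^sub>R ((\<lambda>B. A ** B) ^^ n) (mat 1))"


section \<open>L\'evy processes\<close>

text \<open>The time set is \<open>{0..}\<close>; the values of processes at negative times are irrelevant throughout.\<close>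

definition cadlag :: "'a topology \<Rightarrow> (real \<Rightarrow> 'a) \<Rightarrow> bool" where
  "cadlag S f \<longleftrightarrow>
     (\<forall>t\<ge>0. limitin S f (f t) (at_right t)) \<and> (\<forall>t>0. \<exists>l. limitin S f l (at_left t))"

locale levy_process = prob_space M for M :: "'a measure" +
  fixes X :: "real \<Rightarrow> 'a \<Rightarrow> real"
  assumes random_variable_levy: "\<And>t. 0 \<le> t \<Longrightarrow> X t \<in> borel_measurable M"
    and levy_zero: "AE \<omega> in M. X 0 \<omega> = 0"
    and levy_cadlag: "\<And>\<omega>. \<omega> \<in> space M \<Longrightarrow> cadlag euclidean (\<lambda>t. X t \<omega>)"
    and stationary_increments:
      "\<And>s t. 0 \<le> s \<Longrightarrow> 0 \<le> t \<Longrightarrow>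
        distr M borel (\<lambda>\<omega>. X (s + t) \<omega> - X s \<omega>) = distr M borel (X t)"
    and independent_increments:
      "\<And>n \<tau>. mono \<tau> \<Longrightarrow> 0 \<le> \<tau> 0 \<Longrightarrow>
        indep_vars (\<lambda>_. borel) (\<lambda>i \<omega>. X (\<tau> (Suc i)) \<omega> - X (\<tau> i) \<omega>) {..<n::nat}"

text \<open>\<open>\<psi>\<close> is constrained only at those \<open>z\<close> where the exponential moment exists.\<close>

definition is_laplace_exponent ::
    "'a measure \<Rightarrow> (real \<Rightarrow> 'a \<Rightarrow> real) \<Rightarrow> (complex \<Rightarrow> complex) \<Rightarrow> bool" where
  "is_laplace_exponent M X \<psi> \<longleftrightarrow>
     (\<forall>z t. 0 \<le> t \<longrightarrow> integrable M (\<lambda>\<omega>. exp (z * complex_of_real (X t \<omega>))) \<longrightarrow>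
        (LINT \<omega>|M. exp (z * complex_of_real (X t \<omega>))) = exp (complex_of_real t * \<psi> z))"


section \<open>Markov additive processes\<close>

text \<open>The finite set \<open>E\<close> is the type \<open>'e\<close> with the discrete topology and sigma-algebra.
  \<open>P \<alpha> x\<close> is the law under which \<open>(J\<^sub>0, \<xi>\<^sub>0) = (\<alpha>, x)\<close>, and \<open>A t\<close> is the filtration at time
  \<open>t\<close>.  Since the right-hand side of the additivity property does not depend on the starting
  point, requiring it under every \<open>P \<alpha> x\<close> is the same as requiring it for every initial law
  of \<open>J\<^sub>0\<close> and every deterministic \<open>\<xi>\<^sub>0\<close>.\<close>

abbreviation state_topology :: "('e \<times> real) topology" where
  "state_topology \<equiv> prod_topology (discrete_topology UNIV) euclidean"

abbreviation state_space :: "('e \<times> real) measure" where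
  "state_space \<equiv> count_space UNIV \<Otimes>\<^sub>M borel"

locale markov_additive_process =
  fixes M :: "'w measure" and P :: "'e::finite \<Rightarrow> real \<Rightarrow> 'w measure"
    and A :: "real \<Rightarrow> 'w measure"
    and J :: "real \<Rightarrow> 'w \<Rightarrow> 'e" and \<xi> :: "real \<Rightarrow> 'w \<Rightarrow> real"
  assumes prob_space_P: "\<And>\<alpha> x. prob_space (P \<alpha> x)"
    and sets_P: "\<And>\<alpha> x. sets (P \<alpha> x) = sets M"
    and subalgebra_A: "\<And>t. 0 \<le> t \<Longrightarrow> subalgebra M (A t)"
    and mono_A: "\<And>s t. 0 \<le> s \<Longrightarrow> s \<le> t \<Longrightarrow> sets (A s) \<subseteq> sets (A t)"
    and adapted: "\<And>t. 0 \<le> t \<Longrightarrow> (\<lambda>\<omega>. (J t \<omega>, \<xi> t \<omega>)) \<in> A t \<rightarrow>\<^sub>M state_space"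
    and cadlag_paths: "\<And>\<omega>. \<omega> \<in> space M \<Longrightarrow> cadlag state_topology (\<lambda>t. (J t \<omega>, \<xi> t \<omega>))"
    and initial: "\<And>\<alpha> x. AE \<omega> in P \<alpha> x. J 0 \<omega> = \<alpha> \<and> \<xi> 0 \<omega> = x"
    and markov_additive:
      "\<And>\<alpha> x f s t. continuous_map state_topology euclidean f \<Longrightarrow> bounded (range f) \<Longrightarrow>
        (\<And>p. 0 \<le> f p) \<Longrightarrow> 0 < s \<Longrightarrow> 0 < t \<Longrightarrow>
        AE \<omega> in P \<alpha> x.
          real_cond_exp (P \<alpha> x) (A t) (\<lambda>\<omega>'. f (J (t + s) \<omega>', \<xi> (t + s) \<omega>' - \<xi> t \<omega>')) \<omega>
            = (LINT \<omega>'|P (J t \<omega>) 0. f (J s \<omega>', \<xi> s \<omega>'))"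

definition initial_law ::
    "('e \<Rightarrow> real \<Rightarrow> 'w measure) \<Rightarrow> 'e pmf \<Rightarrow> real \<Rightarrow> 'w measure" where
  "initial_law P \<mu> x = measure_pmf \<mu> \<bind> (\<lambda>\<alpha>. P \<alpha> x)"

definition irreducible_chain ::
    "('e \<Rightarrow> real \<Rightarrow> 'w measure) \<Rightarrow> (real \<Rightarrow> 'w \<Rightarrow> 'e) \<Rightarrow> bool" where
  "irreducible_chain P J \<longleftrightarrow>
     (\<forall>\<alpha> \<beta>. \<exists>t\<ge>0. 0 < measure (P \<alpha> 0) {\<omega> \<in> space (P \<alpha> 0). J t \<omega> = \<beta>})"


section \<open>Rates, sojourn processes and transition jumps\<close>

definition exit_rate :: "('e::finite \<Rightarrow> 'e \<Rightarrow> real) \<Rightarrow> 'e \<Rightarrow> real" where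
  "exit_rate q \<alpha> = (\<Sum>\<beta>\<in>UNIV - {\<alpha>}. q \<alpha> \<beta>)"

text \<open>A state with exit rate \<open>0\<close> is absorbing: its holding time is infinite, and the jump chain is
  continued there by a constant.  This covers a one-point \<open>E\<close>.\<close>

definition jump_prob :: "('e::finite \<Rightarrow> 'e \<Rightarrow> real) \<Rightarrow> 'e \<Rightarrow> 'e \<Rightarrow> real" where
  "jump_prob q \<alpha> \<beta> =
     (if exit_rate q \<alpha> = 0 then (if \<beta> = \<alpha> then 1 else 0)
      else if \<beta> = \<alpha> then 0 else q \<alpha> \<beta> / exit_rate q \<alpha>)"

text \<open>The continuous-time chain with rates \<open>q\<close> started in \<open>\<alpha>\<close>, given by its jump chain \<open>Z\<close> and
  holding times \<open>H\<close>: conditionally on the jump chain the holding times are independent and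
  \<open>H i\<close> is exponential with parameter \<open>exit_rate q (Z i)\<close>.\<close>

definition is_markov_jump_chain ::
    "'v measure \<Rightarrow> ('e::finite \<Rightarrow> 'e \<Rightarrow> real) \<Rightarrow> 'e \<Rightarrow> (nat \<Rightarrow> 'v \<Rightarrow> 'e) \<Rightarrow> (nat \<Rightarrow> 'v \<Rightarrow> ereal) \<Rightarrow> bool" where
  "is_markov_jump_chain N q \<alpha> Z H \<longleftrightarrow>
     (\<forall>n. Z n \<in> N \<rightarrow>\<^sub>M count_space UNIV) \<and> (\<forall>n. H n \<in> borel_measurable N) \<and>
     (\<forall>n. \<forall>\<omega>\<in>space N. 0 \<le> H n \<omega>) \<and>
     (\<forall>n b h. (\<forall>i. 0 \<le> h i) \<longrightarrow>
        measure N {\<omega> \<in> space N. (\<forall>i\<le>n. Z i \<omega> = b i) \<and> (\<forall>i<n. ereal (h i) < H i \<omega>)}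
          = (if b 0 = \<alpha> then 1 else 0) *
            (\<Prod>i<n. jump_prob q (b i) (b (Suc i)) * exp (- exit_rate q (b i) * h i)))"

definition jump_time :: "(nat \<Rightarrow> 'v \<Rightarrow> ereal) \<Rightarrow> nat \<Rightarrow> 'v \<Rightarrow> ereal" where
  "jump_time H n \<omega> = (\<Sum>i<n. H i \<omega>)"

text \<open>The number of jumps up to time \<open>t\<close>; unspecified after an explosion, which has probability
  \<open>0\<close> as the state space is finite.\<close>

definition jump_count :: "(nat \<Rightarrow> 'v \<Rightarrow> ereal) \<Rightarrow> real \<Rightarrow> 'v \<Rightarrow> nat" where
  "jump_count H t \<omega> = (LEAST n. ereal t < jump_time H (Suc n) \<omega>)"

text \<open>The position of the additive component at the \<open>n\<close>-th jump time, started from \<open>0\<close>: \<open>X i \<beta>\<close> drives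
  the \<open>i\<close>-th sojourn if that is spent in \<open>\<beta>\<close>, and \<open>V i \<beta> \<gamma>\<close> is the additional jump at its end if the
  chain then moves to \<open>\<gamma>\<close>.\<close>

definition jump_level ::
    "(nat \<Rightarrow> 'v \<Rightarrow> 'e) \<Rightarrow> (nat \<Rightarrow> 'v \<Rightarrow> ereal) \<Rightarrow> (nat \<Rightarrow> 'e \<Rightarrow> real \<Rightarrow> 'v \<Rightarrow> real) \<Rightarrow>
     (nat \<Rightarrow> 'e \<Rightarrow> 'e \<Rightarrow> 'v \<Rightarrow> real) \<Rightarrow> nat \<Rightarrow> 'v \<Rightarrow> real" where
  "jump_level Z H X V n \<omega> =
     (\<Sum>i<n. X i (Z i \<omega>) (real_of_ereal (H i \<omega>)) \<omega> + V i (Z i \<omega>) (Z (Suc i) \<omega>) \<omega>)"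

definition built_chain ::
    "(nat \<Rightarrow> 'v \<Rightarrow> 'e) \<Rightarrow> (nat \<Rightarrow> 'v \<Rightarrow> ereal) \<Rightarrow> real \<Rightarrow> 'v \<Rightarrow> 'e" where
  "built_chain Z H t \<omega> = Z (jump_count H t \<omega>) \<omega>"

definition built_level ::
    "(nat \<Rightarrow> 'v \<Rightarrow> 'e) \<Rightarrow> (nat \<Rightarrow> 'v \<Rightarrow> ereal) \<Rightarrow> (nat \<Rightarrow> 'e \<Rightarrow> real \<Rightarrow> 'v \<Rightarrow> real) \<Rightarrow>
     (nat \<Rightarrow> 'e \<Rightarrow> 'e \<Rightarrow> 'v \<Rightarrow> real) \<Rightarrow> real \<Rightarrow> 'v \<Rightarrow> real" where
  "built_level Z H X V t \<omega> =
     (let n = jump_count H t \<omega>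
      in jump_level Z H X V n \<omega> + X n (Z n \<omega>) (t - real_of_ereal (jump_time H n \<omega>)) \<omega>)"

definition path_law :: "'v measure \<Rightarrow> 'b measure \<Rightarrow> (real \<Rightarrow> 'v \<Rightarrow> 'b) \<Rightarrow> (real \<Rightarrow> 'b) measure" where
  "path_law N S X = distr N (Pi\<^sub>M {0..} (\<lambda>_. S)) (\<lambda>\<omega>. \<lambda>t\<in>{0..}. X t \<omega>)"

text \<open>Sources of randomness, listed so that the independence of random elements with different
  codomains can be stated as independence of the sigma-algebras they generate.\<close>

datatype 'e noise = Chain | Sojourn nat 'e | Transition nat 'e 'e

fun noise_sets ::
    "'v measure \<Rightarrow> (nat \<Rightarrow> 'v \<Rightarrow> 'e) \<Rightarrow> (nat \<Rightarrow> 'v \<Rightarrow> ereal) \<Rightarrow> (nat \<Rightarrow> 'e \<Rightarrow> real \<Rightarrow> 'v \<Rightarrow> real) \<Rightarrow>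
     (nat \<Rightarrow> 'e \<Rightarrow> 'e \<Rightarrow> 'v \<Rightarrow> real) \<Rightarrow> 'e noise \<Rightarrow> 'v set set" where
  "noise_sets N Z H X V Chain =
     sets (vimage_algebra (space N) (\<lambda>\<omega> n. (Z n \<omega>, H n \<omega>)) (Pi\<^sub>M UNIV (\<lambda>_. count_space UNIV \<Otimes>\<^sub>M borel)))"
| "noise_sets N Z H X V (Sojourn n \<alpha>) =
     sets (vimage_algebra (space N) (\<lambda>\<omega>. \<lambda>t\<in>{0..}. X n \<alpha> t \<omega>) (Pi\<^sub>M {0..} (\<lambda>_. borel)))"
| "noise_sets N Z H X V (Transition n \<alpha> \<beta>) =
     sets (vimage_algebra (space N) (V n \<alpha> \<beta>) borel)"

text \<open>\<open>(J, \<xi>)\<close> has the chain rates \<open>q\<close>, the L\'evy processes \<open>L \<alpha>\<close> and the transition jumps \<open>U \<alpha> \<beta>\<close>.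
  The space \<open>D\<close> carries \<open>L\<close> and \<open>U\<close>, whose joint distribution is irrelevant.  The path description
  is required in distribution only: under \<open>N \<alpha>\<close> there are a chain \<open>(Z, H)\<close> started in \<open>\<alpha>\<close>, copies
  \<open>X n \<beta>\<close> of \<open>L \<beta>\<close> and copies \<open>V n \<beta> \<gamma>\<close> of \<open>U \<beta> \<gamma>\<close>, all independent, from which a process with
  the law of \<open>(J, \<xi>)\<close> is built.  The value \<open>X i \<beta>\<close> at the end of a sojourn may be used in place of the
  left limit, because a L\'evy process almost surely does not jump at an independent time.  The
  diagonal entries of \<open>q\<close> and \<open>U\<close> are never used; \<open>V n \<beta> \<beta>\<close> enters only on a null set and is merely
  required to be measurable.\<close>

locale map_characteristics =
  fixes P :: "'e::finite \<Rightarrow> real \<Rightarrow> 'w measure"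
    and J :: "real \<Rightarrow> 'w \<Rightarrow> 'e" and \<xi> :: "real \<Rightarrow> 'w \<Rightarrow> real"
    and q :: "'e \<Rightarrow> 'e \<Rightarrow> real"
    and D :: "'d measure"
    and L :: "'e \<Rightarrow> real \<Rightarrow> 'd \<Rightarrow> real" and U :: "'e \<Rightarrow> 'e \<Rightarrow> 'd \<Rightarrow> real"
    and N :: "'e \<Rightarrow> 'v measure"
    and Z :: "nat \<Rightarrow> 'v \<Rightarrow> 'e" and H :: "nat \<Rightarrow> 'v \<Rightarrow> ereal"
    and X :: "nat \<Rightarrow> 'e \<Rightarrow> real \<Rightarrow> 'v \<Rightarrow> real" and V :: "nat \<Rightarrow> 'e \<Rightarrow> 'e \<Rightarrow> 'v \<Rightarrow> real"
  assumes rates_nonneg: "\<And>\<alpha> \<beta>. \<alpha> \<noteq> \<beta> \<Longrightarrow> 0 \<le> q \<alpha> \<beta>"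
    and levy_L: "\<And>\<alpha>. levy_process D (L \<alpha>)"
    and random_variable_U: "\<And>\<alpha> \<beta>. \<alpha> \<noteq> \<beta> \<Longrightarrow> U \<alpha> \<beta> \<in> borel_measurable D"
    and U_zero: "\<And>\<alpha> \<beta>. \<alpha> \<noteq> \<beta> \<Longrightarrow> q \<alpha> \<beta> = 0 \<Longrightarrow> AE \<omega> in D. U \<alpha> \<beta> \<omega> = 0"
    and prob_space_N: "\<And>\<alpha>. prob_space (N \<alpha>)"
    and chain: "\<And>\<alpha>. is_markov_jump_chain (N \<alpha>) q \<alpha> Z H"
    and random_variable_X: "\<And>\<alpha> n \<beta> t. 0 \<le> t \<Longrightarrow> X n \<beta> t \<in> borel_measurable (N \<alpha>)"
    and cadlag_X: "\<And>\<alpha> n \<beta> \<omega>. \<omega> \<in> space (N \<alpha>) \<Longrightarrow> cadlag euclidean (\<lambda>t. X n \<beta> t \<omega>)"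
    and copy_X: "\<And>\<alpha> n \<beta>. path_law (N \<alpha>) borel (X n \<beta>) = path_law D borel (L \<beta>)"
    and random_variable_V: "\<And>\<alpha> n \<beta> \<gamma>. V n \<beta> \<gamma> \<in> borel_measurable (N \<alpha>)"
    and copy_V: "\<And>\<alpha> n \<beta> \<gamma>. \<beta> \<noteq> \<gamma> \<Longrightarrow> distr (N \<alpha>) borel (V n \<beta> \<gamma>) = distr D borel (U \<beta> \<gamma>)"
    and independent: "\<And>\<alpha>. prob_space.indep_sets (N \<alpha>) (noise_sets (N \<alpha>) Z H X V)
          ({Chain} \<union> {Sojourn n \<beta> |n \<beta>. True} \<union> {Transition n \<beta> \<gamma> |n \<beta> \<gamma>. \<beta> \<noteq> \<gamma>})"
    and same_law: "\<And>\<alpha> x. path_law (P \<alpha> x) state_space (\<lambda>t \<omega>. (J t \<omega>, \<xi> t \<omega>))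
          = path_law (N \<alpha>) state_space (\<lambda>t \<omega>. (built_chain Z H t \<omega>, x + built_level Z H X V t \<omega>))"

definition matrix_exponent ::
    "('e::finite \<Rightarrow> 'e \<Rightarrow> real) \<Rightarrow> ('e \<Rightarrow> complex \<Rightarrow> complex) \<Rightarrow> 'd measure \<Rightarrow>
     ('e \<Rightarrow> 'e \<Rightarrow> 'd \<Rightarrow> real) \<Rightarrow> complex \<Rightarrow> complex ^ 'e ^ 'e" where
  "matrix_exponent q \<psi> D U z =
     (\<chi> \<alpha> \<beta>. if \<alpha> = \<beta> then \<psi> \<alpha> z - complex_of_real (exit_rate q \<alpha>)
             else complex_of_real (q \<alpha> \<beta>) * (LINT \<omega>|D. exp (z * complex_of_real (U \<alpha> \<beta> \<omega>))))"


section \<open>European options\<close>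

definition option_price ::
    "('e \<Rightarrow> real \<Rightarrow> 'w measure) \<Rightarrow> (real \<Rightarrow> 'w \<Rightarrow> real) \<Rightarrow> real \<Rightarrow> (real \<Rightarrow> real) \<Rightarrow>
     'e \<Rightarrow> real \<Rightarrow> real \<Rightarrow> real" where
  "option_price P Y r H \<alpha> y T = exp (- r * T) * (LINT \<omega>|P \<alpha> (ln y). H (Y T \<omega>))"

end

theory Submission
  imports Defs
begin

text \<open>Let \<open>B\<close> be the displacement of the additive component over \<open>[0, T]\<close>.  The price is an average of
  the payoffs \<open>H (y * exp B)\<close>, so in \<open>y\<close> it is a multiplicative convolution.  Fubini and the
  substitution \<open>x = y * exp B\<close> turn its Mellin transform into \<open>mellin H z\<close> times the expectation of
  \<open>exp (- z * B)\<close> (\<open>mellin_multiplicative_shift\<close>).  Two things remain: this expectation must be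
  finite from every starting state, although the hypothesis only speaks of one initial law, and it
  must be the row sum of the matrix exponential.

  Both follow from the path description.  Given the jump chain and its holding times, \<open>B\<close> is a
  sum of independent pieces, one for each sojourn and one for each jump.  Integrating the noise out
  first leaves the expectation of a weight of the chain alone, the product of the moments
  \<open>exp (\<psi> \<beta> w * h)\<close> over the sojourns and of the moments of the transition jumps
  (\<open>nn_integral_built_level\<close>, \<open>integral_built_level\<close>).

  Splitting the expected weight by the number \<open>n\<close> of jumps and by the current state \<open>\<gamma>\<close> gives
  functions \<open>v n \<gamma> t\<close>.  As the last sojourn before a jump is exponential given the past, they obey
  the recursion in which \<open>v (Suc n) \<gamma> t\<close> integrates \<open>v n \<beta> u * R \<beta> \<gamma> * exp (d \<gamma> * (t - u))\<close> over
  \<open>u\<close> in \<open>{0..t}\<close> and sums over \<open>\<beta>\<close> (\<open>dyson_term_Suc\<close>).  This is the Dyson expansion of the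
  exponential of \<open>F = diag d + R\<close>.  By variation of constants, the exponential minus a partial sum of
  the \<open>v n\<close> obeys the same recursion, and solutions of the recursion decay like \<open>(K * t) ^ n / fact n\<close>;
  hence the series converges to the exponential, with no summability assumed beforehand
  (\<open>dyson_series\<close>).  For weights that are all \<open>1\<close> the rows of \<open>F\<close> sum to \<open>0\<close>, those of its
  exponential to \<open>1\<close>, and this says that the chain does not explode (\<open>AE_no_explosion\<close>).

  For the finiteness, the reduction to path weights is also carried out for nonnegative extended
  integrals, where nothing has to be integrable.  If the expectation is finite from one starting
  state, then the path weight is almost surely finite, and therefore so is each factor that occurs
  with positive probability.  By irreducibility every state and every possible transition occurs
  before \<open>T\<close> with positive probability (\<open>finite_factors\<close>), and an exponential moment of a Levy process
  that is finite at one positive time is finite at all times (\<open>exp_moment_finite\<close>).  So all moments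
  that enter \<open>F\<close> exist, and then the expectation is finite from every starting state.\<close>

section \<open>The matrix exponential as a Dyson series\<close>

abbreviation mpow :: "complex ^ 'n ^ 'n \<Rightarrow> nat \<Rightarrow> complex ^ 'n ^ 'n" where
  "mpow F k \<equiv> ((\<lambda>B. F ** B) ^^ k) (mat 1)"

lemma mpow_Suc_right: "mpow F (Suc k) = mpow F k ** F"
  by (induction k) (simp_all add: matrix_mul_assoc)

lemma mpow_scaleR: "mpow (t *\<^sub>R F) k = (t ^ k) *\<^sub>R mpow F k"
proof (induction k)
  case (Suc k)
  then show ?case
    by (simp add: vec_eq_iff matrix_matrix_mult_def scaleR_sum_right)
qed simp

lemma norm_mpow_le:
  fixes F :: "complex ^ 'n ^ 'n"
  assumes "\<And>a b. norm (F $ a $ b) \<le> K"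
  shows "norm (mpow F k $ a $ b) \<le> (real CARD('n) * K) ^ k"
proof (induction k arbitrary: a b)
  case 0
  then show ?case by (simp add: mat_def)
next
  case (Suc k)
  have "0 \<le> K" using assms[of a a] norm_ge_zero order_trans by blast
  have "norm (mpow F (Suc k) $ a $ b) \<le> (\<Sum>c\<in>UNIV. norm (F $ a $ c) * norm (mpow F k $ c $ b))"
    by (auto simp: matrix_matrix_mult_def norm_mult intro: sum_norm_le)
  also have "\<dots> \<le> (\<Sum>c\<in>(UNIV::'n set). K * (real CARD('n) * K) ^ k)"
    using \<open>0 \<le> K\<close> by (intro sum_mono mult_mono assms Suc) auto
  finally show ?case by simp
qed

lemma matrix_entries_bounded:
  fixes F :: "complex ^ 'n ^ 'n"
  obtains K where "\<And>a b. norm (F $ a $ b) \<le> K"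
proof
  show "norm (F $ a $ b) \<le> norm F" for a b
    using Finite_Cartesian_Product.norm_nth_le[of "F $ a" b]
        Finite_Cartesian_Product.norm_nth_le[of F a] by linarith
qed

lemma summable_mpow:
  fixes F :: "complex ^ 'n ^ 'n" and x :: complex
  shows "summable (\<lambda>k. mpow F k $ a $ b / fact k * x ^ k)"
proof -
  obtain K where K: "\<And>a b. norm (F $ a $ b) \<le> K" using matrix_entries_bounded[of F] by blast
  show ?thesis
  proof (rule summable_comparison_test'[where N = 0])
    show "summable (\<lambda>k. (real CARD('n) * K * norm x) ^ k / fact k)"
      using summable_exp[of "real CARD('n) * K * norm x"] by (simp add: field_simps)
    show "norm (mpow F k $ a $ b / fact k * x ^ k)
        \<le> (real CARD('n) * K * norm x) ^ k / fact k" for k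
      using norm_mpow_le[OF K, of k a b]
      by (simp add: norm_mult norm_divide norm_power power_mult_distrib divide_right_mono
          mult_right_mono)
  qed
qed

text \<open>Read entry by entry, the series defining \<open>matrix_exp\<close> is a scalar power series with infinite
  radius of convergence, which can be differentiated termwise.\<close>

lemma matrix_exp_nth_sums:
  fixes F :: "complex ^ 'n ^ 'n"
  shows "(\<lambda>k. mpow F k $ a $ b / fact k * complex_of_real t ^ k)
      sums (matrix_exp (t *\<^sub>R F) $ a $ b)"
proof -
  define S where "S = (\<chi> a b. \<Sum>k. mpow F k $ a $ b / fact k * complex_of_real t ^ k)"
  have eq: "(\<Sum>k<m. (1 / fact k) *\<^sub>R mpow (t *\<^sub>R F) k) $ a $ b
      = (\<Sum>k<m. mpow F k $ a $ b / fact k * complex_of_real t ^ k)" for m a b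
    by (simp add: mpow_scaleR) (intro sum.cong refl, simp add: scaleR_conv_of_real field_simps)
  have "(\<lambda>k. (1 / fact k) *\<^sub>R mpow (t *\<^sub>R F) k) sums S"
    unfolding sums_def
  proof (intro vec_tendstoI)
    fix a b
    show "(\<lambda>m. (\<Sum>k<m. (1 / fact k) *\<^sub>R mpow (t *\<^sub>R F) k) $ a $ b) \<longlonglongrightarrow> S $ a $ b"
      unfolding eq S_def vec_lambda_beta
      using summable_sums[OF summable_mpow[of F a b "complex_of_real t"]] by (simp add: sums_def)
  qed
  then have "matrix_exp (t *\<^sub>R F) = S"
    unfolding matrix_exp_def by (rule sums_unique[symmetric])
  then show ?thesis
    unfolding S_def using summable_sums[OF summable_mpow[of F a b "complex_of_real t"]] by simp
qed

lemma matrix_exp_0: "matrix_exp (0 *\<^sub>R F) $ a $ b = (if a = b then 1 else 0)"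
proof -
  have "(\<lambda>k. mpow F k $ a $ b / fact k * complex_of_real 0 ^ k) sums (mpow F 0 $ a $ b)"
    using powser_sums_zero[of "\<lambda>k. mpow F k $ a $ b / fact k"] by simp
  from sums_unique2[OF this matrix_exp_nth_sums[of F a b 0]] show ?thesis by (simp add: mat_def)
qed

lemma matrix_exp_has_derivative:
  fixes F :: "complex ^ 'n ^ 'n"
  shows "((\<lambda>t. matrix_exp (t *\<^sub>R F) $ a $ b) has_vector_derivative
     (\<Sum>c\<in>UNIV. matrix_exp (t *\<^sub>R F) $ a $ c * F $ c $ b)) (at t)"
proof -
  let ?c = "\<lambda>k. mpow F k $ a $ b / fact k"
  have exp_eq: "matrix_exp (t *\<^sub>R F) $ a $ b = (\<Sum>k. mpow F k $ a $ b / fact k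
      * complex_of_real t ^ k)" for t a b
    using matrix_exp_nth_sums by (rule sums_unique)
  have "((\<lambda>x. \<Sum>k. ?c k * x ^ k) has_field_derivative (\<Sum>k. diffs ?c k * complex_of_real t ^ k))
      (at (complex_of_real t))"
    by (rule termdiffs_strong_converges_everywhere) (rule summable_mpow)
  then have "((\<lambda>t. \<Sum>k. ?c k * complex_of_real t ^ k) has_vector_derivative
      (\<Sum>k. diffs ?c k * complex_of_real t ^ k)) (at t)"
    by (rule has_vector_derivative_real_field)
  moreover have "(\<lambda>k. diffs ?c k * complex_of_real t ^ k)
      sums (\<Sum>c\<in>UNIV. matrix_exp (t *\<^sub>R F) $ a $ c * F $ c $ b)"
  proof -
    have "(\<lambda>k. \<Sum>c\<in>UNIV. (mpow F k $ a $ c / fact k * complex_of_real t ^ k) * F $ c $ b) sums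
        (\<Sum>c\<in>UNIV. matrix_exp (t *\<^sub>R F) $ a $ c * F $ c $ b)"
      by (intro sums_sum sums_mult2 matrix_exp_nth_sums)
    moreover have "diffs ?c k * complex_of_real t ^ k
        = (\<Sum>c\<in>UNIV. (mpow F k $ a $ c / fact k * complex_of_real t ^ k) * F $ c $ b)" for k
    proof -
      have "diffs ?c k = mpow F (Suc k) $ a $ b / fact k"
        by (simp add: diffs_def del: funpow.simps of_nat_Suc)
      also have "\<dots> = (\<Sum>c\<in>UNIV. mpow F k $ a $ c * F $ c $ b) / fact k"
        by (subst mpow_Suc_right) (simp add: matrix_matrix_mult_def)
      finally have diffs: "diffs ?c k = (\<Sum>c\<in>UNIV. mpow F k $ a $ c * F $ c $ b) / fact k" .
      show ?thesis
        unfolding diffs sum_divide_distrib sum_distrib_right by (simp add: mult_ac)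
    qed
    ultimately show ?thesis by simp
  qed
  ultimately show ?thesis
    unfolding exp_eq by (simp add: sums_iff)
qed

text \<open>The vector of ones lies in the kernel of \<open>F\<close>, so every positive power of \<open>F\<close> has zero row
  sums and only the constant term of the series contributes.\<close>

lemma matrix_exp_row_sum:
  fixes F :: "complex ^ 'n ^ 'n"
  assumes "\<And>a. (\<Sum>b\<in>UNIV. F $ a $ b) = 0"
  shows "(\<Sum>b\<in>UNIV. matrix_exp (t *\<^sub>R F) $ a $ b) = 1"
proof -
  have rs: "(\<Sum>b\<in>UNIV. mpow F k $ a $ b) = (if k = 0 then 1 else 0)" for k
  proof (cases k)
    case 0
    then show ?thesis by (simp add: mat_def)
  next
    case (Suc j)
    have "(\<Sum>b\<in>UNIV. mpow F k $ a $ b) = (\<Sum>b\<in>UNIV. \<Sum>c\<in>UNIV. mpow F j $ a $ c * F $ c $ b)"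
      unfolding Suc by (subst mpow_Suc_right) (simp add: matrix_matrix_mult_def)
    also have "\<dots> = (\<Sum>c\<in>UNIV. mpow F j $ a $ c * (\<Sum>b\<in>UNIV. F $ c $ b))"
      by (subst sum.swap) (simp add: sum_distrib_left)
    finally show ?thesis using Suc assms by simp
  qed
  have "(\<lambda>k. \<Sum>b\<in>UNIV. mpow F k $ a $ b / fact k * complex_of_real t ^ k)
      sums (\<Sum>b\<in>UNIV. matrix_exp (t *\<^sub>R F) $ a $ b)"
    by (intro sums_sum matrix_exp_nth_sums)
  moreover have "(\<Sum>b\<in>UNIV. mpow F k $ a $ b / fact k * complex_of_real t ^ k)
      = (if k = 0 then 1 else 0)" for k
    using rs[of k] by (simp flip: sum_distrib_right sum_divide_distrib)
  moreover have "(\<lambda>k. if k = 0 then 1 else 0 :: complex) sums 1"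
    using sums_single[of 0 "\<lambda>_. 1::complex"] by simp
  ultimately show ?thesis by (simp add: sums_unique2)
qed

text \<open>The integrals over \<open>{0..t}\<close> are nested, so \<open>n\<close> of them contribute the volume \<open>t ^ n / fact n\<close>
  of a simplex; this beats any geometric growth of the kernels.\<close>

lemma dyson_recursion_bound:
  fixes v :: "nat \<Rightarrow> 'n::finite \<Rightarrow> real \<Rightarrow> complex"
  assumes rec: "\<And>n g t. 0 \<le> t \<Longrightarrow> t \<le> T \<Longrightarrow> v (Suc n) g t =
      (LINT u:{0..t}|lborel. (\<Sum>b\<in>UNIV. v n b u * R b g) * exp (d g * of_real (t - u)))"
    and v0: "\<And>g t. 0 \<le> t \<Longrightarrow> t \<le> T \<Longrightarrow> norm (v 0 g t) \<le> C"
    and R: "\<And>b g. norm (R b g) \<le> K" and d: "\<And>g. norm (d g) \<le> K"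
    and t: "0 \<le> t" "t \<le> T"
  shows "norm (v n g t) \<le> C * (real CARD('n) * K * exp (K * T) * t) ^ n / fact n"
  using t
proof (induction n arbitrary: g t)
  case 0
  then show ?case using v0 by simp
next
  case (Suc n)
  define B where "B = real CARD('n) * K * exp (K * T)"
  have K: "0 \<le> K" using d norm_ge_zero order_trans by blast
  have T: "0 \<le> T" using Suc.prems by simp
  have C: "0 \<le> C" using v0[of 0] T norm_ge_zero order_trans by blast
  have B: "0 \<le> B" unfolding B_def using K by simp
  let ?f = "\<lambda>u. (\<Sum>b\<in>UNIV. v n b u * R b g) * exp (d g * of_real (t - u))"
  let ?h = "\<lambda>u::real. C * B ^ Suc n / fact n * u ^ n"
  have int: "((\<lambda>u. C * B ^ Suc n / fact n * u ^ n) has_integral C * B ^ Suc n / fact n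
      * (t ^ Suc n / Suc n)) {0..t}"
  proof -
    have "((\<lambda>u. u ^ n) has_integral t ^ Suc n / Suc n - 0 ^ Suc n / Suc n) {0..t}"
      using Suc.prems by (intro fundamental_theorem_of_calculus)
        (auto intro!: derivative_eq_intros simp flip: has_real_derivative_iff_has_vector_derivative
            simp del: of_nat_Suc power_Suc)
    from has_integral_mult_right[OF this, of "C * B ^ Suc n / fact n"] show ?thesis by simp
  qed
  have si: "set_integrable lborel {0..t} ?h"
    by (rule borel_integrable_atLeastAtMost') (intro continuous_intros)
  have le: "norm (indicator {0..t} u *\<^sub>R ?f u) \<le> indicator {0..t} u *\<^sub>R ?h u" for u
  proof (cases "u \<in> {0..t}")
    case True
    have "norm (?f u) \<le> (\<Sum>b\<in>(UNIV::'n set). C * (B * u) ^ n / fact n * K) * exp (K * T)"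
    proof -
      have "norm (\<Sum>b\<in>UNIV. v n b u * R b g) \<le> (\<Sum>b\<in>(UNIV::'n set). C * (B * u) ^ n / fact n * K)"
      proof (rule sum_norm_le)
        fix b
        have "norm (v n b u) \<le> C * (B * u) ^ n / fact n"
          using Suc.IH[of u b] True Suc.prems by (simp add: B_def)
        then show "norm (v n b u * R b g) \<le> C * (B * u) ^ n / fact n * K"
          unfolding norm_mult using C B True by (intro mult_mono R) auto
      qed
      moreover have "norm (exp (d g * of_real (t - u))) \<le> exp (K * T)"
      proof -
        have "Re (d g * of_real (t - u)) \<le> norm (d g * of_real (t - u))"
            by (rule complex_Re_le_cmod)
        also have "\<dots> = norm (d g) * (t - u)" using True by (simp only: norm_mult norm_of_real) simp
        also have "\<dots> \<le> K * T" using True Suc.prems K by (intro mult_mono d) auto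
        finally show ?thesis by simp
      qed
      ultimately show ?thesis
        unfolding norm_mult
        by (intro mult_mono) (use C B K True in \<open>auto intro!: sum_nonneg\<close>)
    qed
    also have "\<dots> = ?h u"
      by (simp add: B_def power_mult_distrib field_simps)
    finally show ?thesis using True by simp
  qed simp
  have "norm (v (Suc n) g t) \<le> (LINT u:{0..t}|lborel. ?h u)"
    unfolding rec[OF Suc.prems] set_lebesgue_integral_def
    by (rule integral_norm_bound[THEN order_trans], rule integral_mono')
       (use si le C B in \<open>auto simp: set_integrable_def indicator_def\<close>)
  also have "\<dots> = C * B ^ Suc n / fact n * (t ^ Suc n / Suc n)"
    by (rule trans[OF set_borel_integral_eq_integral(2)[OF si] integral_unique[OF int]])
  also have "\<dots> = C * (B * t) ^ Suc n / fact (Suc n)"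
    by (simp add: power_mult_distrib field_simps)
  finally show ?case by (simp only: B_def)
qed

text \<open>The derivative of \<open>u \<mapsto> matrix_exp (u *\<^sub>R F) $ a $ g * exp (d g * (t - u))\<close> cancels the diagonal
  part of \<open>F\<close>; integrating what is left over \<open>{0..t}\<close> gives the identity.\<close>

lemma matrix_exp_variation_of_constants:
  fixes F :: "complex ^ 'n ^ 'n"
  assumes F: "\<And>b g. F $ b $ g = (if b = g then d b else R b g)" and R0: "\<And>b. R b b = 0"
    and t: "0 \<le> t"
  shows "set_integrable lborel {0..t} (\<lambda>u. (\<Sum>b\<in>UNIV. matrix_exp (u *\<^sub>R F) $ a $ b * R b g)
      * exp (d g * of_real (t - u)))"
    and "matrix_exp (t *\<^sub>R F) $ a $ g = (if a = g then exp (d g * of_real t) else 0) +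
     (LINT u:{0..t}|lborel. (\<Sum>b\<in>UNIV. matrix_exp (u *\<^sub>R F) $ a $ b * R b g)
         * exp (d g * of_real (t - u)))"
proof -
  let ?E = "\<lambda>u b. matrix_exp (u *\<^sub>R F) $ a $ b"
  let ?f = "\<lambda>u. (\<Sum>b\<in>UNIV. ?E u b * R b g) * exp (d g * of_real (t - u))"
  have cont: "continuous_on S (\<lambda>u. ?E u b)" for b S
    by (intro continuous_at_imp_continuous_on ballI
        has_vector_derivative_continuous[OF matrix_exp_has_derivative])
  show si: "set_integrable lborel {0..t} ?f"
    by (rule borel_integrable_atLeastAtMost') (intro continuous_intros cont)
  have "((\<lambda>u. ?E u g * exp (d g * of_real (t - u))) has_vector_derivative ?f u)
      (at u within {0..t})" for u
  proof -
    have e: "((\<lambda>u. exp (d g * of_real (t - u))) has_vector_derivative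
        (- d g * exp (d g * of_real (t - u)))) (at u within {0..t})"
    proof -
      have "((\<lambda>w. exp (d g * (of_real t - w))) has_field_derivative
          (- d g * exp (d g * (of_real t - of_real u)))) (at (of_real u))"
        by (auto intro!: derivative_eq_intros)
      from has_vector_derivative_real_field[OF this] show ?thesis
        by (simp add: has_vector_derivative_at_within)
    qed
    have "(\<Sum>b\<in>UNIV. ?E u b * F $ b $ g) = ?E u g * d g + (\<Sum>b\<in>UNIV. ?E u b * R b g)"
    proof -
      have "(\<Sum>b\<in>UNIV. ?E u b * F $ b $ g) = (\<Sum>b\<in>UNIV. (if b = g then ?E u g * d g else 0) + ?E u b
          * R b g)"
        by (intro sum.cong) (auto simp: F R0)
      then show ?thesis by (simp add: sum.distrib)
    qed
    then show ?thesis
      using has_vector_derivative_mult[OF has_vector_derivative_at_within[OF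
          matrix_exp_has_derivative] e, of F a g]
      by (simp add: algebra_simps)
  qed
  from fundamental_theorem_of_calculus[OF t this]
  have "(?f has_integral ?E t g - ?E 0 g * exp (d g * of_real t)) {0..t}" by simp
  then have "(LINT u:{0..t}|lborel. ?f u) = ?E t g - ?E 0 g * exp (d g * of_real t)"
    using set_borel_integral_eq_integral(2)[OF si] by (simp add: integral_unique)
  then show "?E t g = (if a = g then exp (d g * of_real t) else 0) + (LINT u:{0..t}|lborel. ?f u)"
    using matrix_exp_0[of F a g] by (auto split: if_splits)
qed

text \<open>The remainder \<open>matrix_exp (t *\<^sub>R F) $ a $ g - (\<Sum>k<n. v k g t)\<close> satisfies the same recursion as
  \<open>v\<close>, because the exponential satisfies it up to the term \<open>v 0\<close>.  By the bound above it tends to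
  \<open>0\<close>.\<close>

lemma dyson_series:
  fixes F :: "complex ^ 'n ^ 'n"
  assumes F: "\<And>b g. F $ b $ g = (if b = g then d b else R b g)" and R0: "\<And>b. R b b = 0"
    and rec: "\<And>n g t. 0 \<le> t \<Longrightarrow> v (Suc n) g t =
      (LINT u:{0..t}|lborel. (\<Sum>b\<in>UNIV. v n b u * R b g) * exp (d g * of_real (t - u)))"
    and int: "\<And>n g t. 0 \<le> t \<Longrightarrow>
       set_integrable lborel {0..t} (\<lambda>u. (\<Sum>b\<in>UNIV. v n b u * R b g) * exp (d g * of_real (t - u)))"
    and v0: "\<And>g t. 0 \<le> t \<Longrightarrow> v 0 g t = (if a = g then exp (d g * of_real t) else 0)"
    and t: "0 \<le> t"
  shows "(\<lambda>n. v n g t) sums (matrix_exp (t *\<^sub>R F) $ a $ g)"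
proof -
  define r where "r n g t = matrix_exp (t *\<^sub>R F) $ a $ g - (\<Sum>k<n. v k g t)" for n g t
  note voc = matrix_exp_variation_of_constants[OF F R0]
  have r: "r (Suc n) g s = (LINT u:{0..s}|lborel. (\<Sum>b\<in>UNIV. r n b u * R b g)
      * exp (d g * of_real (s - u)))"
    if s: "0 \<le> s" for n g s
  proof -
    have eq: "(\<Sum>b\<in>UNIV. r n b u * R b g) * exp (d g * of_real (s - u)) =
       (\<Sum>b\<in>UNIV. matrix_exp (u *\<^sub>R F) $ a $ b * R b g) * exp (d g * of_real (s - u))
       - (\<Sum>k<n. (\<Sum>b\<in>UNIV. v k b u * R b g) * exp (d g * of_real (s - u)))" for u
    proof -
      have "(\<Sum>b\<in>UNIV. r n b u * R b g) = (\<Sum>b\<in>UNIV. matrix_exp (u *\<^sub>R F) $ a $ b * R b g)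
          - (\<Sum>b\<in>UNIV. \<Sum>k<n. v k b u * R b g)"
        by (simp add: r_def left_diff_distrib sum_subtractf sum_distrib_right)
      also have "(\<Sum>b\<in>UNIV. \<Sum>k<n. v k b u * R b g) = (\<Sum>k<n. \<Sum>b\<in>UNIV. v k b u * R b g)"
        by (rule sum.swap)
      finally show ?thesis by (simp add: left_diff_distrib sum_distrib_right)
    qed
    have i2: "integrable lborel (\<lambda>u. indicator {0..s} u *\<^sub>R ((\<Sum>b\<in>UNIV. v k b u * R b g)
        * exp (d g * of_real (s - u))))" for k
      using int[OF s, of k g] by (simp add: set_integrable_def)
    have "(LINT u:{0..s}|lborel. (\<Sum>b\<in>UNIV. r n b u * R b g) * exp (d g * of_real (s - u)))
      = (LINT u:{0..s}|lborel. (\<Sum>b\<in>UNIV. matrix_exp (u *\<^sub>R F) $ a $ b * R b g)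
          * exp (d g * of_real (s - u)))
        - (\<Sum>k<n. LINT u:{0..s}|lborel. (\<Sum>b\<in>UNIV. v k b u * R b g) * exp (d g * of_real (s - u)))"
      unfolding eq set_lebesgue_integral_def scaleR_diff_right scaleR_sum_right
      by (subst Bochner_Integration.integral_diff[OF
          voc(1)[OF s, of a g, unfolded set_integrable_def]
            Bochner_Integration.integrable_sum[OF i2]], subst
                Bochner_Integration.integral_sum[OF i2]) (rule refl)
    also have "\<dots> = matrix_exp (s *\<^sub>R F) $ a $ g - v 0 g s - (\<Sum>k<n. v (Suc k) g s)"
      using voc(2)[OF s, of a g] v0[OF s] rec[OF s] by simp
    also have "\<dots> = r (Suc n) g s"
      by (simp only: r_def sum.lessThan_Suc_shift) simp
    finally show ?thesis by simp
  qed
  obtain K1 where K1: "\<And>b g. norm (F $ b $ g) \<le> K1" using matrix_entries_bounded[of F] by blast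
  have K10: "0 \<le> K1" using K1[of a a] norm_ge_zero order_trans by blast
  have cont: "continuous_on {0..t} (\<lambda>u. matrix_exp (u *\<^sub>R F) $ a $ b)" for b
    by (intro continuous_at_imp_continuous_on ballI
        has_vector_derivative_continuous[OF matrix_exp_has_derivative])
  have "\<exists>C. \<forall>s\<in>{0..t}. norm (matrix_exp (s *\<^sub>R F) $ a $ b) \<le> C" for b
    using compact_continuous_image[OF cont compact_Icc, THEN compact_imp_bounded]
    by (auto simp: bounded_iff)
  then obtain C where C: "\<And>b s. s \<in> {0..t} \<Longrightarrow> norm (matrix_exp (s *\<^sub>R F) $ a $ b) \<le> C b" by metis
  define C' where "C' = (\<Sum>b\<in>UNIV. \<bar>C b\<bar>)"
  have C': "norm (r 0 b s) \<le> C'" if "0 \<le> s" "s \<le> t" for b s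
  proof -
    have "norm (r 0 b s) \<le> \<bar>C b\<bar>" using C[of s b] that by (simp add: r_def)
    also have "\<dots> \<le> C'" unfolding C'_def by (rule member_le_sum) auto
    finally show ?thesis .
  qed
  let ?B = "real CARD('n) * K1 * exp (K1 * t) * t"
  have bound: "norm (r n g t) \<le> C' * ?B ^ n / fact n" for n
  proof (rule dyson_recursion_bound[where d = d and R = R])
    show "norm (R b g) \<le> K1" for b g using K1[of b g] K10 by (cases "b = g") (auto simp: F R0)
    show "norm (d g) \<le> K1" for g using K1[of g g] by (auto simp: F)
  qed (use r C' t in auto)
  have "(\<lambda>n. C' * (?B ^ n / fact n)) \<longlonglongrightarrow> C' * 0"
    using summable_LIMSEQ_zero[OF summable_exp[of ?B]]
        by (intro tendsto_mult tendsto_const) (simp add: field_simps)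
  then have lim: "(\<lambda>n. C' * ?B ^ n / fact n) \<longlonglongrightarrow> 0"
    by simp
  have "(\<lambda>n. r n g t) \<longlonglongrightarrow> 0"
    by (rule Lim_null_comparison[OF _ lim]) (rule always_eventually, rule allI, rule bound)
  then have "(\<lambda>n. matrix_exp (t *\<^sub>R F) $ a $ g - r n g t) \<longlonglongrightarrow> matrix_exp (t *\<^sub>R F) $ a $ g - 0"
    by (intro tendsto_diff tendsto_const)
  then show ?thesis
    unfolding r_def sums_def by simp
qed

section \<open>Bounds, finite products and restricted measures\<close>

lemma norm_exp_le: "norm (exp (a * of_real t)) \<le> exp (A * t')"
  if "norm (a::complex) \<le> A" "0 \<le> t" "t \<le> t'"
proof -
  have "Re (a * of_real t) \<le> norm (a * of_real t)" by (rule complex_Re_le_cmod)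
  also have "\<dots> = norm a * t" using that by (simp add: norm_mult)
  also have "\<dots> \<le> A * t'" using that norm_ge_zero[of a] by (intro mult_mono) linarith+
  finally show ?thesis by simp
qed

lemma finite_norm_bound:
  fixes a :: "'e::finite \<Rightarrow> complex"
  obtains A where "0 \<le> A" "\<And>\<beta>. norm (a \<beta>) \<le> A"
  using that[of "\<Sum>\<beta>\<in>UNIV. norm (a \<beta>)"] member_le_sum[of _ UNIV "\<lambda>\<beta>. norm (a \<beta>)"]
      by (auto simp: sum_nonneg)

lemma finite_norm_bound2:
  fixes c :: "'e::finite \<Rightarrow> 'e \<Rightarrow> complex"
  obtains C where "0 \<le> C" "\<And>\<beta> \<gamma>. norm (c \<beta> \<gamma>) \<le> C"
  using that[of "\<Sum>x\<in>UNIV. norm (c (fst x) (snd x))"]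
      member_le_sum[of "(_, _)" UNIV "\<lambda>x. norm (c (fst x) (snd x))"]
  by (auto simp: sum_nonneg)

lemma prod_ennreal_finite:
  fixes f :: "'i \<Rightarrow> ennreal"
  assumes "finite I" "(\<Prod>i\<in>I. f i) \<noteq> \<top>" "\<And>i. i \<in> I \<Longrightarrow> f i \<noteq> 0" "i \<in> I"
  shows "f i \<noteq> \<top>"
proof -
  have "(\<Prod>i\<in>I. f i) = f i * (\<Prod>i\<in>I - {i}. f i)" using assms by (intro prod.remove)
  moreover have "(\<Prod>i\<in>I - {i}. f i) \<noteq> 0" using assms by simp
  ultimately show ?thesis using assms(2) by (auto simp: ennreal_mult_eq_top_iff)
qed

lemma (in prob_space) AE_witness:
  assumes "AE \<omega> in M. P \<omega>" "0 < prob S"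
  obtains \<omega> where "\<omega> \<in> S" "\<omega> \<in> space M" "P \<omega>"
proof (rule ccontr)
  assume no: "\<not> thesis"
  have S: "S \<in> sets M" using assms(2) measure_notin_sets by fastforce
  have "AE \<omega> in M. \<omega> \<notin> S"
    using assms(1) by (rule AE_mp) (use no that in \<open>auto intro!: AE_I2\<close>)
  then have "prob S = 0" using S by (simp add: AE_iff_null_sets[symmetric] null_sets_def
      measure_def)
  with assms(2) show False by simp
qed

text \<open>A probability measure restricted to an event \<open>S\<close>, written as a density so that integrals
  against it unfold with the lemmas on densities.\<close>

lemma (in prob_space) emeasure_distr_restrict:
  assumes S: "S \<in> sets M" and f: "f \<in> M \<rightarrow>\<^sub>M K" and B: "B \<in> sets K"
  shows "emeasure (distr (density M (\<lambda>\<omega>. ennreal (indicator S \<omega>))) K f) B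
      = ennreal (prob (f -` B \<inter> S))"
proof -
  have "f \<in> density M (\<lambda>\<omega>. ennreal (indicator S \<omega>)) \<rightarrow>\<^sub>M K" using f by simp
  moreover have "f -` B \<inter> space M \<in> sets M" using f B by (rule measurable_sets)
  moreover have "S \<inter> (f -` B \<inter> space M) = f -` B \<inter> S" using sets.sets_into_space[OF S] by auto
  ultimately show ?thesis
    using S B by (simp add: emeasure_distr ennreal_indicator emeasure_restricted
        emeasure_eq_measure[symmetric])
qed

lemma (in prob_space) finite_measure_distr_restrict:
  assumes S: "S \<in> sets M" and f: "f \<in> M \<rightarrow>\<^sub>M K"
  shows "finite_measure (distr (density M (\<lambda>\<omega>. ennreal (indicator S \<omega>))) K f)"
  by (rule finite_measureI) (simp only: space_distr emeasure_distr_restrict[OF S f sets.top]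
      infinity_ennreal_def ennreal_neq_top not_False_eq_True)

section \<open>The jump chain and its past\<close>

lemma ereal_max_less_iff: "ereal (max a b) < x \<longleftrightarrow> ereal a < x \<and> ereal b < x"
  by simp

text \<open>One starting state at a time: the jump chain and the holding times alone, without the additive
  component.\<close>

locale jump_chain = prob_space N for N :: "'v measure" +
  fixes q :: "'e::finite \<Rightarrow> 'e \<Rightarrow> real" and \<alpha> :: 'e
    and Z :: "nat \<Rightarrow> 'v \<Rightarrow> 'e" and H :: "nat \<Rightarrow> 'v \<Rightarrow> ereal"
  assumes rates: "\<And>\<beta> \<gamma>. \<beta> \<noteq> \<gamma> \<Longrightarrow> 0 \<le> q \<beta> \<gamma>"
    and jump_chain: "is_markov_jump_chain N q \<alpha> Z H"
begin

abbreviation hold :: "nat \<Rightarrow> 'v \<Rightarrow> real" where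
  "hold i \<omega> \<equiv> real_of_ereal (H i \<omega>)"

abbreviation in_sojourn :: "nat \<Rightarrow> real \<Rightarrow> 'v \<Rightarrow> bool" where
  "in_sojourn n t \<omega> \<equiv> jump_time H n \<omega> \<le> ereal t \<and> ereal t < jump_time H (Suc n) \<omega>"

lemma exit_rate_nonneg: "0 \<le> exit_rate q \<beta>"
  unfolding exit_rate_def by (intro sum_nonneg rates) auto

lemma jump_prob_nonneg: "0 \<le> jump_prob q \<beta> \<gamma>"
  using rates[of \<beta> \<gamma>] exit_rate_nonneg[of \<beta>] by (simp add: jump_prob_def)

lemma sum_jump_prob: "(\<Sum>\<gamma>\<in>UNIV. jump_prob q \<beta> \<gamma>) = 1"
proof (cases "exit_rate q \<beta> = 0")
  case False
  have "(\<Sum>\<gamma>\<in>UNIV. jump_prob q \<beta> \<gamma>) = (\<Sum>\<gamma>\<in>UNIV - {\<beta>}. jump_prob q \<beta> \<gamma>)"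
    using False by (intro sum.mono_neutral_right) (auto simp: jump_prob_def)
  also have "\<dots> = exit_rate q \<beta> / exit_rate q \<beta>"
    using False unfolding exit_rate_def sum_divide_distrib
    by (intro sum.cong) (auto simp: jump_prob_def exit_rate_def)
  finally show ?thesis using False by simp
qed (simp add: jump_prob_def)

text \<open>The off-diagonal rates, extended by \<open>0\<close> to the diagonal, whose entries in \<open>q\<close> are arbitrary.\<close>

definition rate :: "'e \<Rightarrow> 'e \<Rightarrow> real" where
  "rate \<beta> \<gamma> = (if \<beta> = \<gamma> then 0 else q \<beta> \<gamma>)"

text \<open>For an absorbing state both sides vanish: the rates out of it are nonnegative with sum \<open>0\<close>.\<close>

lemma jump_prob_exit_rate: "jump_prob q \<beta> \<gamma> * exit_rate q \<beta> = rate \<beta> \<gamma>"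
proof (cases "exit_rate q \<beta> = 0")
  case True
  then have "q \<beta> \<gamma> = 0" if "\<beta> \<noteq> \<gamma>"
    using that rates unfolding exit_rate_def by (subst (asm) sum_nonneg_eq_0_iff) auto
  with True show ?thesis by (simp add: rate_def)
qed (auto simp: jump_prob_def rate_def)

lemma rate_nonneg: "0 \<le> rate \<beta> \<gamma>"
  by (simp add: rate_def rates)

lemma sum_rate: "(\<Sum>\<gamma>\<in>UNIV. rate \<beta> \<gamma>) = exit_rate q \<beta>"
  using sum_jump_prob[of \<beta>] by (simp flip: jump_prob_exit_rate sum_distrib_right)

lemma Z_measurable[measurable]: "Z n \<in> N \<rightarrow>\<^sub>M count_space UNIV"
  and H_measurable[measurable]: "H n \<in> borel_measurable N"
  and H_nonneg: "\<omega> \<in> space N \<Longrightarrow> 0 \<le> H n \<omega>"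
  using jump_chain by (auto simp: is_markov_jump_chain_def)

text \<open>The events whose probabilities define the law of the chain.  The thresholds \<open>h\<close> may be negative,
  so that finitely many cylinders cover the whole space although holding times may be \<open>0\<close> on a null
  set.\<close>

definition cylinder :: "nat \<Rightarrow> (nat \<Rightarrow> 'e) \<Rightarrow> (nat \<Rightarrow> real) \<Rightarrow> 'v set" where
  "cylinder n b h = {\<omega> \<in> space N. (\<forall>i\<le>n. Z i \<omega> = b i) \<and> (\<forall>i<n. ereal (h i) < H i \<omega>)}"

lemma cylinder_sets[measurable]: "cylinder n b h \<in> sets N"
  unfolding cylinder_def by measurable

lemma own_cylinder:
  assumes "\<omega> \<in> space N" "\<And>i. i < n \<Longrightarrow> ereal (h i) < H i \<omega>"
  shows "\<omega> \<in> cylinder n (restrict (\<lambda>j. Z j \<omega>) {..n}) h"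
  using assms by (auto simp: cylinder_def)

lemma own_cylinder_UN:
  assumes "\<omega> \<in> space N" "\<And>i. i < n \<Longrightarrow> ereal (h i) < H i \<omega>"
  shows "\<omega> \<in> (\<Union>b\<in>PiE {..n} (\<lambda>_. UNIV). cylinder n b h)"
  using own_cylinder[of \<omega> n h] assms by (intro UN_I[of "restrict (\<lambda>j. Z j \<omega>) {..n}"]) auto

lemma prob_cylinder: "(\<And>i. 0 \<le> h i) \<Longrightarrow> prob (cylinder n b h) = (if b 0 = \<alpha> then 1 else 0) *
    (\<Prod>i<n. jump_prob q (b i) (b (Suc i)) * exp (- exit_rate q (b i) * h i))"
  using jump_chain unfolding is_markov_jump_chain_def cylinder_def by blast

lemma cylinder_step_nonneg:
  assumes "\<And>i. 0 \<le> h i" "0 \<le> u"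
  shows "prob (cylinder n b h \<inter> {\<omega> \<in> space N. Z (Suc n) \<omega> = \<gamma> \<and> ereal u < H n \<omega>})
    = prob (cylinder n b h) * (jump_prob q (b n) \<gamma> * exp (- exit_rate q (b n) * u))"
proof -
  have "cylinder n b h \<inter> {\<omega> \<in> space N. Z (Suc n) \<omega> = \<gamma> \<and> ereal u < H n \<omega>}
      = cylinder (Suc n) (b(Suc n := \<gamma>)) (h(n := u))"
    by (auto simp: cylinder_def le_Suc_eq less_Suc_eq)
  moreover have "(\<Prod>i<n. jump_prob q ((b(Suc n := \<gamma>)) i) ((b(Suc n := \<gamma>)) (Suc i))
      * exp (- exit_rate q ((b(Suc n := \<gamma>)) i) * (h(n := u)) i))
     = (\<Prod>i<n. jump_prob q (b i) (b (Suc i)) * exp (- exit_rate q (b i) * h i))"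
    by (intro prod.cong) auto
  ultimately show ?thesis
    using assms by (simp add: prob_cylinder)
qed

text \<open>Summing the one-step formula with threshold \<open>0\<close> over all successors shows that a cylinder
  almost surely lies in \<open>{0 < H n}\<close>; there are finitely many paths of each length.\<close>

lemma AE_H_pos: "AE \<omega> in N. \<forall>i. 0 < H i \<omega>"
proof -
  have null: "AE \<omega> in N. \<omega> \<in> cylinder n b (\<lambda>_. 0) \<longrightarrow> 0 < H n \<omega>" for n b
  proof -
    let ?C = "cylinder n b (\<lambda>_. 0)"
    let ?B = "\<lambda>\<gamma>. ?C \<inter> {\<omega> \<in> space N. Z (Suc n) \<omega> = \<gamma> \<and> ereal 0 < H n \<omega>}"
    have "prob (\<Union>\<gamma>\<in>UNIV. ?B \<gamma>) = (\<Sum>\<gamma>\<in>UNIV. prob (?B \<gamma>))"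
      by (rule finite_measure_finite_Union) (auto simp: disjoint_family_on_def)
    also have "\<dots> = prob ?C"
      using sum_jump_prob[of "b n"] by (simp add: cylinder_step_nonneg[where u = 0, simplified]
          flip: sum_distrib_left)
    finally have "prob (?C - (\<Union>\<gamma>\<in>UNIV. ?B \<gamma>)) = 0"
      by (subst finite_measure_Diff) auto
    then have "AE \<omega> in N. \<omega> \<notin> ?C - (\<Union>\<gamma>\<in>UNIV. ?B \<gamma>)"
      by (intro AE_not_in) (simp add: null_sets_def emeasure_eq_measure)
    then show ?thesis
      by (rule AE_mp) (auto simp: cylinder_def zero_ereal_def intro!: AE_I2)
  qed
  have "AE \<omega> in N. \<forall>n. \<forall>b\<in>PiE {..n} (\<lambda>_. UNIV). \<omega> \<in> cylinder n b (\<lambda>_. 0) \<longrightarrow> 0 < H n \<omega>"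
    unfolding AE_all_countable
    by (intro allI AE_ball_countable[THEN iffD2] countable_finite finite_PiE ballI null) auto
  then show ?thesis
  proof (rule AE_mp, intro AE_I2 impI allI)
    fix \<omega> i
    assume *: "\<omega> \<in> space N" "\<forall>n. \<forall>b\<in>PiE {..n} (\<lambda>_. UNIV). \<omega> \<in> cylinder n b (\<lambda>_. 0) \<longrightarrow> 0 < H n \<omega>"
    show "0 < H i \<omega>"
    proof (induction i rule: less_induct)
      case (less i)
      have "\<omega> \<in> cylinder i (restrict (\<lambda>j. Z j \<omega>) {..i}) (\<lambda>_. 0)"
        using less *(1) by (intro own_cylinder) (auto simp: zero_ereal_def)
      then show ?case using *(2) by (meson restrict_PiE_iff UNIV_I)
    qed
  qed
qed

lemma cylinder_step:
  assumes "0 \<le> u"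
  shows "prob (cylinder n b h \<inter> {\<omega> \<in> space N. Z (Suc n) \<omega> = \<gamma> \<and> ereal u < H n \<omega>})
    = prob (cylinder n b h) * (jump_prob q (b n) \<gamma> * exp (- exit_rate q (b n) * u))"
proof -
  have ae: "AE \<omega> in N. \<omega> \<in> cylinder n b h \<longleftrightarrow> \<omega> \<in> cylinder n b (\<lambda>i. max 0 (h i))"
    using AE_H_pos by (rule AE_mp) (intro AE_I2, auto simp: cylinder_def ereal_max_less_iff
        zero_ereal_def)
  have "prob (cylinder n b h) = prob (cylinder n b (\<lambda>i. max 0 (h i)))"
    by (rule finite_measure_eq_AE[OF ae]) auto
  moreover have "prob (cylinder n b h \<inter> {\<omega> \<in> space N. Z (Suc n) \<omega> = \<gamma> \<and> ereal u < H n \<omega>})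
     = prob (cylinder n b (\<lambda>i. max 0 (h i)) \<inter> {\<omega> \<in> space N. Z (Suc n) \<omega> = \<gamma> \<and> ereal u < H n \<omega>})"
    using ae by (intro finite_measure_eq_AE) auto
  ultimately show ?thesis
    using assms by (simp add: cylinder_step_nonneg)
qed

text \<open>The information in \<open>Z 0, \<dots>, Z n\<close> and \<open>H 0, \<dots>, H (n - 1)\<close>, presented by a generator that is
  stable under intersections, so that measures on it are determined by cylinders.\<close>

definition past :: "nat \<Rightarrow> 'v measure" where
  "past n = sigma (space N) (insert {} {cylinder n b h |b h. True})"

lemma space_past[simp]: "space (past n) = space N"
  unfolding past_def by (rule space_measure_of) (auto simp: cylinder_def)

lemma sets_past: "sets (past n) = sigma_sets (space N) (insert {} {cylinder n b h |b h. True})"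
  unfolding past_def by (rule sets_measure_of) (auto simp: cylinder_def)

lemma cylinder_past: "cylinder n b h \<in> sets (past n)"
  unfolding sets_past by (rule sigma_sets.Basic) auto

lemma past_subset: "A \<in> sets (past n) \<Longrightarrow> A \<in> sets N"
proof -
  have "sets (past n) \<subseteq> sets N"
    unfolding sets_past by (intro sets.sigma_sets_subset) auto
  then show "A \<in> sets (past n) \<Longrightarrow> A \<in> sets N" by auto
qed

lemma measurable_past[measurable]: "(\<lambda>\<omega>. \<omega>) \<in> N \<rightarrow>\<^sub>M past n"
  by (auto simp: measurable_def past_subset intro: sets.Int)

lemma Int_stable_cylinders: "Int_stable (insert {} {cylinder n b h |b h. True})"
proof (rule Int_stableI)
  fix a c assume "a \<in> insert {} {cylinder n b h |b h. True}" "c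
      \<in> insert {} {cylinder n b h |b h. True}"
  then consider "a = {}" | "c = {}" | b h b' h' where "a = cylinder n b h" "c = cylinder n b' h'"
    by auto
  then show "a \<inter> c \<in> insert {} {cylinder n b h |b h. True}"
  proof cases
    case (3 b h b' h')
    show ?thesis
    proof (cases "\<forall>i\<le>n. b i = b' i")
      case True
      then have "a \<inter> c = cylinder n b (\<lambda>i. max (h i) (h' i))"
        unfolding 3 cylinder_def by (auto simp: ereal_max_less_iff)
      then show ?thesis by blast
    next
      case False
      then have "a \<inter> c = {}" unfolding 3 by (auto simp: cylinder_def)
      then show ?thesis by simp
    qed
  qed simp_all
qed

lemma cylinder_cover: "(\<Union>b\<in>PiE {..n} (\<lambda>_. UNIV). cylinder n b (\<lambda>_. -1)) = space N"
proof (intro equalityI subsetI)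
  fix \<omega> assume \<omega>: "\<omega> \<in> space N"
  have "- 1 < H i \<omega>" for i using H_nonneg[OF \<omega>, of i] by (rule less_le_trans[rotated]) simp
  then show "\<omega> \<in> (\<Union>b\<in>PiE {..n} (\<lambda>_. UNIV). cylinder n b (\<lambda>_. -1))"
    by (intro own_cylinder_UN) (use \<omega> in \<open>auto simp: one_ereal_def\<close>)
qed (auto simp: cylinder_def)

lemma Z_past:
  assumes "i \<le> n" shows "Z i \<in> past n \<rightarrow>\<^sub>M count_space UNIV"
proof (subst measurable_count_space_eq2, simp, intro conjI ballI)
  fix \<beta>
  have "Z i -` {\<beta>} \<inter> space (past n) = (\<Union>b\<in>{b \<in> PiE {..n} (\<lambda>_. UNIV). b i = \<beta>}. cylinder n b
      (\<lambda>_. -1))"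
  proof (intro equalityI subsetI)
    fix \<omega> assume "\<omega> \<in> Z i -` {\<beta>} \<inter> space (past n)"
    moreover from this obtain b where "b \<in> PiE {..n} (\<lambda>_. UNIV)" "\<omega> \<in> cylinder n b (\<lambda>_. -1)"
      using cylinder_cover[of n] by auto
    ultimately show "\<omega> \<in> (\<Union>b\<in>{b \<in> PiE {..n} (\<lambda>_. UNIV). b i = \<beta>}. cylinder n b (\<lambda>_. -1))"
      using assms by (auto simp: cylinder_def)
  qed (use assms in \<open>auto simp: cylinder_def\<close>)
  also have "\<dots> \<in> sets (past n)"
    by (intro sets.finite_UN finite_subset[OF _ finite_PiE[of "{..n}" "\<lambda>_. UNIV"]] cylinder_past)
        auto
  finally show "Z i -` {\<beta>} \<inter> space (past n) \<in> sets (past n)" .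
qed auto

lemma H_past:
  assumes "i < n" shows "H i \<in> borel_measurable (past n)"
  unfolding borel_measurable_ereal_iff_Ioi
proof
  fix a :: ereal
  consider r where "a = ereal r" | "a = \<infinity>" | "a = -\<infinity>" by (cases a) auto
  then show "H i -` {a<..} \<inter> space (past n) \<in> sets (past n)"
  proof cases
    case 1
    have gt: "- 1 < H i \<omega>" if "\<omega> \<in> space N" for i \<omega>
      using H_nonneg[OF that, of i] by (rule less_le_trans[rotated]) simp
    have "H i -` {a<..} \<inter> space (past n) = (\<Union>b\<in>PiE {..n} (\<lambda>_. UNIV). cylinder n b
        ((\<lambda>_. -1)(i := r)))"
    proof (intro equalityI subsetI)
      fix \<omega> assume "\<omega> \<in> H i -` {a<..} \<inter> space (past n)"
      then show "\<omega> \<in> (\<Union>b\<in>PiE {..n} (\<lambda>_. UNIV). cylinder n b ((\<lambda>_. -1)(i := r)))"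
        by (intro own_cylinder_UN) (use gt 1 in \<open>auto simp: one_ereal_def\<close>)
    qed (use assms 1 in \<open>auto simp: cylinder_def\<close>)
    also have "\<dots> \<in> sets (past n)"
      by (intro sets.finite_UN finite_PiE cylinder_past) auto
    finally show ?thesis .
  next
    case 3
    have "-\<infinity> < H i \<omega>" if "\<omega> \<in> space N" for \<omega>
      using H_nonneg[OF that, of i] by (cases "H i \<omega>") auto
    with 3 have "H i -` {a<..} \<inter> space (past n) = space (past n)" by auto
    then show ?thesis using sets.top[of "past n"] by simp
  qed (simp add: greaterThan_def vimage_def)
qed

text \<open>The Markov property of the jump chain at its \<open>n\<close>-th jump.  For cylinders it is the quotient of
  two defining formulas; both sides are finite measures in \<open>A\<close>, hence agree on all of the past.\<close>

lemma jump_step: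
  assumes A: "A \<in> sets (past n)" and u: "0 \<le> u"
  shows "prob (A \<inter> {\<omega> \<in> space N. Z n \<omega> = \<beta> \<and> Z (Suc n) \<omega> = \<gamma> \<and> ereal u < H n \<omega>})
    = prob (A \<inter> {\<omega> \<in> space N. Z n \<omega> = \<beta>}) * (jump_prob q \<beta> \<gamma> * exp (- exit_rate q \<beta> * u))"
proof -
  define c where "c = jump_prob q \<beta> \<gamma> * exp (- exit_rate q \<beta> * u)"
  have c: "0 \<le> c" by (simp add: c_def jump_prob_nonneg)
  let ?S = "{\<omega> \<in> space N. Z n \<omega> = \<beta> \<and> Z (Suc n) \<omega> = \<gamma> \<and> ereal u < H n \<omega>}"
  let ?R = "{\<omega> \<in> space N. Z n \<omega> = \<beta>}"
  let ?M1 = "distr (density N (indicator ?S)) (past n) (\<lambda>\<omega>. \<omega>)"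
  let ?M2 = "scale_measure (ennreal c) (distr (density N (indicator ?R)) (past n) (\<lambda>\<omega>. \<omega>))"
  have e: "emeasure (distr (density N (indicator S)) (past n) (\<lambda>\<omega>. \<omega>)) B = ennreal (prob (B \<inter> S))"
    if "S \<in> sets N" "B \<in> sets (past n)" for S B
  proof -
    have "(\<lambda>\<omega>. \<omega>) \<in> density N (indicator S) \<rightarrow>\<^sub>M past n" by simp
    then show ?thesis
      using that past_subset[OF that(2)] sets.sets_into_space[OF past_subset[OF that(2)]]
      by (simp add: emeasure_distr emeasure_restricted Int_absorb2 emeasure_eq_measure[symmetric]
          Int_commute)
  qed
  have S: "?S \<in> sets N" and R: "?R \<in> sets N" by measurable
  have "?M1 = ?M2"
  proof (rule measure_eqI_generator_eq_countable[where \<Omega> = "space N"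
        and E = "insert {} {cylinder n b h |b h. True}"
        and A = "(\<lambda>b. cylinder n b (\<lambda>_. -1)) ` PiE {..n} (\<lambda>_. UNIV)"])
    fix B assume B: "B \<in> insert {} {cylinder n b h |b h. True}"
    then have B': "B \<in> sets (past n)" unfolding sets_past by (rule sigma_sets.Basic)
    show "emeasure ?M1 B = emeasure ?M2 B"
    proof (cases "B = {}")
      case False
      with B obtain b h where b: "B = cylinder n b h" by auto
      have "prob (B \<inter> ?S) = c * prob (B \<inter> ?R)"
      proof (cases "b n = \<beta>")
        case True
        then have "B \<inter> ?R = B" "B \<inter> ?S = cylinder n b h \<inter> {\<omega> \<in> space N. Z (Suc n) \<omega> = \<gamma>
            \<and> ereal u < H n \<omega>}"
          by (auto simp: b cylinder_def)
        then show ?thesis using cylinder_step[OF u, of n b h \<gamma>] True by (simp add: c_def b)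
      next
        case False
        then have "B \<inter> ?R = {}" "B \<inter> ?S = {}" by (auto simp: b cylinder_def)
        then show ?thesis by simp
      qed
      then show ?thesis
        by (simp only: emeasure_scale_measure e[OF S B'] e[OF R B']) (simp add: ennreal_mult c)
    qed simp
  next
    show "\<Union> ((\<lambda>b. cylinder n b (\<lambda>_. -1)) ` PiE {..n} (\<lambda>_. UNIV)) = space N"
      by (rule cylinder_cover)
    show "countable ((\<lambda>b. cylinder n b (\<lambda>_. -1)) ` PiE {..n} (\<lambda>_. UNIV))"
      by (intro countable_image countable_finite finite_PiE) auto
  next
    fix a assume "a \<in> (\<lambda>b. cylinder n b (\<lambda>_. -1)) ` PiE {..n} (\<lambda>_. UNIV)"
    then have "a \<in> sets (past n)" using cylinder_past by auto
    then show "emeasure ?M1 a \<noteq> \<infinity>" by (simp only: e[OF S]) simp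
  next
    show "insert {} {cylinder n b h |b h. True} \<subseteq> Pow (space N)" by (auto simp: cylinder_def)
  qed (auto simp only: Int_stable_cylinders sets_past sets_distr sets_scale_measure)
  then have "emeasure ?M1 A = emeasure ?M2 A" by simp
  then have "ennreal (prob (A \<inter> ?S)) = ennreal (c * prob (A \<inter> ?R))"
    by (simp only: emeasure_scale_measure e[OF S A] e[OF R A]) (simp add: ennreal_mult c)
  then show ?thesis using c by (simp add: c_def mult.commute)
qed

end

section \<open>The law of one sojourn given the past\<close>

context jump_chain begin

abbreviation sojourn_density :: "'e \<Rightarrow> 'e \<Rightarrow> real \<Rightarrow> real" where
  "sojourn_density \<beta> \<gamma> h \<equiv> if 0 \<le> h then rate \<beta> \<gamma> * exp (- exit_rate q \<beta> * h) else 0"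

text \<open>The law of a holding time in \<open>\<beta>\<close> that ends with a jump to \<open>\<gamma>\<close>, restricted to that event.  Its
  total mass is \<open>jump_prob q \<beta> \<gamma>\<close>, and it is the zero measure when \<open>\<beta>\<close> is absorbing.\<close>

definition sojourn_law :: "'e \<Rightarrow> 'e \<Rightarrow> real measure" where
  "sojourn_law \<beta> \<gamma> = density lborel (\<lambda>h. ennreal (sojourn_density \<beta> \<gamma> h))"

lemma sets_sojourn_law[simp, measurable_cong]: "sets (sojourn_law \<beta> \<gamma>) = sets borel"
  and space_sojourn_law[simp]: "space (sojourn_law \<beta> \<gamma>) = UNIV"
  by (auto simp: sojourn_law_def)

lemma sojourn_law_atMost:
  "emeasure (sojourn_law \<beta> \<gamma>) {..u} =
     ennreal (if 0 \<le> u then jump_prob q \<beta> \<gamma> * (1 - exp (- exit_rate q \<beta> * u)) else 0)"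
proof -
  have "emeasure (sojourn_law \<beta> \<gamma>) {..u} = (\<integral>\<^sup>+h. ennreal (rate \<beta> \<gamma> * exp (- exit_rate q \<beta> * h))
      * indicator {0..u} h \<partial>lborel)"
    unfolding sojourn_law_def
    by (subst emeasure_density) (auto intro!: nn_integral_cong simp: indicator_def)
  also have "\<dots> = ennreal (if 0 \<le> u then jump_prob q \<beta> \<gamma> * (1 - exp (- exit_rate q \<beta> * u)) else 0)"
  proof (cases "0 \<le> u")
    case True
    have "(\<integral>\<^sup>+h. ennreal (rate \<beta> \<gamma> * exp (- exit_rate q \<beta> * h)) * indicator {0..u} h \<partial>lborel)
      = ennreal (- jump_prob q \<beta> \<gamma> * exp (- exit_rate q \<beta> * u)
          - (- jump_prob q \<beta> \<gamma> * exp (- exit_rate q \<beta> * 0)))"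
      using True
      by (intro nn_integral_FTC_Icc)
        (auto intro!: derivative_eq_intros simp: jump_prob_nonneg exit_rate_nonneg simp flip:
            jump_prob_exit_rate)
    then show ?thesis using True by (simp add: algebra_simps)
  qed simp
  finally show ?thesis .
qed

lemma sigma_finite_sojourn_law: "sigma_finite_measure (sojourn_law \<beta> \<gamma>)"
proof (rule sigma_finite_measure.intro, intro exI conjI)
  show "\<Union> (range (\<lambda>k::nat. {..real k})) = space (sojourn_law \<beta> \<gamma>)"
    by (auto intro: real_arch_simple)
  show "\<forall>a\<in>range (\<lambda>k::nat. {..real k}). emeasure (sojourn_law \<beta> \<gamma>) a \<noteq> \<infinity>"
    by (auto simp: sojourn_law_atMost)
qed auto

text \<open>The joint law of the past and the current holding time is a product measure on the event that
  the current state is \<open>\<beta>\<close>, the next one \<open>\<gamma>\<close> and the holding time finite: the Markov property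
  \<open>jump_step\<close>, extended from half-lines to Borel sets of holding times.\<close>

lemma past_sojourn_law:
  "distr (density N (\<lambda>\<omega>. ennreal (indicator {\<omega> \<in> space N. Z n \<omega> = \<beta> \<and> Z (Suc n) \<omega> = \<gamma> \<and> H n \<omega> < \<infinity>}
      \<omega>)))
     (past n \<Otimes>\<^sub>M borel) (\<lambda>\<omega>. (\<omega>, hold n \<omega>))
   = distr (density N (\<lambda>\<omega>. ennreal (indicator {\<omega> \<in> space N. Z n \<omega> = \<beta>} \<omega>))) (past n) (\<lambda>\<omega>. \<omega>) \<Otimes>\<^sub>M
       sojourn_law \<beta> \<gamma>"
  (is "?L = ?M1 \<Otimes>\<^sub>M ?M2")
proof (rule sym, rule pair_measure_eqI)
  let ?S = "{\<omega> \<in> space N. Z n \<omega> = \<beta> \<and> Z (Suc n) \<omega> = \<gamma> \<and> H n \<omega> < \<infinity>}"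
  let ?R = "{\<omega> \<in> space N. Z n \<omega> = \<beta>}"
  have S: "?S \<in> sets N" and R: "?R \<in> sets N" by measurable
  show "sigma_finite_measure ?M1"
    by (rule finite_measure.sigma_finite_measure[OF
        finite_measure_distr_restrict[OF R measurable_past]])
  show "sigma_finite_measure ?M2" by (rule sigma_finite_sojourn_law)
  have "sets (?M1 \<Otimes>\<^sub>M ?M2) = sets (past n \<Otimes>\<^sub>M borel)"
    by (rule sets_pair_measure_cong) (simp_all only: sets_distr sets_sojourn_law)
  then show "sets (?M1 \<Otimes>\<^sub>M ?M2) = sets ?L"
    by (simp only: sets_distr)
  fix A B assume "A \<in> sets ?M1" and "B \<in> sets ?M2"
  then have A: "A \<in> sets (past n)" and B: "B \<in> sets borel" by auto
  have AN: "A \<in> sets N" using past_subset[OF A] .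
  have AS: "A \<inter> ?S \<in> sets N" using AN S by auto
  have M1A: "emeasure ?M1 A = ennreal (prob (A \<inter> ?R))"
    using emeasure_distr_restrict[OF R measurable_past A] by simp
  let ?K1 = "distr (density N (\<lambda>\<omega>. ennreal (indicator (A \<inter> ?S) \<omega>))) borel (\<lambda>\<omega>. hold n \<omega>)"
  have K1: "emeasure ?K1 C = ennreal (prob ((\<lambda>\<omega>. hold n \<omega>) -` C \<inter> (A \<inter> ?S)))" if "C
      \<in> sets borel" for C
    by (rule emeasure_distr_restrict[OF AS _ that]) measurable
  have "?K1 = scale_measure (emeasure ?M1 A) ?M2"
  proof (rule measure_eqI_generator_eq_countable[where \<Omega> = UNIV and E = "range (\<lambda>u::real. {..u})"
        and A = "range (\<lambda>k::nat. {..real k})"])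
    fix C assume "C \<in> range (\<lambda>u::real. {..u})"
    then obtain u where C: "C = {..u}" by auto
    have "prob ((\<lambda>\<omega>. hold n \<omega>) -` C \<inter> (A \<inter> ?S)) =
       prob (A \<inter> ?R) * (if 0 \<le> u then jump_prob q \<beta> \<gamma> * (1 - exp (- exit_rate q \<beta> * u)) else 0)"
    proof (cases "0 \<le> u")
      case False
      then have "(\<lambda>\<omega>. hold n \<omega>) -` C \<inter> (A \<inter> ?S) = {}"
        using H_nonneg[of _ n] by (auto simp: C) (meson order_trans real_of_ereal_pos)
      with False show ?thesis by simp
    next
      case True
      let ?T = "\<lambda>u::real. A \<inter> {\<omega> \<in> space N. Z n \<omega> = \<beta> \<and> Z (Suc n) \<omega> = \<gamma> \<and> ereal u < H n \<omega>}"
      have T: "?T u \<in> sets N" for u using AN by measurable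
      have "(\<lambda>\<omega>. hold n \<omega>) -` C \<inter> space N \<inter> (A \<inter> ?S) \<in> sets N"
        using C by (intro sets.Int[OF _ AS] measurable_sets[where A = borel]) auto
      also have "(\<lambda>\<omega>. hold n \<omega>) -` C \<inter> space N \<inter> (A \<inter> ?S) = (\<lambda>\<omega>. hold n \<omega>) -` C \<inter> (A \<inter> ?S)"
        by auto
      finally have sub: "(\<lambda>\<omega>. hold n \<omega>) -` C \<inter> (A \<inter> ?S) \<in> sets N" .
      \<comment> \<open>A finite holding time at most \<open>u\<close> is one that exceeds \<open>0\<close>, as it does almost surely,
        but not \<open>u\<close>.\<close>
      have "prob ((\<lambda>\<omega>. hold n \<omega>) -` C \<inter> (A \<inter> ?S)) = prob (?T 0 - ?T u)"
      proof (rule finite_measure_eq_AE)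
        show "AE \<omega> in N. \<omega> \<in> (\<lambda>\<omega>. hold n \<omega>) -` C \<inter> (A \<inter> ?S) \<longleftrightarrow> \<omega> \<in> ?T 0 - ?T u"
        proof (rule AE_mp[OF AE_H_pos], intro AE_I2 impI)
          fix \<omega> assume "\<omega> \<in> space N" "\<forall>i. 0 < H i \<omega>"
          then show "\<omega> \<in> (\<lambda>\<omega>. hold n \<omega>) -` C \<inter> (A \<inter> ?S) \<longleftrightarrow> \<omega> \<in> ?T 0 - ?T u"
            by (cases "H n \<omega>") (auto simp: C zero_ereal_def dest!: spec[of _ n])
        qed
      qed (use sub T in auto)
      also have "\<dots> = prob (?T 0) - prob (?T u)"
      proof (rule finite_measure_Diff)
        show "?T u \<subseteq> ?T 0" using True by (auto intro: le_less_trans[rotated])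
      qed (use T in auto)
      also have "\<dots> = prob (A \<inter> ?R) * (jump_prob q \<beta> \<gamma> * (1 - exp (- exit_rate q \<beta> * u)))"
        using jump_step[OF A, of 0 \<beta> \<gamma>] jump_step[OF A True, of \<beta> \<gamma>] by (simp add: algebra_simps)
      finally show ?thesis using True by simp
    qed
    moreover have "C \<in> sets borel" by (simp add: C)
    ultimately have "emeasure ?K1 C = emeasure ?M1 A * emeasure ?M2 C"
      unfolding M1A C sojourn_law_atMost ennreal_mult'[OF measure_nonneg, symmetric]
      by (simp only: K1)
    then show "emeasure ?K1 C = emeasure (scale_measure (emeasure ?M1 A) ?M2) C" by simp
  next
    show "Int_stable (range (\<lambda>u::real. {..u}))"
    proof (rule Int_stableI)
      fix a b assume "a \<in> range (\<lambda>u::real. {..u})" "b \<in> range (\<lambda>u::real. {..u})"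
      then obtain u v where "a = {..u}" "b = {..v}" by auto
      then have "a \<inter> b = {..min u v}" by auto
      then show "a \<inter> b \<in> range (\<lambda>u::real. {..u})" by blast
    qed
    show "sets ?K1 = sigma_sets UNIV (range (\<lambda>u::real. {..u}))"
       "sets (scale_measure (emeasure ?M1 A) ?M2) = sigma_sets UNIV (range (\<lambda>u::real. {..u}))"
      by (simp_all add: borel_eq_atMost)
    show "\<Union> (range (\<lambda>k::nat. {..real k})) = UNIV" by (auto intro: real_arch_simple)
    show "emeasure ?K1 a \<noteq> \<infinity>" if "a \<in> range (\<lambda>k::nat. {..real k})" for a
      using that by (subst K1) auto
  qed auto
  then have "emeasure ?M1 A * emeasure ?M2 B = emeasure ?K1 B" by simp
  also have "\<dots> = ennreal (prob ((\<lambda>\<omega>. (\<omega>, hold n \<omega>)) -` (A \<times> B) \<inter> ?S))"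
    by (subst K1[OF B]) (auto intro!: arg_cong[of _ _ prob])
  also have "\<dots> = emeasure ?L (A \<times> B)"
    by (rule emeasure_distr_restrict[symmetric, OF S]) (use A B in auto)
  finally show "emeasure ?M1 A * emeasure ?M2 B = emeasure ?L (A \<times> B)" .
qed

text \<open>Integral form of the product law.  The holding time \<open>h\<close> may enter \<open>\<Phi>\<close> jointly with the past,
  which is needed because the time left until \<open>t\<close> depends on both.\<close>

lemma integral_jump_step:
  fixes \<Phi> :: "'v \<Rightarrow> real \<Rightarrow> complex"
  assumes m: "case_prod \<Phi> \<in> borel_measurable (past n \<Otimes>\<^sub>M borel)"
    and bound: "\<And>\<omega> h. \<omega> \<in> space N \<Longrightarrow> 0 \<le> h \<Longrightarrow> norm (\<Phi> \<omega> h) \<le> B"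
  shows "(LINT \<omega>|N. (if Z n \<omega> = \<beta> \<and> Z (Suc n) \<omega> = \<gamma> \<and> H n \<omega> < \<infinity> then \<Phi> \<omega> (hold n \<omega>) else 0))
    = (LINT \<omega>|N. (if Z n \<omega> = \<beta> then LINT h|lborel. sojourn_density \<beta> \<gamma> h *\<^sub>R \<Phi> \<omega> h else 0))"
proof -
  let ?S = "{\<omega> \<in> space N. Z n \<omega> = \<beta> \<and> Z (Suc n) \<omega> = \<gamma> \<and> H n \<omega> < \<infinity>}"
  let ?R = "{\<omega> \<in> space N. Z n \<omega> = \<beta>}"
  let ?f = "\<lambda>\<omega>. (\<omega>, hold n \<omega>)"
  let ?M1 = "distr (density N (\<lambda>\<omega>. ennreal (indicator ?R \<omega>))) (past n) (\<lambda>\<omega>. \<omega>)"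
  let ?M2 = "sojourn_law \<beta> \<gamma>"
  have S: "?S \<in> sets N" and R: "?R \<in> sets N" by measurable
  have f[measurable]: "?f \<in> N \<rightarrow>\<^sub>M past n \<Otimes>\<^sub>M borel" by measurable
  interpret M1: finite_measure ?M1 by (rule finite_measure_distr_restrict[OF R measurable_past])
  interpret M2: sigma_finite_measure ?M2 by (rule sigma_finite_sojourn_law)
  interpret pair_sigma_finite ?M1 ?M2 ..
  note law = past_sojourn_law[of n \<beta> \<gamma>]
  have \<Phi>f[measurable]: "(\<lambda>\<omega>. \<Phi> \<omega> (hold n \<omega>)) \<in> borel_measurable N"
    using measurable_compose[OF f m] by simp
  have "(LINT \<omega>|N. (if Z n \<omega> = \<beta> \<and> Z (Suc n) \<omega> = \<gamma> \<and> H n \<omega> < \<infinity> then \<Phi> \<omega> (hold n \<omega>) else 0))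
    = (LINT \<omega>|N. indicator ?S \<omega> *\<^sub>R \<Phi> \<omega> (hold n \<omega>))"
    by (intro Bochner_Integration.integral_cong) (auto simp: indicator_def)
  also have "\<dots> = (LINT \<omega>|density N (\<lambda>\<omega>. ennreal (indicator ?S \<omega>)). \<Phi> \<omega> (hold n \<omega>))"
    using S by (intro integral_density[symmetric]) auto
  also have "\<dots> = (LINT x|(?M1 \<Otimes>\<^sub>M ?M2). case_prod \<Phi> x)"
    unfolding law[symmetric] by (subst integral_distr) (use m f in auto)
  also have "\<dots> = (LINT \<omega>|?M1. LINT h|?M2. \<Phi> \<omega> h)"
  proof -
    have "integrable (density N (\<lambda>\<omega>. ennreal (indicator ?S \<omega>))) (\<lambda>\<omega>. \<Phi> \<omega> (hold n \<omega>))"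
    proof -
      have "integrable N (\<lambda>\<omega>. indicator ?S \<omega> *\<^sub>R \<Phi> \<omega> (hold n \<omega>))"
      proof (rule integrable_const_bound[where B = "\<bar>B\<bar>"])
        show "AE \<omega> in N. norm (indicator ?S \<omega> *\<^sub>R \<Phi> \<omega> (hold n \<omega>)) \<le> \<bar>B\<bar>"
          using bound H_nonneg by (auto intro!: AE_I2 simp: indicator_def real_of_ereal_pos
              order_trans[OF _ abs_ge_self])
      qed (use S in auto)
      then show ?thesis
        using S by (subst integrable_density) auto
    qed
    then have "integrable (?M1 \<Otimes>\<^sub>M ?M2) (case_prod \<Phi>)"
      unfolding law[symmetric] using m f by (subst integrable_distr_eq) auto
    from integral_fst'[OF this] show ?thesis by simp
  qed
  also have "\<dots> = (LINT \<omega>|?M1. LINT h|lborel. sojourn_density \<beta> \<gamma> h *\<^sub>R \<Phi> \<omega> h)"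
  proof (rule Bochner_Integration.integral_cong[OF refl])
    fix \<omega> assume "\<omega> \<in> space ?M1"
    then have "\<Phi> \<omega> \<in> borel_measurable borel"
      using measurable_compose[OF measurable_Pair1' m, of \<omega>] by simp
    then show "(LINT h|?M2. \<Phi> \<omega> h) = (LINT h|lborel. sojourn_density \<beta> \<gamma> h *\<^sub>R \<Phi> \<omega> h)"
      unfolding sojourn_law_def by (subst integral_density) (auto simp: rate_nonneg)
  qed
  also have "\<dots> = (LINT \<omega>|density N (\<lambda>\<omega>. ennreal (indicator ?R \<omega>)). LINT h|lborel. sojourn_density \<beta>
      \<gamma> h *\<^sub>R \<Phi> \<omega> h)"
  proof -
    have [measurable]: "case_prod \<Phi> \<in> borel_measurable (past n \<Otimes>\<^sub>M lborel)" using m by simp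
    have "(\<lambda>\<omega>. LINT h|lborel. sojourn_density \<beta> \<gamma> h *\<^sub>R \<Phi> \<omega> h) \<in> borel_measurable (past n)"
      by measurable
    then show ?thesis by (subst integral_distr) auto
  qed
  also have "\<dots> = (LINT \<omega>|N. indicator ?R \<omega> *\<^sub>R (LINT h|lborel. sojourn_density \<beta> \<gamma> h *\<^sub>R \<Phi> \<omega> h))"
  proof -
    have [measurable]: "case_prod \<Phi> \<in> borel_measurable (past n \<Otimes>\<^sub>M lborel)" using m by simp
    have "(\<lambda>\<omega>. LINT h|lborel. sojourn_density \<beta> \<gamma> h *\<^sub>R \<Phi> \<omega> h) \<in> borel_measurable (past n)"
      by measurable
    then have "(\<lambda>\<omega>. LINT h|lborel. sojourn_density \<beta> \<gamma> h *\<^sub>R \<Phi> \<omega> h) \<in> borel_measurable N"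
      by (rule measurable_compose[OF measurable_past])
    then show ?thesis using R by (subst integral_density) auto
  qed
  also have "\<dots> = (LINT \<omega>|N. (if Z n \<omega> = \<beta> then LINT h|lborel. sojourn_density \<beta> \<gamma> h *\<^sub>R \<Phi> \<omega> h else
      0))"
    by (intro Bochner_Integration.integral_cong) (auto simp: indicator_def)
  finally show ?thesis .
qed

end

section \<open>Expected path weights by number of jumps\<close>

context jump_chain begin

text \<open>The real-valued version of \<open>jump_time\<close>, equal to it as long as no holding time is infinite.\<close>

definition clock :: "nat \<Rightarrow> 'v \<Rightarrow> real" where
  "clock n \<omega> = (\<Sum>i<n. hold i \<omega>)"

lemma clock_nonneg: "\<omega> \<in> space N \<Longrightarrow> 0 \<le> clock n \<omega>"
  unfolding clock_def by (intro sum_nonneg) (simp add: real_of_ereal_pos H_nonneg)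

lemma jump_time_eq_clock:
  assumes "\<omega> \<in> space N" "\<And>i. i < n \<Longrightarrow> H i \<omega> < \<infinity>"
  shows "jump_time H n \<omega> = ereal (clock n \<omega>)"
proof -
  have "(\<Sum>i<n. H i \<omega>) = (\<Sum>i<n. ereal (hold i \<omega>))"
  proof (rule sum.cong[OF refl])
    fix i assume "i \<in> {..<n}"
    then show "H i \<omega> = ereal (hold i \<omega>)"
      using H_nonneg[OF assms(1), of i] assms(2)[of i] by (cases "H i \<omega>") auto
  qed
  then show ?thesis by (simp add: jump_time_def clock_def)
qed

lemma jump_time_infinite_iff: "jump_time H n \<omega> = \<infinity> \<longleftrightarrow> (\<exists>i<n. H i \<omega> = \<infinity>)"
  unfolding jump_time_def by (auto simp: sum_Pinfty)

lemma jump_time_le_iff: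
  assumes "\<omega> \<in> space N"
  shows "jump_time H n \<omega> \<le> ereal t \<longleftrightarrow> (\<forall>i<n. H i \<omega> < \<infinity>) \<and> clock n \<omega> \<le> t"
proof (cases "\<forall>i<n. H i \<omega> < \<infinity>")
  case True
  then show ?thesis using jump_time_eq_clock[OF assms, of n] by simp
next
  case False
  then have "jump_time H n \<omega> = \<infinity>" by (auto simp: jump_time_infinite_iff)
  then show ?thesis using False by simp
qed

lemma clock_eq:
  assumes "\<omega> \<in> space N" "jump_time H n \<omega> \<noteq> \<infinity>"
  shows "real_of_ereal (jump_time H n \<omega>) = clock n \<omega>"
  using jump_time_eq_clock[OF assms(1), of n] assms(2) by (auto simp: jump_time_infinite_iff)

lemma jump_time_mono:
  assumes "\<omega> \<in> space N" "m \<le> n"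
  shows "jump_time H m \<omega> \<le> jump_time H n \<omega>"
  unfolding jump_time_def using assms by (intro sum_mono2) (auto simp: H_nonneg)

lemma jump_time_measurable[measurable]: "jump_time H n \<in> borel_measurable N"
  unfolding jump_time_def by measurable

lemma clock_measurable[measurable]: "clock n \<in> borel_measurable N"
  unfolding clock_def by measurable

lemma clock_past[measurable]: "clock n \<in> borel_measurable (past n)"
  unfolding clock_def by (intro borel_measurable_sum borel_measurable_real_of_ereal H_past) auto

lemma jump_time_past[measurable]: "jump_time H n \<in> borel_measurable (past n)"
  unfolding jump_time_def by (intro borel_measurable_ereal_sum H_past) auto

text \<open>The part of the path weight that is settled at the \<open>n\<close>-th jump: \<open>a \<beta>\<close> is the exponent earned per
  unit of time in \<open>\<beta>\<close>, and \<open>c \<beta> \<gamma>\<close> the factor for a jump from \<open>\<beta>\<close> to \<open>\<gamma>\<close>.\<close>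

definition path_factor :: "('e \<Rightarrow> complex) \<Rightarrow> ('e \<Rightarrow> 'e \<Rightarrow> complex) \<Rightarrow> nat \<Rightarrow> 'v \<Rightarrow> complex" where
  "path_factor a c n \<omega> = (\<Prod>i<n. exp (a (Z i \<omega>) * of_real (hold i \<omega>)) * c (Z i \<omega>) (Z (Suc i) \<omega>))"

lemma path_factor_past[measurable]: "path_factor a c n \<in> borel_measurable (past n)"
proof -
  have "(\<lambda>\<omega>. exp (a (Z i \<omega>) * of_real (hold i \<omega>)) * c (Z i \<omega>) (Z (Suc i) \<omega>))
      \<in> borel_measurable (past n)" if "i < n" for i
  proof -
    have [measurable]: "Z i \<in> past n \<rightarrow>\<^sub>M count_space UNIV" "Z (Suc i) \<in> past n \<rightarrow>\<^sub>M count_space UNIV"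
        "H i \<in> borel_measurable (past n)"
      using that by (auto intro: Z_past H_past)
    have [measurable]: "(\<lambda>\<omega>. c (Z i \<omega>) (Z (Suc i) \<omega>)) \<in> borel_measurable (past n)"
      by (rule measurable_compose_countable[OF measurable_compose_countable]) measurable
    show ?thesis by measurable
  qed
  then show ?thesis unfolding path_factor_def by (intro borel_measurable_prod) auto
qed

lemma path_factor_measurable[measurable]: "path_factor a c n \<in> borel_measurable N"
  by (rule measurable_compose[OF measurable_past]) measurable

lemma path_factor_Suc: "path_factor a c (Suc n) \<omega> =
    path_factor a c n \<omega> * (exp (a (Z n \<omega>) * of_real (hold n \<omega>)) * c (Z n \<omega>) (Z (Suc n) \<omega>))"
  by (simp add: path_factor_def)

lemma clock_Suc: "clock (Suc n) \<omega> = clock n \<omega> + real_of_ereal (H n \<omega>)"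
  by (simp add: clock_def)

lemma jump_time_Suc_le_iff:
  assumes "\<omega> \<in> space N"
  shows "jump_time H (Suc n) \<omega> \<le> ereal t \<longleftrightarrow>
     H n \<omega> < \<infinity> \<and> jump_time H n \<omega> \<le> ereal t \<and> clock n \<omega> + hold n \<omega> \<le> t"
  using clock_nonneg[OF assms, of n] real_of_ereal_pos[OF H_nonneg[OF assms, of n]]
  by (auto simp: jump_time_le_iff[OF assms] clock_Suc less_Suc_eq)

lemma norm_path_factor:
  assumes "\<And>\<beta>. norm (a \<beta>) \<le> A" "\<And>\<beta> \<gamma>. norm (c \<beta> \<gamma>) \<le> C" "\<omega> \<in> space N"
  shows "norm (path_factor a c n \<omega>) \<le> exp (A * clock n \<omega>) * C ^ n"
proof (induction n)
  case 0
  then show ?case by (simp add: path_factor_def clock_def)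
next
  case (Suc n)
  have "0 \<le> C" using assms(2)[of \<alpha> \<alpha>] norm_ge_zero order_trans by blast
  moreover have "norm (exp (a (Z n \<omega>) * of_real (hold n \<omega>))) \<le> exp (A * hold n \<omega>)"
    by (rule norm_exp_le[OF assms(1) real_of_ereal_pos[OF H_nonneg[OF assms(3)]] order_refl])
  ultimately have "norm (path_factor a c (Suc n) \<omega>) \<le> (exp (A * clock n \<omega>) * C ^ n)
      * (exp (A * hold n \<omega>) * C)"
    unfolding path_factor_Suc norm_mult by (intro mult_mono Suc assms(2)) auto
  then show ?case by (simp add: clock_Suc distrib_left exp_add mult_ac)
qed

text \<open>The expected weight of the paths with \<open>n\<close> jumps up to time \<open>t\<close> and current state \<open>\<gamma>\<close>, see
  \<open>dyson_term_eq\<close>.  The event that the current sojourn lasts beyond \<open>t\<close> is already integrated out: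
  it accounts for \<open>exit_rate q \<gamma>\<close> in the exponent.  In this form only the past enters.\<close>

definition dyson_term :: "('e \<Rightarrow> complex) \<Rightarrow> ('e \<Rightarrow> 'e \<Rightarrow> complex) \<Rightarrow> nat \<Rightarrow> 'e \<Rightarrow> real \<Rightarrow> complex" where
  "dyson_term a c n \<gamma> t = (LINT \<omega>|N. (if Z n \<omega> = \<gamma> \<and> jump_time H n \<omega> \<le> ereal t
      then path_factor a c n \<omega> * exp ((a \<gamma> - of_real (exit_rate q \<gamma>)) * of_real (t - clock n \<omega>))
          else 0))"

text \<open>On the event that \<open>n\<close> jumps fit into a bounded time span the weight is bounded, so every
  integral over a fixed number of jumps exists.\<close>

lemma path_factor_bound:
  fixes a d :: "'e \<Rightarrow> complex" and c t n
  obtains B where "\<And>\<omega> \<gamma> s. \<omega> \<in> space N \<Longrightarrow> jump_time H n \<omega> \<le> ereal s \<Longrightarrow> s \<le> t \<Longrightarrow>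
     norm (path_factor a c n \<omega> * exp (d \<gamma> * of_real (s - clock n \<omega>))) \<le> B"
    and "0 \<le> B"
proof -
  obtain A1 where A1: "0 \<le> A1" "\<And>\<beta>. norm (a \<beta>) \<le> A1" using finite_norm_bound[of a] by blast
  obtain A2 where A2: "0 \<le> A2" "\<And>\<beta>. norm (d \<beta>) \<le> A2"
    using finite_norm_bound[of d] by blast
  obtain C where C: "0 \<le> C" "\<And>\<beta> \<gamma>. norm (c \<beta> \<gamma>) \<le> C" using finite_norm_bound2[of c] by blast
  show thesis
  proof (rule that[of "(exp (A1 * t) * C ^ n) * exp (A2 * t)"])
    fix \<omega> \<gamma> s assume *: "\<omega> \<in> space N" "jump_time H n \<omega> \<le> ereal s" "s \<le> t"
    then have cl: "0 \<le> clock n \<omega>" "clock n \<omega> \<le> s" using jump_time_le_iff clock_nonneg by auto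
    have "norm (path_factor a c n \<omega>) \<le> exp (A1 * clock n \<omega>) * C ^ n"
      by (rule norm_path_factor[OF A1(2) C(2) *(1)])
    also have "\<dots> \<le> exp (A1 * t) * C ^ n"
      using A1 C cl * by (intro mult_right_mono) (auto intro: mult_left_mono)
    finally have 1: "norm (path_factor a c n \<omega>) \<le> exp (A1 * t) * C ^ n" .
    have "norm (exp (d \<gamma> * of_real (s - clock n \<omega>))) \<le> exp (A2 * t)"
      by (rule norm_exp_le[OF A2(2)]) (use cl * in auto)
    with 1 show "norm (path_factor a c n \<omega> * exp (d \<gamma> * of_real (s - clock n \<omega>)))
        \<le> (exp (A1 * t) * C ^ n) * exp (A2 * t)"
      unfolding norm_mult using C by (intro mult_mono) auto
  qed (use C in auto)
qed

lemma dyson_term_0: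
  assumes "0 \<le> t"
  shows "dyson_term a c 0 \<gamma> t = (if \<alpha> = \<gamma> then exp ((a \<gamma> - of_real (exit_rate q \<gamma>)) * of_real t)
      else 0)"
proof -
  have "prob (cylinder 0 (\<lambda>_. \<alpha>) (\<lambda>_. 0)) = 1" by (subst prob_cylinder) auto
  then have "AE \<omega> in N. \<omega> \<in> cylinder 0 (\<lambda>_. \<alpha>) (\<lambda>_. 0)" by (subst (asm) prob_eq_1) auto
  then have ae: "AE \<omega> in N. Z 0 \<omega> = \<alpha>" by (rule AE_mp) (auto simp: cylinder_def)
  have "dyson_term a c 0 \<gamma> t = (LINT \<omega>|N. (if \<alpha>
      = \<gamma> then exp ((a \<gamma> - of_real (exit_rate q \<gamma>)) * of_real t) else 0))"
    unfolding dyson_term_def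
    by (rule integral_cong_AE)
      (use ae assms in \<open>auto simp: jump_time_def path_factor_def clock_def zero_ereal_def\<close>)
  then show ?thesis by (simp add: prob_space)
qed

text \<open>Condition on the past of the \<open>n\<close>-th jump.  The current sojourn in \<open>\<beta>\<close> then has density
  \<open>rate \<beta> \<gamma> * exp (- exit_rate q \<beta> * h)\<close> for a jump to \<open>\<gamma>\<close> after time \<open>h\<close>.  With \<open>u = clock n \<omega> + h\<close>
  as the time of that jump, the factor \<open>exp (- exit_rate q \<beta> * h)\<close> joins the weight of the sojourn to
  give the integrand of \<open>dyson_term a c n \<beta> u\<close>, and Fubini moves the integral over \<open>u\<close> outside.\<close>

lemma dyson_term_Suc:
  fixes a d :: "'e \<Rightarrow> complex" and c R :: "'e \<Rightarrow> 'e \<Rightarrow> complex"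
  assumes "0 \<le> t"
    and R_def: "\<And>\<beta> \<gamma>. R \<beta> \<gamma> = of_real (rate \<beta> \<gamma>) * c \<beta> \<gamma>"
    and d_def: "\<And>\<gamma>. d \<gamma> = a \<gamma> - of_real (exit_rate q \<gamma>)"
  shows "set_integrable lborel {0..t} (\<lambda>u. dyson_term a c n \<beta> u * R \<beta> \<gamma>
      * exp (d \<gamma> * of_real (t - u)))"
    and "dyson_term a c (Suc n) \<gamma> t =
     (LINT u:{0..t}|lborel. (\<Sum>\<beta>\<in>UNIV. dyson_term a c n \<beta> u * R \<beta> \<gamma>) * exp (d \<gamma> * of_real (t - u)))"
proof -
  obtain B0 where B0: "\<And>\<omega> \<gamma> s. \<omega> \<in> space N \<Longrightarrow> jump_time H n \<omega> \<le> ereal s \<Longrightarrow> s \<le> t \<Longrightarrow>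
     norm (path_factor a c n \<omega> * exp (d \<gamma> * of_real (s - clock n \<omega>))) \<le> B0" and B0': "0 \<le> B0"
    using path_factor_bound[of n t a c d] by metis
  obtain A where A: "0 \<le> A" "\<And>\<beta>. norm (d \<beta>) \<le> A" using finite_norm_bound[of d] by blast
  obtain A1 where A1: "0 \<le> A1" "\<And>\<beta>. norm (a \<beta>) \<le> A1" using finite_norm_bound[of a] by blast
  \<comment> \<open>The integrand after the substitution: the integrand of \<open>dyson_term a c n \<beta> u\<close>, a jump to
    \<open>\<gamma>\<close> at time \<open>u\<close>, and a sojourn in \<open>\<gamma>\<close> until \<open>t\<close>.\<close>
  let ?\<Psi> = "\<lambda>\<beta> \<omega> u. if u \<in> {0..t} \<and> Z n \<omega> = \<beta> \<and> jump_time H n \<omega> \<le> ereal u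
      then path_factor a c n \<omega> * exp (d \<beta> * of_real (u - clock n \<omega>)) * R \<beta> \<gamma>
          * exp (d \<gamma> * of_real (t - u)) else 0"
  interpret L: pair_sigma_finite N lborel ..
  have \<Psi>: "integrable (N \<Otimes>\<^sub>M lborel) (\<lambda>(\<omega>, u). ?\<Psi> \<beta> \<omega> u)" for \<beta>
  proof (rule Bochner_Integration.integrable_bound)
    let ?g = "\<lambda>(\<omega>::'v, u::real). indicator (space N \<times> {0..t}) (\<omega>, u) *\<^sub>R
        (B0 * norm (R \<beta> \<gamma>) * exp (A * t))"
    show "integrable (N \<Otimes>\<^sub>M lborel) ?g"
    proof -
      have "emeasure (N \<Otimes>\<^sub>M lborel) (space N \<times> {0..t}) = emeasure N (space N)
          * emeasure lborel {0..t}"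
        by (rule lborel.emeasure_pair_measure_Times) auto
      then have "emeasure (N \<Otimes>\<^sub>M lborel) (space N \<times> {0..t}) < \<infinity>"
        using \<open>0 \<le> t\<close> by (simp add: emeasure_space_1)
      then show ?thesis by (auto simp: split_beta')
    qed
    show "(\<lambda>(\<omega>, u). ?\<Psi> \<beta> \<omega> u) \<in> borel_measurable (N \<Otimes>\<^sub>M lborel)" by measurable
    show "AE x in N \<Otimes>\<^sub>M lborel. norm (case x of (\<omega>, u) \<Rightarrow> ?\<Psi> \<beta> \<omega> u) \<le> norm (?g x)"
    proof (rule AE_I2)
      fix x :: "'v \<times> real" assume "x \<in> space (N \<Otimes>\<^sub>M lborel)"
      then obtain \<omega> and u :: real where x: "x = (\<omega>, u)" and \<omega>: "\<omega> \<in> space N"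
        by (auto simp: space_pair_measure)
      have "norm (?\<Psi> \<beta> \<omega> u) \<le> norm (?g (\<omega>, u))"
      proof (cases "u \<in> {0..t} \<and> Z n \<omega> = \<beta> \<and> jump_time H n \<omega> \<le> ereal u")
        case True
        have "norm (exp (d \<gamma> * of_real (t - u))) \<le> exp (A * t)"
          by (rule norm_exp_le[OF A(2)]) (use True in auto)
        then have "norm (?\<Psi> \<beta> \<omega> u) \<le> B0 * norm (R \<beta> \<gamma>) * exp (A * t)"
          using True B0[OF \<omega>, of u \<beta>] B0' by (auto simp: norm_mult intro!: mult_mono)
        then show ?thesis using True \<omega> B0' by simp
      qed auto
      then show "norm (case x of (\<omega>, u) \<Rightarrow> ?\<Psi> \<beta> \<omega> u) \<le> norm (?g x)" by (simp only: x prod.case)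
    qed
  qed
  have inner: "(LINT \<omega>|N. ?\<Psi> \<beta> \<omega> u) = indicator {0..t} u *\<^sub>R (dyson_term a c n \<beta> u * R \<beta> \<gamma>
      * exp (d \<gamma> * of_real (t - u)))" for \<beta> u
  proof -
    have "(LINT \<omega>|N. ?\<Psi> \<beta> \<omega> u) = (LINT \<omega>|N. (if Z n \<omega> = \<beta> \<and> jump_time H n \<omega> \<le> ereal u
      then path_factor a c n \<omega> * exp (d \<beta> * of_real (u - clock n \<omega>)) else 0)
          * (indicator {0..t} u *\<^sub>R (R \<beta> \<gamma> * exp (d \<gamma> * of_real (t - u)))))"
      by (rule Bochner_Integration.integral_cong) (auto simp: indicator_def)
    then show ?thesis unfolding dyson_term_def d_def by simp
  qed
  show si: "set_integrable lborel {0..t} (\<lambda>u. dyson_term a c n \<beta> u * R \<beta> \<gamma>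
      * exp (d \<gamma> * of_real (t - u)))" for \<beta>
    unfolding set_integrable_def inner[symmetric]
    using L.integrable_snd[OF \<Psi>[of \<beta>]] by simp
  \<comment> \<open>The integrand of \<open>dyson_term a c (Suc n) \<gamma> t\<close> as a function of the past and the length \<open>h\<close>
    of the sojourn in \<open>\<beta>\<close>.\<close>
  let ?\<Phi> = "\<lambda>\<beta> \<omega> h. if 0 \<le> h \<and> jump_time H n \<omega> \<le> ereal t \<and> clock n \<omega> + h \<le> t
     then path_factor a c n \<omega> * (exp (a \<beta> * of_real h) * c \<beta> \<gamma>)
         * exp (d \<gamma> * of_real (t - (clock n \<omega> + h))) else 0"
  obtain C where C: "0 \<le> C" "\<And>\<beta> \<gamma>. norm (c \<beta> \<gamma>) \<le> C" using finite_norm_bound2[of c] by blast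
  have \<Phi>_bound: "norm (?\<Phi> \<beta> \<omega> h) \<le> B0 * (exp (A1 * t) * C) * exp (A * t)" if "\<omega> \<in> space N" "0
      \<le> h" for \<beta> \<omega> h
  proof (cases "jump_time H n \<omega> \<le> ereal t \<and> clock n \<omega> + h \<le> t")
    case True
    have cl: "0 \<le> clock n \<omega>" "jump_time H n \<omega> \<le> ereal (clock n \<omega>)" "clock n \<omega> \<le> t"
      using clock_nonneg[OF that(1)] True that(2) by (auto simp: jump_time_le_iff[OF that(1)])
    have "norm (path_factor a c n \<omega>) \<le> B0"
      using B0[OF that(1) cl(2,3)] by simp
    moreover have "norm (exp (a \<beta> * of_real h)) \<le> exp (A1 * t)"
      by (rule norm_exp_le[OF A1(2)]) (use cl True that in auto)
    moreover have "norm (exp (d \<gamma> * of_real (t - (clock n \<omega> + h)))) \<le> exp (A * t)"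
      by (rule norm_exp_le[OF A(2)]) (use cl True that in auto)
    ultimately show ?thesis
      using True that C B0' by (auto simp: norm_mult intro!: mult_mono)
  qed (use B0' C in auto)
  have \<Phi>_meas: "case_prod (?\<Phi> \<beta>) \<in> borel_measurable (past n \<Otimes>\<^sub>M borel)" for \<beta>
    by measurable
  have "dyson_term a c (Suc n) \<gamma> t = (LINT \<omega>|N. (\<Sum>\<beta>\<in>UNIV. if Z n \<omega> = \<beta> \<and> Z (Suc n) \<omega> = \<gamma>
      \<and> H n \<omega> < \<infinity> then ?\<Phi> \<beta> \<omega> (hold n \<omega>) else 0))"
    unfolding dyson_term_def
  proof (rule Bochner_Integration.integral_cong[OF refl])
    fix \<omega> assume \<omega>: "\<omega> \<in> space N"
    have "(\<Sum>\<beta>\<in>UNIV. if Z n \<omega> = \<beta> \<and> Z (Suc n) \<omega> = \<gamma> \<and> H n \<omega> < \<infinity> then ?\<Phi> \<beta> \<omega> (hold n \<omega>) else 0)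
      = (\<Sum>\<beta>\<in>UNIV. if Z n \<omega> = \<beta> then if Z (Suc n) \<omega> = \<gamma>
          \<and> H n \<omega> < \<infinity> then ?\<Phi> \<beta> \<omega> (hold n \<omega>) else 0 else 0)"
      by (intro sum.cong) auto
    also have "\<dots> = (if Z (Suc n) \<omega> = \<gamma> \<and> H n \<omega> < \<infinity> then ?\<Phi> (Z n \<omega>) \<omega> (hold n \<omega>) else 0)"
      by (subst sum.delta') auto
    finally show "(if Z (Suc n) \<omega> = \<gamma> \<and> jump_time H (Suc n) \<omega> \<le> ereal t
         then path_factor a c (Suc n) \<omega> * exp ((a \<gamma> - of_real (exit_rate q \<gamma>))
             * of_real (t - clock (Suc n) \<omega>)) else 0)
      = (\<Sum>\<beta>\<in>UNIV. if Z n \<omega> = \<beta> \<and> Z (Suc n) \<omega> = \<gamma> \<and> H n \<omega> < \<infinity> then ?\<Phi> \<beta> \<omega> (hold n \<omega>) else 0)"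
      using real_of_ereal_pos[OF H_nonneg[OF \<omega>, of n]]
      by (simp add: jump_time_Suc_le_iff[OF \<omega>] path_factor_Suc clock_Suc d_def)
  qed
  also have "\<dots> = (\<Sum>\<beta>\<in>UNIV. LINT \<omega>|N. (if Z n \<omega> = \<beta> \<and> Z (Suc n) \<omega> = \<gamma>
      \<and> H n \<omega> < \<infinity> then ?\<Phi> \<beta> \<omega> (hold n \<omega>) else 0))"
  proof (rule Bochner_Integration.integral_sum, rule integrable_const_bound[where B = "B0
      * (exp (A1 * t) * C) * exp (A * t)"])
    fix \<beta>
    show "AE \<omega> in N. norm (if Z n \<omega> = \<beta> \<and> Z (Suc n) \<omega> = \<gamma> \<and> H n \<omega> < \<infinity> then ?\<Phi> \<beta> \<omega> (hold n \<omega>) else 0)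
        \<le> B0 * (exp (A1 * t) * C) * exp (A * t)"
    proof (intro AE_I2)
      fix \<omega> assume \<omega>: "\<omega> \<in> space N"
      from \<Phi>_bound[OF \<omega> real_of_ereal_pos[OF H_nonneg[OF \<omega>, of n]], of \<beta>] B0' C(1)
      show "norm (if Z n \<omega> = \<beta> \<and> Z (Suc n) \<omega> = \<gamma> \<and> H n \<omega> < \<infinity> then ?\<Phi> \<beta> \<omega> (hold n \<omega>) else 0)
        \<le> B0 * (exp (A1 * t) * C) * exp (A * t)"
            by (simp only: if_distrib[of norm] split: if_split) simp
    qed
    show "(\<lambda>\<omega>. if Z n \<omega> = \<beta> \<and> Z (Suc n) \<omega> = \<gamma> \<and> H n \<omega> < \<infinity> then ?\<Phi> \<beta> \<omega> (hold n \<omega>) else 0)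
        \<in> borel_measurable N"
      by measurable
  qed
  also have "\<dots> = (\<Sum>\<beta>\<in>UNIV. LINT \<omega>|N. LINT u|lborel. ?\<Psi> \<beta> \<omega> u)"
  proof (rule sum.cong[OF refl])
    fix \<beta>
    have main: "(LINT h|lborel. sojourn_density \<beta> \<gamma> h *\<^sub>R ?\<Phi> \<beta> \<omega> h)
        = (LINT u|lborel. ?\<Psi> \<beta> \<omega> u)" if \<omega>: "\<omega> \<in> space N" and Z: "Z n \<omega> = \<beta>" for \<omega>
    proof -
      have e: "of_real (exp (- exit_rate q \<beta> * h)) * exp (a \<beta> * of_real h)
          = exp (d \<beta> * of_real h)" for h
        unfolding exp_of_real[symmetric] exp_add[symmetric] d_def by (simp add: algebra_simps)
      have "(LINT h|lborel. sojourn_density \<beta> \<gamma> h *\<^sub>R ?\<Phi> \<beta> \<omega> h)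
        = (LINT u|lborel. (if 0 \<le> u - clock n \<omega> then rate \<beta> \<gamma>
            * exp (- exit_rate q \<beta> * (u - clock n \<omega>)) else 0) *\<^sub>R ?\<Phi> \<beta> \<omega> (u - clock n \<omega>))"
      proof -
        have shift: "- clock n \<omega> + 1 * u = u - clock n \<omega>" for u by simp
        show ?thesis
          by (subst lborel_integral_real_affine[where c = 1 and t = "- clock n \<omega>"])
              (simp_all only: shift, simp_all)
      qed
      also have "\<dots> = (LINT u|lborel. ?\<Psi> \<beta> \<omega> u)"
      proof (rule Bochner_Integration.integral_cong[OF refl])
        fix u
        show "(if 0 \<le> u - clock n \<omega> then rate \<beta> \<gamma> * exp (- exit_rate q \<beta> * (u - clock n \<omega>)) else 0)
            *\<^sub>R ?\<Phi> \<beta> \<omega> (u - clock n \<omega>)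
           = ?\<Psi> \<beta> \<omega> u"
        proof (cases "u \<in> {0..t} \<and> jump_time H n \<omega> \<le> ereal u")
          case True
          then have "clock n \<omega> \<le> u" "jump_time H n \<omega> \<le> ereal t"
              by (auto simp: jump_time_le_iff[OF \<omega>])
          with True Z show ?thesis
            using e[of "u - clock n \<omega>"] by (simp add: scaleR_conv_of_real R_def)
        next
          case False
          then have "\<not> (clock n \<omega> \<le> u \<and> jump_time H n \<omega> \<le> ereal t \<and> u \<le> t)"
            using clock_nonneg[OF \<omega>, of n] by (auto simp: jump_time_le_iff[OF \<omega>])
          with False show ?thesis by auto
        qed
      qed
      finally show ?thesis .
    qed
    have "(LINT \<omega>|N. (if Z n \<omega> = \<beta> then LINT h|lborel. sojourn_density \<beta> \<gamma> h *\<^sub>R ?\<Phi> \<beta> \<omega> h else 0))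
       = (LINT \<omega>|N. LINT u|lborel. ?\<Psi> \<beta> \<omega> u)"
    proof (rule Bochner_Integration.integral_cong[OF refl])
      fix \<omega> assume \<omega>: "\<omega> \<in> space N"
      show "(if Z n \<omega> = \<beta> then LINT h|lborel. sojourn_density \<beta> \<gamma> h *\<^sub>R ?\<Phi> \<beta> \<omega> h else 0)
         = (LINT u|lborel. ?\<Psi> \<beta> \<omega> u)"
      proof (cases "Z n \<omega> = \<beta>")
        case True
        show ?thesis unfolding if_P[OF True] by (rule main[OF \<omega> True])
      qed simp
    qed
    then show "(LINT \<omega>|N. (if Z n \<omega> = \<beta> \<and> Z (Suc n) \<omega> = \<gamma>
        \<and> H n \<omega> < \<infinity> then ?\<Phi> \<beta> \<omega> (hold n \<omega>) else 0))
       = (LINT \<omega>|N. LINT u|lborel. ?\<Psi> \<beta> \<omega> u)"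
      by (rule trans[rotated]) (rule integral_jump_step[OF \<Phi>_meas], erule (1) \<Phi>_bound)
  qed
  also have "\<dots> = (\<Sum>\<beta>\<in>UNIV. LINT u|lborel. LINT \<omega>|N. ?\<Psi> \<beta> \<omega> u)"
    by (intro sum.cong refl L.Fubini_integral[symmetric] \<Psi>)
  also have "\<dots> = (LINT u:{0..t}|lborel. (\<Sum>\<beta>\<in>UNIV. dyson_term a c n \<beta> u * R \<beta> \<gamma>)
      * exp (d \<gamma> * of_real (t - u)))"
    unfolding inner set_lebesgue_integral_def
    by (subst Bochner_Integration.integral_sum[OF si[unfolded set_integrable_def], symmetric])
      (simp add: scaleR_sum_right sum_distrib_right)
  finally show "dyson_term a c (Suc n) \<gamma> t = \<dots>" .
qed

end

section \<open>Expected path weights and the generator\<close>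

text \<open>The value type is left open: extended nonnegative reals serve for moments that may be infinite,
  complex numbers for the final formula.\<close>

definition path_weight ::
  "(nat \<Rightarrow> 'v \<Rightarrow> 'e) \<Rightarrow> (nat \<Rightarrow> 'v \<Rightarrow> ereal) \<Rightarrow> ('e \<Rightarrow> real \<Rightarrow> 'b) \<Rightarrow> ('e \<Rightarrow> 'e \<Rightarrow> 'b) \<Rightarrow> real \<Rightarrow> 'v \<Rightarrow>
      'b::comm_monoid_mult" where
  "path_weight Z H g c t \<omega> = (let n = jump_count H t \<omega> in
     (\<Prod>i<n. g (Z i \<omega>) (real_of_ereal (H i \<omega>)) * c (Z i \<omega>) (Z (Suc i) \<omega>)) *
     g (Z n \<omega>) (t - real_of_ereal (jump_time H n \<omega>)))"

lemma jump_count_measurable: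
  assumes [measurable]: "\<And>n. H n \<in> borel_measurable K"
  shows "jump_count H t \<in> K \<rightarrow>\<^sub>M count_space UNIV"
  unfolding jump_count_def jump_time_def by measurable

lemma path_weight_measurable:
  fixes c :: "'e::finite \<Rightarrow> 'e \<Rightarrow> 'b::{comm_monoid_mult, topological_space}"
  assumes H[measurable]: "\<And>n. H n \<in> borel_measurable K" and Z[measurable]: "\<And>n. Z n
      \<in> K \<rightarrow>\<^sub>M count_space UNIV"
    and g[measurable]: "\<And>\<beta>. g \<beta> \<in> borel_measurable borel"
    and prod: "\<And>f h. f \<in> borel_measurable K \<Longrightarrow> h \<in> borel_measurable K \<Longrightarrow> (\<lambda>\<omega>. f \<omega> * h \<omega> :: 'b)
        \<in> borel_measurable K"
  shows "path_weight Z H g c t \<in> borel_measurable K"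
proof -
  have c: "(\<lambda>\<omega>. c (Z i \<omega>) (Z (Suc i) \<omega>)) \<in> borel_measurable K" for i
    by (rule measurable_compose_countable[OF measurable_compose_countable]) measurable
  have gz: "(\<lambda>\<omega>. g (Z i \<omega>) (f \<omega>)) \<in> borel_measurable K" if [measurable]: "f
      \<in> borel_measurable K" for i f
    by (rule measurable_compose_countable[OF _ Z]) measurable
  have p: "(\<lambda>\<omega>. \<Prod>i<n. g (Z i \<omega>) (real_of_ereal (H i \<omega>)) * c (Z i \<omega>) (Z (Suc i) \<omega>))
      \<in> borel_measurable K" for n
    by (induction n) (auto intro!: prod gz c)
  have "(\<lambda>\<omega>. (\<Prod>i<n. g (Z i \<omega>) (real_of_ereal (H i \<omega>)) * c (Z i \<omega>) (Z (Suc i) \<omega>)) *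
     g (Z n \<omega>) (t - real_of_ereal (jump_time H n \<omega>))) \<in> borel_measurable K" for n
    by (intro prod p gz) (unfold jump_time_def, measurable)
  from measurable_compose_countable[where f = "\<lambda>n \<omega>. (\<Prod>i<n. g (Z i \<omega>) (real_of_ereal (H i \<omega>))
      * c (Z i \<omega>) (Z (Suc i) \<omega>)) *
     g (Z n \<omega>) (t - real_of_ereal (jump_time H n \<omega>))", OF this
         jump_count_measurable[of H K t, OF H]]
  show ?thesis unfolding path_weight_def Let_def .
qed

context jump_chain begin

abbreviation exp_weight :: "('e \<Rightarrow> complex) \<Rightarrow> ('e \<Rightarrow> 'e \<Rightarrow> complex) \<Rightarrow> real \<Rightarrow> 'v \<Rightarrow> complex" where
  "exp_weight a c \<equiv> path_weight Z H (\<lambda>\<beta> s. exp (a \<beta> * of_real s)) c"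

lemma integrable_path_factor:
  fixes a d :: "'e \<Rightarrow> complex"
  assumes [measurable]: "Measurable.pred N Q"
  shows "integrable N (\<lambda>\<omega>. if Q \<omega> \<and> jump_time H n \<omega> \<le> ereal t
      then path_factor a c n \<omega> * exp (d (Z n \<omega>) * of_real (t - clock n \<omega>)) else 0)"
proof -
  obtain B where B: "\<And>\<omega> \<gamma> s. \<omega> \<in> space N \<Longrightarrow> jump_time H n \<omega> \<le> ereal s \<Longrightarrow> s \<le> t \<Longrightarrow>
     norm (path_factor a c n \<omega> * exp (d \<gamma> * of_real (s - clock n \<omega>))) \<le> B" "0 \<le> B"
    using path_factor_bound[of n t a c d] by metis
  have [measurable]: "(\<lambda>\<omega>. exp (d (Z n \<omega>) * of_real (t - clock n \<omega>))) \<in> borel_measurable N"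
    by (rule measurable_compose_countable[OF _ Z_measurable]) measurable
  show ?thesis
    by (rule integrable_const_bound[where B = B]) (use B in \<open>auto intro!: AE_I2 simp del: of_real_diff\<close>)
qed

text \<open>Given the past, the current sojourn outlasts the remaining time \<open>t - clock n \<omega>\<close> with probability
  \<open>exp (- exit_rate q \<gamma> * (t - clock n \<omega>))\<close>.  The proof subtracts the complementary event, a sojourn
  that ends before \<open>t\<close>, because it has a density.\<close>

lemma dyson_term_eq:
  fixes a :: "'e \<Rightarrow> complex"
  assumes "0 \<le> t"
  shows "dyson_term a c n \<gamma> t = (LINT \<omega>|N. (if Z n \<omega> = \<gamma> \<and> in_sojourn n t \<omega>
      then path_factor a c n \<omega> * exp (a (Z n \<omega>) * of_real (t - clock n \<omega>)) else 0))"
proof -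
  let ?q = "exit_rate q \<gamma>"
  let ?f = "\<lambda>\<omega>. if jump_time H n \<omega> \<le> ereal t then path_factor a c n \<omega>
      * exp (a \<gamma> * of_real (t - clock n \<omega>)) else 0"
  let ?\<Phi> = "\<lambda>\<omega> h. if h \<le> t - clock n \<omega> then ?f \<omega> else 0"
  obtain B where B: "\<And>\<omega> \<gamma> s. \<omega> \<in> space N \<Longrightarrow> jump_time H n \<omega> \<le> ereal s \<Longrightarrow> s \<le> t \<Longrightarrow>
     norm (path_factor a c n \<omega> * exp (a \<gamma> * of_real (s - clock n \<omega>))) \<le> B" and B0: "0 \<le> B"
    using path_factor_bound[of n t a c a] by metis
  have fB: "norm (?f \<omega>) \<le> B" if "\<omega> \<in> space N" for \<omega> using B[OF that, of t \<gamma>] B0 by auto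
  have \<Phi>B: "norm (?\<Phi> \<omega> h) \<le> B" if "\<omega> \<in> space N" for \<omega> h using fB[OF that] B0 by auto
  have \<Phi>m: "case_prod ?\<Phi> \<in> borel_measurable (past n \<Otimes>\<^sub>M borel)" by measurable
  have int: "integrable N (\<lambda>\<omega>. if Q \<omega> then ?f \<omega> else 0)" if [measurable]: "Measurable.pred N Q" for
      Q
    by (rule integrable_const_bound[where B = B]) (use fB B0 in \<open>auto intro!: AE_I2\<close>)
  have inner: "(LINT h|lborel. (if 0 \<le> h then rate \<gamma> \<gamma>' * exp (- ?q * h) else 0) *\<^sub>R ?\<Phi> \<omega> h)
     = (jump_prob q \<gamma> \<gamma>' * (1 - exp (- ?q * (t - clock n \<omega>)))) *\<^sub>R ?f \<omega>" if \<omega>: "\<omega>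
         \<in> space N" for \<omega> \<gamma>'
  proof (cases "jump_time H n \<omega> \<le> ereal t")
    case True
    then have cl: "0 \<le> t - clock n \<omega>" by (simp add: jump_time_le_iff[OF \<omega>])
    have "(LINT h|lborel. (if 0 \<le> h then rate \<gamma> \<gamma>' * exp (- ?q * h) else 0) *\<^sub>R ?\<Phi> \<omega> h)
        = (LINT h|sojourn_law \<gamma> \<gamma>'. ?\<Phi> \<omega> h)"
      unfolding sojourn_law_def by (subst integral_density) (auto simp: rate_nonneg)
    also have "\<dots> = (LINT h|sojourn_law \<gamma> \<gamma>'. indicator {..t - clock n \<omega>} h *\<^sub>R ?f \<omega>)"
      by (rule Bochner_Integration.integral_cong) (auto simp: indicator_def)
    also have "\<dots> = measure (sojourn_law \<gamma> \<gamma>') {..t - clock n \<omega>} *\<^sub>R ?f \<omega>"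
      by (subst integral_scaleR_left) (auto simp: sojourn_law_atMost)
    also have "measure (sojourn_law \<gamma> \<gamma>') {..t - clock n \<omega>} = jump_prob q \<gamma> \<gamma>'
        * (1 - exp (- ?q * (t - clock n \<omega>)))"
      unfolding measure_def sojourn_law_atMost
          using cl jump_prob_nonneg[of \<gamma> \<gamma>'] exit_rate_nonneg[of \<gamma>] by simp
    finally show ?thesis .
  qed simp
  have "(LINT \<omega>|N. (if Z n \<omega> = \<gamma> \<and> H n \<omega> < \<infinity> \<and> hold n \<omega> \<le> t - clock n \<omega> then ?f \<omega> else 0))
     = (LINT \<omega>|N. (\<Sum>\<gamma>'\<in>UNIV. if Z n \<omega> = \<gamma> \<and> Z (Suc n) \<omega> = \<gamma>'
         \<and> H n \<omega> < \<infinity> then ?\<Phi> \<omega> (hold n \<omega>) else 0))"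
  proof (rule Bochner_Integration.integral_cong[OF refl])
    fix \<omega>
    have "(\<Sum>\<gamma>'\<in>UNIV. if Z n \<omega> = \<gamma> \<and> Z (Suc n) \<omega> = \<gamma>' \<and> H n \<omega> < \<infinity> then ?\<Phi> \<omega> (hold n \<omega>) else 0)
      = (\<Sum>\<gamma>'\<in>UNIV. if Z (Suc n) \<omega> = \<gamma>' then (if Z n \<omega> = \<gamma> \<and> H n \<omega> < \<infinity> then ?\<Phi> \<omega> (hold n \<omega>) else 0)
          else 0)"
      by (intro sum.cong) auto
    also have "\<dots> = (if Z n \<omega> = \<gamma> \<and> H n \<omega> < \<infinity> then ?\<Phi> \<omega> (hold n \<omega>) else 0)"
      by (subst sum.delta') auto
    finally show "(if Z n \<omega> = \<gamma> \<and> H n \<omega> < \<infinity> \<and> hold n \<omega> \<le> t - clock n \<omega> then ?f \<omega> else 0)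
      = (\<Sum>\<gamma>'\<in>UNIV. if Z n \<omega> = \<gamma> \<and> Z (Suc n) \<omega> = \<gamma>' \<and> H n \<omega> < \<infinity> then ?\<Phi> \<omega> (hold n \<omega>) else 0)"
      by simp
  qed
  also have "\<dots> = (\<Sum>\<gamma>'\<in>UNIV. LINT \<omega>|N. (if Z n \<omega> = \<gamma> \<and> Z (Suc n) \<omega> = \<gamma>'
      \<and> H n \<omega> < \<infinity> then ?\<Phi> \<omega> (hold n \<omega>) else 0))"
  proof (rule Bochner_Integration.integral_sum)
    fix \<gamma>'
    have "integrable N (\<lambda>\<omega>. if Z n \<omega> = \<gamma> \<and> Z (Suc n) \<omega> = \<gamma>' \<and> H n \<omega> < \<infinity> \<and> hold n \<omega> \<le> t
        - clock n \<omega> then ?f \<omega> else 0)"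
      by (rule int) measurable
    then show "integrable N (\<lambda>\<omega>. if Z n \<omega> = \<gamma> \<and> Z (Suc n) \<omega> = \<gamma>'
        \<and> H n \<omega> < \<infinity> then ?\<Phi> \<omega> (hold n \<omega>) else 0)"
      by (rule Bochner_Integration.integrable_cong[OF refl, THEN iffD1, rotated]) auto
  qed
  also have "\<dots> = (\<Sum>\<gamma>'\<in>UNIV. LINT \<omega>|N. jump_prob q \<gamma> \<gamma>' *\<^sub>R
      (if Z n \<omega> = \<gamma> then (1 - exp (- ?q * (t - clock n \<omega>))) *\<^sub>R ?f \<omega> else 0))"
    by (rule sum.cong[OF refl], subst integral_jump_step[OF \<Phi>m \<Phi>B], assumption)
      (rule Bochner_Integration.integral_cong[OF refl], simp add: inner del: scaleR_conv_of_real)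
  also have "\<dots> = (LINT \<omega>|N. (if Z n \<omega> = \<gamma> then (1 - exp (- ?q * (t - clock n \<omega>))) *\<^sub>R ?f \<omega> else 0))"
    by (simp add: sum_jump_prob flip: scaleR_left.sum del: scaleR_conv_of_real)
  finally have jumped: "(LINT \<omega>|N. (if Z n \<omega> = \<gamma> \<and> H n \<omega> < \<infinity> \<and> hold n \<omega> \<le> t
      - clock n \<omega> then ?f \<omega> else 0))
    = (LINT \<omega>|N. (if Z n \<omega> = \<gamma> then (1 - exp (- ?q * (t - clock n \<omega>))) *\<^sub>R ?f \<omega> else 0))" .
  have i1: "integrable N (\<lambda>\<omega>. if Z n \<omega> = \<gamma> then ?f \<omega> else 0)"
    and i2: "integrable N (\<lambda>\<omega>. if Z n \<omega> = \<gamma> \<and> H n \<omega> < \<infinity> \<and> hold n \<omega> \<le> t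
        - clock n \<omega> then ?f \<omega> else 0)"
    by (rule int, measurable)+
  have i3: "integrable N (\<lambda>\<omega>. if Z n \<omega> = \<gamma> then (1 - exp (- ?q * (t - clock n \<omega>))) *\<^sub>R ?f \<omega> else 0)"
  proof (rule integrable_const_bound[where B = B])
    show "AE \<omega> in N. norm (if Z n \<omega> = \<gamma> then (1 - exp (- ?q * (t - clock n \<omega>))) *\<^sub>R ?f \<omega> else 0)
        \<le> B"
    proof (rule AE_I2)
      fix \<omega> assume \<omega>: "\<omega> \<in> space N"
      show "norm (if Z n \<omega> = \<gamma> then (1 - exp (- ?q * (t - clock n \<omega>))) *\<^sub>R ?f \<omega> else 0) \<le> B"
      proof (cases "jump_time H n \<omega> \<le> ereal t")
        case True
        then have "0 \<le> ?q * (t - clock n \<omega>)" using exit_rate_nonneg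
            by (simp add: jump_time_le_iff[OF \<omega>])
        then have "\<bar>1 - exp (- ?q * (t - clock n \<omega>))\<bar> \<le> 1" by simp
        then have "\<bar>1 - exp (- ?q * (t - clock n \<omega>))\<bar> * norm (?f \<omega>) \<le> 1 * B"
          by (intro mult_mono fB \<omega>) auto
        then show ?thesis using B0 by (simp del: scaleR_conv_of_real)
      qed (use B0 in auto)
    qed
  qed measurable
  have "(LINT \<omega>|N. (if Z n \<omega> = \<gamma> \<and> in_sojourn n t \<omega>
      then path_factor a c n \<omega> * exp (a (Z n \<omega>) * of_real (t - clock n \<omega>)) else 0))
     = (LINT \<omega>|N. (if Z n \<omega> = \<gamma> then ?f \<omega> else 0)
         - (if Z n \<omega> = \<gamma> \<and> H n \<omega> < \<infinity> \<and> hold n \<omega> \<le> t - clock n \<omega> then ?f \<omega> else 0))"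
    by (rule Bochner_Integration.integral_cong[OF refl])
      (auto simp: jump_time_Suc_le_iff not_le[symmetric])
  also have "\<dots> = (LINT \<omega>|N. (if Z n \<omega> = \<gamma> then ?f \<omega> else 0)
      - (if Z n \<omega> = \<gamma> then (1 - exp (- ?q * (t - clock n \<omega>))) *\<^sub>R ?f \<omega> else 0))"
    using jumped by (subst (1 2) Bochner_Integration.integral_diff[OF i1]) (use i2 i3 in auto)
  also have "\<dots> = dyson_term a c n \<gamma> t"
    unfolding dyson_term_def
  proof (rule Bochner_Integration.integral_cong[OF refl])
    fix \<omega>
    have "exp ((a \<gamma> - of_real ?q) * of_real (t - clock n \<omega>)) = exp (a \<gamma> * of_real (t - clock n \<omega>))
        * of_real (exp (- ?q * (t - clock n \<omega>)))"
      unfolding exp_of_real[symmetric] exp_add[symmetric] by (simp add: algebra_simps)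
    then show "(if Z n \<omega> = \<gamma> then ?f \<omega> else 0)
        - (if Z n \<omega> = \<gamma> then (1 - exp (- ?q * (t - clock n \<omega>))) *\<^sub>R ?f \<omega> else 0)
      = (if Z n \<omega> = \<gamma> \<and> jump_time H n \<omega> \<le> ereal t
       then path_factor a c n \<omega> * exp ((a \<gamma> - of_real ?q) * of_real (t - clock n \<omega>)) else 0)"
      by (simp add: scaleR_conv_of_real algebra_simps)
  qed
  finally show ?thesis by simp
qed

lemma jump_count_eq:
  assumes "\<omega> \<in> space N" "jump_time H n \<omega> \<le> ereal t" "ereal t < jump_time H (Suc n) \<omega>"
  shows "jump_count H t \<omega> = n"
  unfolding jump_count_def
proof (rule Least_equality)
  fix m assume "ereal t < jump_time H (Suc m) \<omega>"
  then have "jump_time H n \<omega> < jump_time H (Suc m) \<omega>" using assms(2)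
      by (rule le_less_trans[rotated])
  then show "n \<le> m"
    using jump_time_mono[OF assms(1), of "Suc m" n] by (metis not_less not_less_eq_eq)
qed (rule assms)

lemma path_weight_eq:
  assumes "\<omega> \<in> space N" "jump_time H n \<omega> \<le> ereal t" "ereal t < jump_time H (Suc n) \<omega>"
  shows "exp_weight a c t \<omega> = path_factor a c n \<omega> * exp (a (Z n \<omega>) * of_real (t - clock n \<omega>))"
proof -
  have "jump_time H n \<omega> \<noteq> \<infinity>" using assms(2) by auto
  then show ?thesis
    unfolding path_weight_def jump_count_eq[OF assms] Let_def
        by (simp add: clock_eq[OF assms(1)] path_factor_def)
qed

text \<open>With \<open>a = (\<lambda>\<beta>. \<psi> \<beta> z)\<close> and \<open>c\<close> the moments of the transition jumps this is the matrix exponent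
  \<open>F z\<close>.\<close>

definition generator :: "('e \<Rightarrow> complex) \<Rightarrow> ('e \<Rightarrow> 'e \<Rightarrow> complex) \<Rightarrow> complex ^ 'e ^ 'e" where
  "generator a c = (\<chi> \<beta> \<gamma>. if \<beta> = \<gamma> then a \<beta> - of_real (exit_rate q \<beta>) else of_real (q \<beta> \<gamma>)
      * c \<beta> \<gamma>)"

text \<open>The functions \<open>dyson_term a c n \<gamma>\<close> form the Dyson series of the generator; summation over the
  final state \<open>\<gamma>\<close> gives the row sum.\<close>

lemma path_weight_series:
  assumes "0 \<le> t"
  shows "(\<lambda>n. LINT \<omega>|N. (if in_sojourn n t \<omega>
       then exp_weight a c t \<omega> else 0))
    sums (\<Sum>\<gamma>\<in>UNIV. matrix_exp (t *\<^sub>R generator a c) $ \<alpha> $ \<gamma>)"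
proof -
  let ?d = "\<lambda>\<gamma>. a \<gamma> - of_real (exit_rate q \<gamma>)" and ?R = "\<lambda>\<beta> \<gamma>. of_real (rate \<beta> \<gamma>) * c \<beta> \<gamma>"
  note Suc = dyson_term_Suc[where R = ?R and c = c and a = a and d = ?d, OF _ refl refl]
  have "(\<lambda>n. dyson_term a c n \<gamma> t) sums (matrix_exp (t *\<^sub>R generator a c) $ \<alpha> $ \<gamma>)" for \<gamma>
  proof (rule dyson_series[where d = ?d and R = ?R])
    show "generator a c $ b $ g = (if b = g then ?d b else ?R b g)" for b g
      by (simp add: generator_def rate_def)
    show "?R b b = 0" for b by (simp add: rate_def)
    show "set_integrable lborel {0..s} (\<lambda>u. (\<Sum>b\<in>UNIV. dyson_term a c n b u * ?R b g)
        * exp (?d g * of_real (s - u)))"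
      if "0 \<le> s" for n g s
      unfolding sum_distrib_right set_integrable_def scaleR_sum_right
      by (intro Bochner_Integration.integrable_sum Suc(1)[OF that, unfolded set_integrable_def])
  qed (use Suc(2) dyson_term_0 assms in auto)
  then have "(\<lambda>n. \<Sum>\<gamma>\<in>UNIV. dyson_term a c n \<gamma> t)
      sums (\<Sum>\<gamma>\<in>UNIV. matrix_exp (t *\<^sub>R generator a c) $ \<alpha> $ \<gamma>)"
    by (intro sums_sum)
  moreover have "(\<Sum>\<gamma>\<in>UNIV. dyson_term a c n \<gamma> t) = (LINT \<omega>|N. (if in_sojourn n t \<omega>
       then exp_weight a c t \<omega> else 0))" for n
  proof -
    let ?w = "\<lambda>\<omega>. path_factor a c n \<omega> * exp (a (Z n \<omega>) * of_real (t - clock n \<omega>))"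
    have int: "integrable N (\<lambda>\<omega>. if Z n \<omega> = \<gamma> \<and> in_sojourn n t \<omega> then ?w \<omega> else 0)" for \<gamma>
      using integrable_path_factor[of "\<lambda>\<omega>. Z n \<omega> = \<gamma> \<and> ereal t < jump_time H (Suc n) \<omega>" n t a c a]
      by (simp add: conj_ac)
    have "(\<Sum>\<gamma>\<in>UNIV. dyson_term a c n \<gamma> t) = (LINT \<omega>|N. (\<Sum>\<gamma>\<in>UNIV. if Z n \<omega> = \<gamma>
        \<and> in_sojourn n t \<omega> then ?w \<omega> else 0))"
      unfolding dyson_term_eq[OF assms] by (rule Bochner_Integration.integral_sum[symmetric])
          (rule int)
    also have "\<dots> = (LINT \<omega>|N. (if in_sojourn n t \<omega>
       then exp_weight a c t \<omega> else 0))"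
    proof (rule Bochner_Integration.integral_cong[OF refl])
      fix \<omega> assume \<omega>: "\<omega> \<in> space N"
      have "(\<Sum>\<gamma>\<in>UNIV. if Z n \<omega> = \<gamma> \<and> in_sojourn n t \<omega> then ?w \<omega> else 0)
        = (\<Sum>\<gamma>\<in>UNIV. if Z n \<omega> = \<gamma> then (if in_sojourn n t \<omega> then ?w \<omega> else 0) else 0)"
        by (intro sum.cong) auto
      also have "\<dots> = (if in_sojourn n t \<omega> then ?w \<omega> else 0)"
        by (subst sum.delta') auto
      finally show "(\<Sum>\<gamma>\<in>UNIV. if Z n \<omega> = \<gamma> \<and> in_sojourn n t \<omega> then ?w \<omega> else 0)
        = (if in_sojourn n t \<omega>
       then exp_weight a c t \<omega> else 0)"
        using path_weight_eq[OF \<omega>, of n t a c] by auto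
    qed
    finally show ?thesis .
  qed
  ultimately show ?thesis by simp
qed

text \<open>With all weights equal to \<open>1\<close> the series adds up the probabilities of exactly \<open>n\<close> jumps by time
  \<open>t\<close>, and the generator is the rate matrix, whose rows sum to \<open>0\<close>.  So these probabilities have
  sum \<open>1\<close>.\<close>

lemma AE_no_explosion:
  assumes "0 \<le> t"
  shows "AE \<omega> in N. \<exists>n. in_sojourn n t \<omega>"
proof -
  let ?E = "\<lambda>n. {\<omega> \<in> space N. in_sojourn n t \<omega>}"
  let ?a = "\<lambda>_::'e. 0::complex" and ?c = "\<lambda>(_::'e) (_::'e). 1::complex"
  have rows: "(\<Sum>\<gamma>\<in>UNIV. generator ?a ?c $ \<beta> $ \<gamma>) = 0" for \<beta>
  proof -
    have "(\<Sum>\<gamma>\<in>UNIV. generator ?a ?c $ \<beta> $ \<gamma>) = (\<Sum>\<gamma>\<in>UNIV. of_real (rate \<beta> \<gamma>)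
        - (if \<beta> = \<gamma> then of_real (exit_rate q \<beta>) else 0))"
      by (intro sum.cong) (auto simp: generator_def rate_def)
    also have "\<dots> = of_real (\<Sum>\<gamma>\<in>UNIV. rate \<beta> \<gamma>) - of_real (exit_rate q \<beta>)"
      by (simp add: sum_subtractf)
    finally show ?thesis by (simp add: sum_rate)
  qed
  have "(LINT \<omega>|N. (if in_sojourn n t \<omega>
       then exp_weight ?a ?c t \<omega> else 0)) = of_real (prob (?E n))" for n
  proof -
    have "(LINT \<omega>|N. (if in_sojourn n t \<omega>
       then exp_weight ?a ?c t \<omega> else 0)) = (LINT \<omega>|N. of_real (indicator (?E n) \<omega>))"
      by (rule Bochner_Integration.integral_cong) (auto simp: path_weight_def Let_def)
    then show ?thesis by simp
  qed
  with path_weight_series[OF assms, of ?a ?c]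
  have "(\<lambda>n. of_real (prob (?E n)) :: complex) sums 1"
    by (simp only: matrix_exp_row_sum[OF rows])
  then have "(\<lambda>n. prob (?E n)) sums 1" using sums_of_real_iff[of "\<lambda>n. prob (?E n)" 1, where 'a
      = complex] by simp
  moreover have "(\<lambda>n. prob (?E n)) sums prob (\<Union>n. ?E n)"
  proof (rule finite_measure_UNION)
    show "disjoint_family ?E"
      unfolding disjoint_family_on_def using jump_count_eq by blast
  qed auto
  ultimately have "prob (\<Union>n. ?E n) = 1" by (rule sums_unique2[symmetric])
  then have "AE \<omega> in N. \<omega> \<in> (\<Union>n. ?E n)" by (subst (asm) prob_eq_1) auto
  then show ?thesis by (rule AE_mp) auto
qed

lemma path_weight_borel[measurable]:
  "path_weight Z H (\<lambda>\<beta> s. exp (a \<beta> * of_real s :: complex)) c t \<in> borel_measurable N"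
  by (rule path_weight_measurable) auto

text \<open>Integrability comes from the same series: the norm of a weight is again a weight, with
  parameters \<open>Re (a \<beta>)\<close> and \<open>norm (c \<beta> \<gamma>)\<close>, so the integrals of the norms are summable.\<close>

lemma expectation_path_weight:
  assumes "0 \<le> t"
  shows "integrable N (exp_weight a c t)" (is "integrable N ?w")
    and "expectation (exp_weight a c t)
      = (\<Sum>\<gamma>\<in>UNIV. matrix_exp (t *\<^sub>R generator a c) $ \<alpha> $ \<gamma>)"
proof -
  let ?E = "\<lambda>n \<omega>. in_sojourn n t \<omega>"
  let ?f = "\<lambda>n \<omega>. if ?E n \<omega> then ?w \<omega> else 0"
  let ?a = "\<lambda>\<beta>. complex_of_real (Re (a \<beta>))" and ?c = "\<lambda>\<beta> \<gamma>. complex_of_real (norm (c \<beta> \<gamma>))"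
  let ?w' = "exp_weight ?a ?c t"
  have norm_w: "?w' \<omega> = of_real (norm (?w \<omega>))" for \<omega>
    unfolding path_weight_def Let_def
    by (simp add: norm_mult prod_norm[symmetric] of_real_prod exp_of_real[symmetric])
  have int: "integrable N (?f n)" for n
  proof -
    have "integrable N (\<lambda>\<omega>. if ereal t < jump_time H (Suc n) \<omega> \<and> jump_time H n \<omega> \<le> ereal t
      then path_factor a c n \<omega> * exp (a (Z n \<omega>) * of_real (t - clock n \<omega>)) else 0)"
      by (rule integrable_path_factor) measurable
    then show ?thesis
      by (rule Bochner_Integration.integrable_cong[OF refl, THEN iffD1, rotated])
          (auto simp: path_weight_eq)
  qed
  have "summable (\<lambda>n. of_real (LINT \<omega>|N. norm (?f n \<omega>)) :: complex)"
  proof -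
    have "complex_of_real (LINT \<omega>|N. norm (?f n \<omega>))
        = (LINT \<omega>|N. (if ?E n \<omega> then ?w' \<omega> else 0))" for n
    proof -
      have "complex_of_real (LINT \<omega>|N. norm (?f n \<omega>)) = (LINT \<omega>|N. complex_of_real (norm (?f n \<omega>)))"
        by (rule integral_complex_of_real[symmetric])
      also have "\<dots> = (LINT \<omega>|N. (if ?E n \<omega> then ?w' \<omega> else 0))"
        by (rule Bochner_Integration.integral_cong) (auto simp: norm_w)
      finally show ?thesis .
    qed
    then show ?thesis using path_weight_series[OF assms, of ?a ?c] by (simp add: sums_summable)
  qed
  then have sum: "summable (\<lambda>n. LINT \<omega>|N. norm (?f n \<omega>))" by (simp only: summable_of_real_iff)
  have one: "?f n \<omega> = 0" if "\<omega> \<in> space N" "n \<noteq> jump_count H t \<omega>" for n \<omega>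
    using jump_count_eq[OF that(1), of n t] that(2) by auto
  have ae_sum: "AE \<omega> in N. summable (\<lambda>n. norm (?f n \<omega>))"
  proof (rule AE_I2)
    fix \<omega> assume "\<omega> \<in> space N"
    from one[OF this] show "summable (\<lambda>n. norm (?f n \<omega>))"
      by (intro summable_finite[of "{jump_count H t \<omega>}"]) auto
  qed
  have eq: "AE \<omega> in N. (\<Sum>n. ?f n \<omega>) = ?w \<omega>"
  proof (rule AE_mp[OF AE_no_explosion[OF assms]], intro AE_I2 impI)
    fix \<omega> assume \<omega>: "\<omega> \<in> space N" and "\<exists>n. ?E n \<omega>"
    then obtain m where m: "?E m \<omega>" by blast
    then have "m = jump_count H t \<omega>" using jump_count_eq[OF \<omega>, of m t] by simp
    then have "(\<Sum>n. ?f n \<omega>) = (\<Sum>n\<in>{m}. ?f n \<omega>)"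
      using one[OF \<omega>] by (intro suminf_finite) auto
    then show "(\<Sum>n. ?f n \<omega>) = ?w \<omega>" using m by simp
  qed
  have i: "integrable N (\<lambda>\<omega>. \<Sum>n. ?f n \<omega>)" by (rule integrable_suminf[OF int ae_sum sum])
  show "integrable N ?w"
    by (rule integrable_cong_AE_imp[OF i _ eq]) (rule path_weight_borel)
  have "(\<lambda>n. LINT \<omega>|N. ?f n \<omega>) sums (LINT \<omega>|N. (\<Sum>n. ?f n \<omega>))"
    by (rule sums_integral[OF int ae_sum sum])
  moreover have "(LINT \<omega>|N. (\<Sum>n. ?f n \<omega>)) = expectation ?w"
    by (rule integral_cong_AE[OF borel_measurable_integrable[OF i] path_weight_borel eq])
  ultimately show "expectation ?w = (\<Sum>\<gamma>\<in>UNIV. matrix_exp (t *\<^sub>R generator a c) $ \<alpha> $ \<gamma>)"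
    using path_weight_series[OF assms, of a c] by (simp only: sums_unique2)
qed

end

section \<open>Integrating out the sojourn noise\<close>

text \<open>Right-continuity makes the process a pointwise limit of its values on the grid points
  \<open>k / Suc n\<close> strictly to the right of \<open>t\<close>, and each approximation takes only countably many times.
  The clipping at \<open>0\<close> avoids negative times, at which nothing is assumed.\<close>

lemma cadlag_joint_measurable:
  fixes X :: "real \<Rightarrow> 'v \<Rightarrow> real"
  assumes rv: "\<And>t. 0 \<le> t \<Longrightarrow> X t \<in> borel_measurable K"
    and cadlag: "\<And>\<omega>. \<omega> \<in> space K \<Longrightarrow> cadlag euclidean (\<lambda>t. X t \<omega>)"
  shows "(\<lambda>(t, \<omega>). X (max 0 t) \<omega>) \<in> borel_measurable (borel \<Otimes>\<^sub>M K)"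
proof -
  \<comment> \<open>The first point of the grid of mesh \<open>1 / Suc k\<close> that is strictly larger than \<open>t\<close>.\<close>
  define s where "s k t = real (nat \<lfloor>real (Suc k) * t\<rfloor> + 1) / real (Suc k)" for k :: nat and t ::
      real
  have s_bounds: "t < s k t" "s k t \<le> t + 1 / real (Suc k)" if "0 \<le> t" for k t
  proof -
    have r: "real (nat \<lfloor>real (Suc k) * t\<rfloor>) = real_of_int \<lfloor>real (Suc k) * t\<rfloor>"
      using that by (simp del: of_nat_Suc)
    have "real (Suc k) * t < real (nat \<lfloor>real (Suc k) * t\<rfloor> + 1)"
      unfolding of_nat_add r by linarith
    then show "t < s k t" unfolding s_def by (subst pos_less_divide_eq)
        (simp_all add: mult.commute del: of_nat_Suc)
    have "real (nat \<lfloor>real (Suc k) * t\<rfloor> + 1) \<le> real (Suc k) * t + 1"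
      unfolding of_nat_add r by linarith
    then have "s k t \<le> (real (Suc k) * t + 1) / real (Suc k)" unfolding s_def
        by (intro divide_right_mono) auto
    also have "\<dots> = t + 1 / real (Suc k)" by (simp add: add_divide_distrib del: of_nat_Suc)
    finally show "s k t \<le> t + 1 / real (Suc k)" .
  qed
  have s_pos: "0 \<le> s k t" for k t by (simp add: s_def)
  have "(\<lambda>x. X (s k (max 0 (fst x))) (snd x)) \<in> borel_measurable (borel \<Otimes>\<^sub>M K)" for k
  proof -
    have [measurable]: "(\<lambda>x. X (real (m + 1) / real (Suc k)) (snd x))
        \<in> borel_measurable (borel \<Otimes>\<^sub>M K)" for m
      by (rule measurable_compose[OF measurable_snd rv]) simp
    have [measurable]: "(\<lambda>x. nat \<lfloor>real (Suc k) * max 0 (fst x)\<rfloor>) \<in> borel \<Otimes>\<^sub>M K \<rightarrow>\<^sub>M count_space UNIV"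
      by measurable
    show ?thesis
      unfolding s_def
      by (rule measurable_compose_countable[where f
          = "\<lambda>m x. X (real (m + 1) / real (Suc k)) (snd x)"]) measurable
  qed
  moreover have "(\<lambda>k. X (s k (max 0 (fst x))) (snd x)) \<longlonglongrightarrow> X (max 0 (fst x)) (snd x)"
    if "x \<in> space (borel \<Otimes>\<^sub>M K)" for x
  proof -
    let ?t = "max 0 (fst x)"
    have t: "0 \<le> ?t" by simp
    have "snd x \<in> space K" using that by (auto simp: space_pair_measure)
    then have "((\<lambda>t. X t (snd x)) \<longlongrightarrow> X ?t (snd x)) (at_right ?t)"
      using cadlag[of "snd x"] t unfolding cadlag_def limitin_canonical_iff by blast
    moreover have "filterlim (\<lambda>k. s k ?t) (at_right ?t) sequentially"
      unfolding filterlim_at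
    proof
      show "\<forall>\<^sub>F k in sequentially. s k ?t \<in> {?t<..} \<and> s k ?t \<noteq> ?t"
        using s_bounds(1)[OF t] by (intro always_eventually allI)
            (metis greaterThan_iff less_irrefl)
      have "(\<lambda>k. ?t + 1 / real (Suc k)) \<longlonglongrightarrow> ?t + 0"
        using LIMSEQ_inverse_real_of_nat by (intro tendsto_add tendsto_const)
            (simp add: inverse_eq_divide)
      then have lim: "(\<lambda>k. ?t + 1 / real (Suc k)) \<longlonglongrightarrow> ?t" by simp
      show "(\<lambda>k. s k ?t) \<longlonglongrightarrow> ?t"
        using s_bounds[OF t] by (intro tendsto_sandwich[OF _ _ tendsto_const lim])
            (auto intro!: always_eventually less_imp_le)
    qed
    ultimately show ?thesis by (rule filterlim_compose)
  qed
  ultimately have "(\<lambda>x. X (max 0 (fst x)) (snd x)) \<in> borel_measurable (borel \<Otimes>\<^sub>M K)"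
    by (rule borel_measurable_LIMSEQ_real[rotated])
  then show ?thesis by (simp add: split_beta')
qed

text \<open>The level with the chain and the noise evaluated at two separate sample points, for use with
  Fubini.  On the diagonal it is \<open>built_level\<close>.\<close>

definition mixed_level ::
    "(nat \<Rightarrow> 'v \<Rightarrow> 'e) \<Rightarrow> (nat \<Rightarrow> 'v \<Rightarrow> ereal) \<Rightarrow> (nat \<Rightarrow> 'e \<Rightarrow> real \<Rightarrow> 'v \<Rightarrow> real) \<Rightarrow>
     (nat \<Rightarrow> 'e \<Rightarrow> 'e \<Rightarrow> 'v \<Rightarrow> real) \<Rightarrow> real \<Rightarrow> 'v \<Rightarrow> 'v \<Rightarrow> real" where
  "mixed_level Z H X V t \<omega> \<omega>' = (let n = jump_count H t \<omega> in
     (\<Sum>i<n. X i (Z i \<omega>) (max 0 (real_of_ereal (H i \<omega>))) \<omega>' + V i (Z i \<omega>) (Z (Suc i) \<omega>) \<omega>') +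
     X n (Z n \<omega>) (max 0 (t - real_of_ereal (jump_time H n \<omega>))) \<omega>')"

lemma mixed_level_measurable:
  fixes Z :: "nat \<Rightarrow> 'v \<Rightarrow> 'e::finite"
  assumes H: "\<And>n. H n \<in> borel_measurable K" and Z: "\<And>n. Z n \<in> K \<rightarrow>\<^sub>M count_space UNIV"
    and X: "\<And>n \<beta> t. 0 \<le> t \<Longrightarrow> X n \<beta> t \<in> borel_measurable K'"
    and cadlag: "\<And>n \<beta> \<omega>. \<omega> \<in> space K' \<Longrightarrow> cadlag euclidean (\<lambda>t. X n \<beta> t \<omega>)"
    and V: "\<And>n \<beta> \<gamma>. V n \<beta> \<gamma> \<in> borel_measurable K'"
  shows "(\<lambda>x. mixed_level Z H X V t (fst x) (snd x)) \<in> borel_measurable (K \<Otimes>\<^sub>M K')"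
proof -
  have Z'[measurable]: "(\<lambda>x. Z n (fst x)) \<in> K \<Otimes>\<^sub>M K' \<rightarrow>\<^sub>M count_space UNIV" for n
    by (rule measurable_compose[OF measurable_fst Z])
  have H'[measurable]: "(\<lambda>x. H n (fst x)) \<in> borel_measurable (K \<Otimes>\<^sub>M K')" for n
    by (rule measurable_compose[OF measurable_fst H])
  have jt[measurable]: "(\<lambda>x. jump_time H n (fst x)) \<in> borel_measurable (K \<Otimes>\<^sub>M K')" for n
    unfolding jump_time_def by measurable
  have X': "(\<lambda>x. X i (Z j (fst x)) (max 0 (f x)) (snd x)) \<in> borel_measurable (K \<Otimes>\<^sub>M K')"
    if [measurable]: "f \<in> borel_measurable (K \<Otimes>\<^sub>M K')" for i j f
  proof (rule measurable_compose_countable[OF _ Z'])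
    fix \<beta>
    have "(\<lambda>x. (f x, snd x)) \<in> K \<Otimes>\<^sub>M K' \<rightarrow>\<^sub>M borel \<Otimes>\<^sub>M K'" by measurable
    from measurable_compose[OF this cadlag_joint_measurable[of "X i \<beta>" K']] X cadlag
    show "(\<lambda>x. X i \<beta> (max 0 (f x)) (snd x)) \<in> borel_measurable (K \<Otimes>\<^sub>M K')" by simp
  qed
  have V': "(\<lambda>x. V i (Z i (fst x)) (Z (Suc i) (fst x)) (snd x)) \<in> borel_measurable (K \<Otimes>\<^sub>M K')" for i
    by (rule measurable_compose_countable[OF measurable_compose_countable[OF _ Z'] Z'])
      (rule measurable_compose[OF measurable_snd V])
  have "(\<lambda>x. (\<Sum>i<n. X i (Z i (fst x)) (max 0 (real_of_ereal (H i (fst x)))) (snd x)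
      + V i (Z i (fst x)) (Z (Suc i) (fst x)) (snd x)) +
     X n (Z n (fst x)) (max 0 (t - real_of_ereal (jump_time H n (fst x)))) (snd x))
         \<in> borel_measurable (K \<Otimes>\<^sub>M K')" for n
    by (intro borel_measurable_add borel_measurable_sum X' V') measurable
  from measurable_compose_countable[where f = "\<lambda>n x.
      (\<Sum>i<n. X i (Z i (fst x)) (max 0 (real_of_ereal (H i (fst x)))) (snd x)
          + V i (Z i (fst x)) (Z (Suc i) (fst x)) (snd x)) +
     X n (Z n (fst x)) (max 0 (t - real_of_ereal (jump_time H n (fst x)))) (snd x)", OF this
         measurable_compose[OF measurable_fst jump_count_measurable[of H K t, OF H]]]
  show ?thesis unfolding mixed_level_def Let_def .
qed

context jump_chain begin

text \<open>This also holds in the explosive case: then all jump times are at most \<open>t\<close>, whatever number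
  \<open>LEAST\<close> returns.\<close>

lemma jump_time_count_le:
  assumes "\<omega> \<in> space N" "0 \<le> t"
  shows "jump_time H (jump_count H t \<omega>) \<omega> \<le> ereal t"
proof (cases "\<exists>n. ereal t < jump_time H (Suc n) \<omega>")
  case True
  show ?thesis
  proof (cases "jump_count H t \<omega>")
    case 0
    then show ?thesis using assms by (simp add: jump_time_def)
  next
    case (Suc m)
    then have "\<not> ereal t < jump_time H (Suc m) \<omega>"
      unfolding jump_count_def by (intro not_less_Least) auto
    then show ?thesis using Suc by simp
  qed
next
  case False
  then have "jump_time H (Suc (jump_count H t \<omega>)) \<omega> \<le> ereal t" by (auto simp: not_less)
  then show ?thesis using jump_time_mono[OF assms(1), of "jump_count H t \<omega>" "Suc
      (jump_count H t \<omega>)"] by auto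
qed

lemma mixed_level_diag:
  assumes "\<omega> \<in> space N" "0 \<le> t"
  shows "mixed_level Z H X V t \<omega> \<omega> = built_level Z H X V t \<omega>"
proof -
  let ?n = "jump_count H t \<omega>"
  have "jump_time H ?n \<omega> \<le> ereal t" by (rule jump_time_count_le[OF assms])
  then have "jump_time H ?n \<omega> \<noteq> \<infinity>" by auto
  moreover have "clock ?n \<omega> \<le> t" using jump_time_count_le[OF assms]
      by (simp add: jump_time_le_iff[OF assms(1)])
  moreover have "0 \<le> real_of_ereal (H i \<omega>)" for i
      by (rule real_of_ereal_pos[OF H_nonneg[OF assms(1)]])
  ultimately show ?thesis
    by (simp add: mixed_level_def built_level_def jump_level_def Let_def clock_eq[OF assms(1)]
        max_def)
qed

text \<open>A sojourn in an absorbing state never ends, and a jump along a zero rate has probability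
  \<open>0\<close>; so at the end of a finite sojourn the state really changes.\<close>

lemma AE_rate_pos: "AE \<omega> in N. \<forall>n. H n \<omega> < \<infinity> \<longrightarrow> Z n \<omega> \<noteq> Z (Suc n) \<omega> \<and> 0 < q (Z n \<omega>) (Z (Suc n) \<omega>)"
proof -
  have "AE \<omega> in N. \<not> (Z n \<omega> = \<beta> \<and> Z (Suc n) \<omega> = \<gamma> \<and> H n \<omega> < \<infinity>)" if "rate \<beta> \<gamma> = 0" for n \<beta> \<gamma>
  proof -
    let ?S = "{\<omega> \<in> space N. Z n \<omega> = \<beta> \<and> Z (Suc n) \<omega> = \<gamma> \<and> H n \<omega> < \<infinity>}"
    have S: "?S \<in> sets N" by measurable
    have "of_real (prob ?S) = (LINT \<omega>|N. complex_of_real (indicator ?S \<omega>))"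
      using S by simp
    also have "\<dots> = (LINT \<omega>|N. (if Z n \<omega> = \<beta> \<and> Z (Suc n) \<omega> = \<gamma>
        \<and> H n \<omega> < \<infinity> then (\<lambda>_ _. 1) \<omega> (hold n \<omega>) else 0))"
      by (rule Bochner_Integration.integral_cong) (auto simp: indicator_def)
    also have "\<dots> = 0"
      by (subst integral_jump_step[where B = 1]) (auto simp: that cong: if_cong)
    finally have "emeasure N ?S = 0" by (simp add: emeasure_eq_measure)
    then have "AE \<omega> in N. \<omega> \<notin> ?S" using S by (intro AE_not_in) (auto simp: null_sets_def)
    then show ?thesis by (rule AE_mp) auto
  qed
  then have "AE \<omega> in N. \<forall>n. \<forall>\<beta> \<gamma>. rate \<beta> \<gamma> = 0 \<longrightarrow> \<not> (Z n \<omega> = \<beta> \<and> Z (Suc n) \<omega> = \<gamma> \<and> H n \<omega> < \<infinity>)"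
    unfolding AE_all_countable by (intro allI AE_impI)
  then show ?thesis
  proof (rule AE_mp, intro AE_I2 impI allI)
    fix \<omega> n assume "\<forall>n. \<forall>\<beta> \<gamma>. rate \<beta> \<gamma> = 0 \<longrightarrow> \<not> (Z n \<omega> = \<beta> \<and> Z (Suc n) \<omega> = \<gamma> \<and> H n \<omega> < \<infinity>)" "H n \<omega> <
        \<infinity>"
    then have "rate (Z n \<omega>) (Z (Suc n) \<omega>) \<noteq> 0" by blast
    then show "Z n \<omega> \<noteq> Z (Suc n) \<omega> \<and> 0 < q (Z n \<omega>) (Z (Suc n) \<omega>)"
      using rates[of "Z n \<omega>" "Z (Suc n) \<omega>"] by (auto simp: rate_def split: if_splits)
  qed
qed

end

definition noise_index :: "'e noise set" where
  "noise_index = {Sojourn n \<beta> |n \<beta>. True} \<union> {Transition n \<beta> \<gamma> |n \<beta> \<gamma>. \<beta> \<noteq> \<gamma>}"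

lemma noise_index_iff[simp]:
  "Chain \<notin> noise_index" "Sojourn n \<beta> \<in> noise_index" "Transition n \<beta> \<gamma> \<in> noise_index \<longleftrightarrow> \<beta> \<noteq> \<gamma>"
  by (auto simp: noise_index_def)

text \<open>The chain together with the noise that drives the additive component, still for one starting
  state.\<close>

locale noisy_chain = jump_chain N q \<alpha> Z H
  for N :: "'v measure" and q :: "'e::finite \<Rightarrow> 'e \<Rightarrow> real" and \<alpha> Z H +
  fixes X :: "nat \<Rightarrow> 'e \<Rightarrow> real \<Rightarrow> 'v \<Rightarrow> real" and V :: "nat \<Rightarrow> 'e \<Rightarrow> 'e \<Rightarrow> 'v \<Rightarrow> real"
  assumes X_rv: "\<And>n \<beta> t. 0 \<le> t \<Longrightarrow> X n \<beta> t \<in> borel_measurable N"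
    and X_cadlag: "\<And>n \<beta> \<omega>. \<omega> \<in> space N \<Longrightarrow> cadlag euclidean (\<lambda>t. X n \<beta> t \<omega>)"
    and V_rv: "\<And>n \<beta> \<gamma>. V n \<beta> \<gamma> \<in> borel_measurable N"
    and indep: "indep_sets (noise_sets N Z H X V) ({Chain} \<union> noise_index)"
begin

definition chain_algebra :: "'v measure" where
  "chain_algebra = vimage_algebra (space N) (\<lambda>\<omega> n. (Z n \<omega>, H n \<omega>))
      (Pi\<^sub>M UNIV (\<lambda>_. count_space UNIV \<Otimes>\<^sub>M borel))"

definition noise_algebra :: "'v measure" where
  "noise_algebra = sigma (space N) (\<Union>i\<in>noise_index. noise_sets N Z H X V i)"

lemma noise_sets_events: "i \<in> {Chain} \<union> noise_index \<Longrightarrow> noise_sets N Z H X V i \<subseteq> events"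
  by (rule bspec[OF conjunct1[OF indep[unfolded indep_sets_def]]])

lemma space_chain_algebra[simp]: "space chain_algebra = space N"
  by (simp add: chain_algebra_def)

lemma sets_chain_algebra: "sets chain_algebra \<subseteq> events"
  using noise_sets_events[of Chain] by (simp add: chain_algebra_def)

lemma noise_Union_subset: "(\<Union>i\<in>noise_index. noise_sets N Z H X V i) \<subseteq> events"
  by (rule UN_least, rule noise_sets_events, rule UnI2)

lemma space_noise_algebra[simp]: "space noise_algebra = space N"
  unfolding noise_algebra_def by (rule space_measure_of[OF
      order_trans[OF noise_Union_subset sets.space_closed]])

lemma sets_noise_algebra_eq: "sets noise_algebra
    = sigma_sets (space N) (\<Union>i\<in>noise_index. noise_sets N Z H X V i)"
  unfolding noise_algebra_def by (rule sets_measure_of[OF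
      order_trans[OF noise_Union_subset sets.space_closed]])

lemma sets_noise_algebra: "sets noise_algebra \<subseteq> events"
  unfolding sets_noise_algebra_eq by (rule sets.sigma_sets_subset[OF noise_Union_subset])

lemma indep_chain_noise: "A \<in> sets chain_algebra \<Longrightarrow> B \<in> sets noise_algebra \<Longrightarrow> prob (A \<inter> B) = prob A
    * prob B"
proof -
  assume A: "A \<in> sets chain_algebra" and B: "B \<in> sets noise_algebra"
  let ?I = "\<lambda>b. if b then {Chain} else (noise_index :: 'e noise set)"
  have "indep_sets (\<lambda>b. sigma_sets (space N) (\<Union>i\<in>?I b. noise_sets N Z H X V i)) UNIV"
  proof (rule indep_sets_collect_sigma)
    have "(\<Union>b\<in>UNIV. ?I b) = {Chain} \<union> noise_index" by (auto simp: UNIV_bool)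
    then show "indep_sets (noise_sets N Z H X V) (\<Union>b\<in>UNIV. ?I b)" using indep by (simp only:)
    show "Int_stable (noise_sets N Z H X V i)" for i
      by (cases i) (auto simp: Int_stable_def)
    show "disjoint_family_on ?I UNIV" by (auto simp: disjoint_family_on_def)
  qed
  then have "prob (\<Inter>b\<in>UNIV. (if b then A else B)) = (\<Prod>b\<in>UNIV. prob (if b then A else B))"
  proof (rule indep_setsD)
    show "\<forall>b\<in>UNIV. (if b then A else B) \<in> sigma_sets (space N) (\<Union>i\<in>?I b. noise_sets N Z H X V i)"
      using A B by (auto simp: chain_algebra_def sets_noise_algebra_eq)
  qed auto
  then show ?thesis by (simp add: UNIV_bool mult.commute Int_commute)
qed

lemma measurable_chain_id: "(\<lambda>\<omega>. \<omega>) \<in> N \<rightarrow>\<^sub>M chain_algebra"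
  using sets_chain_algebra by (auto simp: measurable_def)

lemma measurable_noise_id: "(\<lambda>\<omega>. \<omega>) \<in> N \<rightarrow>\<^sub>M noise_algebra"
  using sets_noise_algebra by (auto simp: measurable_def)

text \<open>Independence of the chain from all the noise, stated as: the diagonal map sends the probability
  measure to the product of its restrictions to the two sigma-algebras.  This is what Fubini needs
  to freeze the chain while the noise is integrated.\<close>

lemma distr_chain_noise:
  "distr N chain_algebra (\<lambda>\<omega>. \<omega>) \<Otimes>\<^sub>M distr N noise_algebra (\<lambda>\<omega>. \<omega>)
     = distr N (chain_algebra \<Otimes>\<^sub>M noise_algebra) (\<lambda>\<omega>. (\<omega>, \<omega>))"
proof (rule pair_measure_eqI)
  show "sigma_finite_measure (distr N chain_algebra (\<lambda>\<omega>. \<omega>))"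
    by (rule prob_space_imp_sigma_finite[OF prob_space_distr[OF measurable_chain_id]])
  show "sigma_finite_measure (distr N noise_algebra (\<lambda>\<omega>. \<omega>))"
    by (rule prob_space_imp_sigma_finite[OF prob_space_distr[OF measurable_noise_id]])
  have "sets (distr N chain_algebra (\<lambda>\<omega>. \<omega>) \<Otimes>\<^sub>M distr N noise_algebra (\<lambda>\<omega>. \<omega>))
      = sets (chain_algebra \<Otimes>\<^sub>M noise_algebra)"
    by (rule sets_pair_measure_cong) (simp_all only: sets_distr)
  then show "sets (distr N chain_algebra (\<lambda>\<omega>. \<omega>) \<Otimes>\<^sub>M distr N noise_algebra (\<lambda>\<omega>. \<omega>))
      = sets (distr N (chain_algebra \<Otimes>\<^sub>M noise_algebra) (\<lambda>\<omega>. (\<omega>, \<omega>)))" by (simp only: sets_distr)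
  fix A B assume "A \<in> sets (distr N chain_algebra (\<lambda>\<omega>. \<omega>))" "B
      \<in> sets (distr N noise_algebra (\<lambda>\<omega>. \<omega>))"
  then have A: "A \<in> sets chain_algebra" and B: "B \<in> sets noise_algebra" by auto
  have "A \<subseteq> space N" "B \<subseteq> space N" using A B sets.sets_into_space by fastforce+
  then have "emeasure (distr N (chain_algebra \<Otimes>\<^sub>M noise_algebra) (\<lambda>\<omega>. (\<omega>, \<omega>))) (A \<times> B)
      = emeasure N (A \<inter> B)"
    using A B by (subst emeasure_distr[OF measurable_Pair[OF measurable_chain_id
        measurable_noise_id]])
      (auto intro!: arg_cong[of _ _ "emeasure N"])
  also have "\<dots> = emeasure N A * emeasure N B"
    by (simp add: emeasure_eq_measure indep_chain_noise[OF A B] ennreal_mult)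
  also have "\<dots> = emeasure (distr N chain_algebra (\<lambda>\<omega>. \<omega>)) A
      * emeasure (distr N noise_algebra (\<lambda>\<omega>. \<omega>)) B"
    using A B \<open>A \<subseteq> space N\<close> \<open>B \<subseteq> space N\<close>
    by (simp add: emeasure_distr[OF measurable_chain_id A] emeasure_distr[OF measurable_noise_id B]
        Int_absorb2)
  finally show "emeasure (distr N chain_algebra (\<lambda>\<omega>. \<omega>)) A
      * emeasure (distr N noise_algebra (\<lambda>\<omega>. \<omega>)) B
     = emeasure (distr N (chain_algebra \<Otimes>\<^sub>M noise_algebra) (\<lambda>\<omega>. (\<omega>, \<omega>))) (A \<times> B)" by simp
qed

lemma nn_integral_chain_noise:
  assumes f: "case_prod f \<in> borel_measurable (chain_algebra \<Otimes>\<^sub>M noise_algebra)"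
  shows "(\<integral>\<^sup>+\<omega>. f \<omega> \<omega> \<partial>N) = (\<integral>\<^sup>+\<omega>. \<integral>\<^sup>+\<omega>'. f \<omega> \<omega>' \<partial>N \<partial>N)"
proof -
  let ?C = "distr N chain_algebra (\<lambda>\<omega>. \<omega>)" and ?W = "distr N noise_algebra (\<lambda>\<omega>. \<omega>)"
  interpret W: prob_space ?W by (rule prob_space_distr[OF measurable_noise_id])
  have f': "case_prod f \<in> borel_measurable (?C \<Otimes>\<^sub>M ?W)" using f by simp
  have sec: "f \<omega> \<in> borel_measurable noise_algebra" if "\<omega> \<in> space N" for \<omega>
    using measurable_compose[OF measurable_Pair1' f, of \<omega>] that by simp
  have "(\<integral>\<^sup>+\<omega>. f \<omega> \<omega> \<partial>N) = (\<integral>\<^sup>+x. case_prod f x \<partial>(?C \<Otimes>\<^sub>M ?W))"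
    unfolding distr_chain_noise
    by (subst nn_integral_distr[OF measurable_Pair[OF measurable_chain_id measurable_noise_id]])
        (use f in simp_all)
  also have "\<dots> = (\<integral>\<^sup>+\<omega>. \<integral>\<^sup>+\<omega>'. f \<omega> \<omega>' \<partial>?W \<partial>?C)"
    using W.nn_integral_fst[OF f'] by simp
  also have "\<dots> = (\<integral>\<^sup>+\<omega>. \<integral>\<^sup>+\<omega>'. f \<omega> \<omega>' \<partial>?W \<partial>N)"
    by (rule nn_integral_distr[OF measurable_chain_id])
      (use W.borel_measurable_nn_integral_fst[OF f'] in simp)
  also have "\<dots> = (\<integral>\<^sup>+\<omega>. \<integral>\<^sup>+\<omega>'. f \<omega> \<omega>' \<partial>N \<partial>N)"
    by (rule nn_integral_cong) (rule nn_integral_distr[OF measurable_noise_id], simp add: sec)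
  finally show ?thesis .
qed

lemma integral_chain_noise:
  fixes f :: "'v \<Rightarrow> 'v \<Rightarrow> complex"
  assumes f: "case_prod f \<in> borel_measurable (chain_algebra \<Otimes>\<^sub>M noise_algebra)"
    and int: "integrable N (\<lambda>\<omega>. f \<omega> \<omega>)"
  shows "(LINT \<omega>|N. f \<omega> \<omega>) = (LINT \<omega>|N. LINT \<omega>'|N. f \<omega> \<omega>')"
proof -
  let ?C = "distr N chain_algebra (\<lambda>\<omega>. \<omega>)" and ?W = "distr N noise_algebra (\<lambda>\<omega>. \<omega>)"
  interpret C: prob_space ?C by (rule prob_space_distr[OF measurable_chain_id])
  interpret W: prob_space ?W by (rule prob_space_distr[OF measurable_noise_id])
  interpret CW: pair_sigma_finite ?C ?W ..
  note d = measurable_Pair[OF measurable_chain_id measurable_noise_id]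
  have sec: "f \<omega> \<in> borel_measurable noise_algebra" if "\<omega> \<in> space N" for \<omega>
    using measurable_compose[OF measurable_Pair1' f, of \<omega>] that by simp
  have i: "integrable (?C \<Otimes>\<^sub>M ?W) (case_prod f)"
    unfolding distr_chain_noise by (subst integrable_distr_eq[OF d f]) (use int in simp)
  have "(LINT \<omega>|N. f \<omega> \<omega>) = (LINT x|(?C \<Otimes>\<^sub>M ?W). case_prod f x)"
    unfolding distr_chain_noise by (subst integral_distr[OF d f]) simp
  also have "\<dots> = (LINT \<omega>|?C. LINT \<omega>'|?W. f \<omega> \<omega>')"
    using CW.integral_fst'[OF i] by simp
  also have "\<dots> = (LINT \<omega>|N. LINT \<omega>'|?W. f \<omega> \<omega>')"
    by (rule integral_distr[OF measurable_chain_id])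
        (use borel_measurable_integrable[OF CW.integrable_fst'[OF i]] in simp)
  also have "\<dots> = (LINT \<omega>|N. LINT \<omega>'|N. f \<omega> \<omega>')"
    by (rule Bochner_Integration.integral_cong[OF refl])
        (rule integral_distr[OF measurable_noise_id sec])
  finally show ?thesis .
qed

lemma chain_algebra_ZH: "Z n \<in> chain_algebra \<rightarrow>\<^sub>M count_space UNIV" "H n
    \<in> borel_measurable chain_algebra"
proof -
  have "(\<lambda>\<omega> n. (Z n \<omega>, H n \<omega>)) \<in> chain_algebra \<rightarrow>\<^sub>M Pi\<^sub>M UNIV (\<lambda>_. count_space UNIV \<Otimes>\<^sub>M borel)"
    unfolding chain_algebra_def by (rule measurable_vimage_algebra1)
        (auto simp: space_PiM space_pair_measure)
  from measurable_compose[OF this measurable_component_singleton[of n]]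
  have p: "(\<lambda>\<omega>. (Z n \<omega>, H n \<omega>)) \<in> chain_algebra \<rightarrow>\<^sub>M count_space UNIV \<Otimes>\<^sub>M borel" by simp
  show "Z n \<in> chain_algebra \<rightarrow>\<^sub>M count_space UNIV" using measurable_compose[OF p measurable_fst]
      by simp
  show "H n \<in> borel_measurable chain_algebra" using measurable_compose[OF p measurable_snd] by simp
qed

lemma noise_sets_sojourn:
  assumes "0 \<le> t" "A \<in> sets borel"
  shows "X n \<beta> t -` A \<inter> space N \<in> noise_sets N Z H X V (Sojourn n \<beta>)"
proof -
  let ?K = "vimage_algebra (space N) (\<lambda>\<omega>. \<lambda>t\<in>{0..}. X n \<beta> t \<omega>) (Pi\<^sub>M {0..} (\<lambda>_. borel))"
  have "(\<lambda>\<omega>. \<lambda>t\<in>{0..}. X n \<beta> t \<omega>) \<in> ?K \<rightarrow>\<^sub>M Pi\<^sub>M {0..} (\<lambda>_. borel)"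
    by (rule measurable_vimage_algebra1) (auto simp: space_PiM)
  from measurable_compose[OF this measurable_component_singleton[of t]]
  have "X n \<beta> t \<in> borel_measurable ?K" using assms by simp
  from measurable_sets[OF this assms(2)] show ?thesis by simp
qed

lemma noise_sets_transition:
  assumes "A \<in> sets borel"
  shows "V n \<beta> \<gamma> -` A \<inter> space N \<in> noise_sets N Z H X V (Transition n \<beta> \<gamma>)"
  using assms by (auto simp: sets_vimage_algebra2)

lemma X_noise:
  assumes "0 \<le> t"
  shows "X n \<beta> t \<in> borel_measurable noise_algebra"
proof (rule measurableI)
  fix A :: "real set" assume "A \<in> sets borel"
  from noise_sets_sojourn[OF assms this]
  show "X n \<beta> t -` A \<inter> space noise_algebra \<in> sets noise_algebra"
    unfolding sets_noise_algebra_eq space_noise_algebra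
        by (intro sigma_sets.Basic UN_I[of "Sojourn n \<beta>"]) auto
qed simp

lemma V_noise:
  assumes "\<beta> \<noteq> \<gamma>"
  shows "V n \<beta> \<gamma> \<in> borel_measurable noise_algebra"
proof (rule measurableI)
  fix A :: "real set" assume "A \<in> sets borel"
  from noise_sets_transition[OF this]
  show "V n \<beta> \<gamma> -` A \<inter> space noise_algebra \<in> sets noise_algebra"
    unfolding sets_noise_algebra_eq space_noise_algebra
    by (intro sigma_sets.Basic UN_I[of "Transition n \<beta> \<gamma>"]) (auto simp: assms)
qed simp

text \<open>One real random variable per source of noise, with the \<open>i\<close>-th sojourn process read off at the
  time \<open>\<tau> i\<close>, so that independence can be stated by \<open>indep_vars\<close> over the index type.\<close>

fun noise_value :: "(nat \<Rightarrow> real) \<Rightarrow> 'e noise \<Rightarrow> 'v \<Rightarrow> real" where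
  "noise_value \<tau> Chain = (\<lambda>_. 0)"
| "noise_value \<tau> (Sojourn i \<beta>) = X i \<beta> (\<tau> i)"
| "noise_value \<tau> (Transition i \<beta> \<gamma>) = V i \<beta> \<gamma>"

lemma indep_noise_value:
  assumes "\<And>i. 0 \<le> \<tau> i" "I \<subseteq> noise_index"
  shows "indep_vars (\<lambda>_. borel) (noise_value \<tau>) I"
  unfolding indep_vars_def2
proof
  show "\<forall>i\<in>I. random_variable borel (noise_value \<tau> i)"
  proof
    fix i assume "i \<in> I"
    then show "random_variable borel (noise_value \<tau> i)"
      using assms X_rv V_rv by (cases i) auto
  qed
  show "indep_sets (\<lambda>i. {noise_value \<tau> i -` A \<inter> space N |A. A \<in> sets borel}) I"
  proof (rule indep_sets_mono[OF indep])
    fix i assume "i \<in> I"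
    then show "{noise_value \<tau> i -` A \<inter> space N |A. A \<in> sets borel} \<subseteq> noise_sets N Z H X V i"
      using assms noise_sets_sojourn noise_sets_transition
          by (cases i) (auto simp del: noise_sets.simps)
  qed (use assms in auto)
qed

definition path_noise :: "(nat \<Rightarrow> 'e) \<Rightarrow> nat \<Rightarrow> 'e noise set" where
  "path_noise b n = (\<lambda>i. Sojourn i (b i)) ` {..n} \<union> (\<lambda>i. Transition i (b i) (b (Suc i))) ` {..<n}"

lemma prod_path_noise:
  fixes f :: "'e noise \<Rightarrow> 'b::comm_monoid_mult"
  shows "(\<Prod>j\<in>path_noise b n. f j) = (\<Prod>i<n. f (Sojourn i (b i)) * f (Transition i (b i) (b (Suc i))))
      * f (Sojourn n (b n))"
proof -
  have "(\<Prod>j\<in>path_noise b n. f j) = (\<Prod>i\<le>n. f (Sojourn i (b i)))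
      * (\<Prod>i<n. f (Transition i (b i) (b (Suc i))))"
    unfolding path_noise_def
    by (subst prod.union_disjoint) (auto simp: prod.reindex inj_on_def)
  then show ?thesis by (simp add: lessThan_Suc_atMost[symmetric] prod.distrib mult_ac)
qed

lemma path_noise_index: "(\<And>i. i < n \<Longrightarrow> b i \<noteq> b (Suc i)) \<Longrightarrow> path_noise b n \<subseteq> noise_index"
  by (auto simp: path_noise_def)

text \<open>For a frozen chain path the displacement is a sum of independent variables with distinct
  indices.  Consecutive states must differ, since the variables \<open>V i \<beta> \<beta>\<close> carry no independence.\<close>

lemma nn_integral_path:
  fixes \<sigma> :: real
  assumes \<tau>: "\<And>i. 0 \<le> \<tau> i" and b: "\<And>i. i < n \<Longrightarrow> b i \<noteq> b (Suc i)"
  shows "(\<integral>\<^sup>+\<omega>. ennreal (exp (\<sigma> * ((\<Sum>i<n. X i (b i) (\<tau> i) \<omega> + V i (b i) (b (Suc i)) \<omega>)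
      + X n (b n) (\<tau> n) \<omega>))) \<partial>N)
    = (\<Prod>i<n. (\<integral>\<^sup>+\<omega>. ennreal (exp (\<sigma> * X i (b i) (\<tau> i) \<omega>)) \<partial>N)
        * (\<integral>\<^sup>+\<omega>. ennreal (exp (\<sigma> * V i (b i) (b (Suc i)) \<omega>)) \<partial>N))
       * (\<integral>\<^sup>+\<omega>. ennreal (exp (\<sigma> * X n (b n) (\<tau> n) \<omega>)) \<partial>N)"
proof -
  have sub: "path_noise b n \<subseteq> noise_index" by (rule path_noise_index) (rule b)
  have "indep_vars (\<lambda>_. borel) (\<lambda>j \<omega>. ennreal (exp (\<sigma> * noise_value \<tau> j \<omega>))) (path_noise b n)"
    by (rule indep_vars_compose2[OF indep_noise_value[OF \<tau> sub]]) auto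
  moreover have "finite (path_noise b n)" by (simp add: path_noise_def)
  ultimately have "(\<integral>\<^sup>+\<omega>. (\<Prod>j\<in>path_noise b n. ennreal (exp (\<sigma> * noise_value \<tau> j \<omega>))) \<partial>N)
      = (\<Prod>j\<in>path_noise b n. \<integral>\<^sup>+\<omega>. ennreal (exp (\<sigma> * noise_value \<tau> j \<omega>)) \<partial>N)"
    by (intro indep_vars_nn_integral) auto
  moreover have "(\<Prod>j\<in>path_noise b n. ennreal (exp (\<sigma> * noise_value \<tau> j \<omega>)))
     = ennreal (exp (\<sigma> * ((\<Sum>i<n. X i (b i) (\<tau> i) \<omega> + V i (b i) (b (Suc i)) \<omega>)
         + X n (b n) (\<tau> n) \<omega>)))" for \<omega>
    unfolding prod_path_noise
    by (simp add: distrib_left exp_add sum_distrib_left exp_sum prod_ennreal prod_nonneg flip: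
        ennreal_mult)
  ultimately show ?thesis unfolding prod_path_noise by simp
qed

lemma integral_path:
  fixes z :: complex
  assumes \<tau>: "\<And>i. 0 \<le> \<tau> i" and b: "\<And>i. i < n \<Longrightarrow> b i \<noteq> b (Suc i)"
    and iX: "\<And>i \<beta> s. 0 \<le> s \<Longrightarrow> integrable N (\<lambda>\<omega>. exp (z * of_real (X i \<beta> s \<omega>)))"
    and iV: "\<And>i \<beta> \<gamma>. \<beta> \<noteq> \<gamma> \<Longrightarrow> integrable N (\<lambda>\<omega>. exp (z * of_real (V i \<beta> \<gamma> \<omega>)))"
  shows "(LINT \<omega>|N. exp (z * of_real ((\<Sum>i<n. X i (b i) (\<tau> i) \<omega> + V i (b i) (b (Suc i)) \<omega>)
      + X n (b n) (\<tau> n) \<omega>)))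
    = (\<Prod>i<n. (LINT \<omega>|N. exp (z * of_real (X i (b i) (\<tau> i) \<omega>)))
        * (LINT \<omega>|N. exp (z * of_real (V i (b i) (b (Suc i)) \<omega>))))
       * (LINT \<omega>|N. exp (z * of_real (X n (b n) (\<tau> n) \<omega>)))"
proof -
  have sub: "path_noise b n \<subseteq> noise_index" by (rule path_noise_index) (rule b)
  have "indep_vars (\<lambda>_. borel) (\<lambda>j \<omega>. exp (z * of_real (noise_value \<tau> j \<omega>))) (path_noise b n)"
    by (rule indep_vars_compose2[OF indep_noise_value[OF \<tau> sub]]) auto
  moreover have "integrable N (\<lambda>\<omega>. exp (z * of_real (noise_value \<tau> j \<omega>)))" if "j
      \<in> path_noise b n" for j
    using that b iX iV \<tau> by (auto simp: path_noise_def simp del: of_real_sum)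
  moreover have "finite (path_noise b n)" by (simp add: path_noise_def)
  ultimately have "(LINT \<omega>|N. (\<Prod>j\<in>path_noise b n. exp (z * of_real (noise_value \<tau> j \<omega>))))
      = (\<Prod>j\<in>path_noise b n. LINT \<omega>|N. exp (z * of_real (noise_value \<tau> j \<omega>)))"
    by (intro indep_vars_lebesgue_integral) auto
  moreover have "(\<Prod>j\<in>path_noise b n. exp (z * of_real (noise_value \<tau> j \<omega>)))
     = exp (z * of_real ((\<Sum>i<n. X i (b i) (\<tau> i) \<omega> + V i (b i) (b (Suc i)) \<omega>) + X n (b n) (\<tau> n) \<omega>))"
         for \<omega>
    unfolding prod_path_noise
    by (simp add: distrib_left exp_add sum_distrib_left exp_sum)
  ultimately show ?thesis unfolding prod_path_noise by simp
qed

end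

context noisy_chain begin

text \<open>On the diagonal \<open>V\<close> need not be measurable with respect to the noise; it is replaced by \<open>0\<close>
  there, which changes the level only on a null set.\<close>

abbreviation V' :: "nat \<Rightarrow> 'e \<Rightarrow> 'e \<Rightarrow> 'v \<Rightarrow> real" where
  "V' n \<beta> \<gamma> \<equiv> (if \<beta> = \<gamma> then (\<lambda>_. 0) else V n \<beta> \<gamma>)"

lemma mixed_level_chain_noise:
  "(\<lambda>x. mixed_level Z H X V' t (fst x) (snd x))
      \<in> borel_measurable (chain_algebra \<Otimes>\<^sub>M noise_algebra)"
  by (rule mixed_level_measurable) (auto simp: chain_algebra_ZH X_noise V_noise X_cadlag)

lemma built_level_measurable:
  assumes "0 \<le> t"
  shows "built_level Z H X V t \<in> borel_measurable N"
proof -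
  have m: "(\<lambda>x. mixed_level Z H X V t (fst x) (snd x)) \<in> borel_measurable (N \<Otimes>\<^sub>M N)"
    by (rule mixed_level_measurable) (auto simp: X_rv V_rv X_cadlag)
  have "(\<lambda>\<omega>. mixed_level Z H X V t \<omega> \<omega>) \<in> borel_measurable N"
    using measurable_compose[OF _ m, of "\<lambda>\<omega>. (\<omega>, \<omega>)" N] by simp
  then show ?thesis
    by (subst measurable_cong[where g = "\<lambda>\<omega>. mixed_level Z H X V t \<omega> \<omega>"])
        (simp_all add: mixed_level_diag assms)
qed

lemma built_chain_measurable: "built_chain Z H t \<in> N \<rightarrow>\<^sub>M count_space UNIV"
  unfolding built_chain_def
  by (rule measurable_compose_countable[where f = "\<lambda>n \<omega>. Z n \<omega>", OF _ jump_count_measurable])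
      measurable

lemma AE_proper_path:
  assumes "0 \<le> t"
  shows "AE \<omega> in N. \<forall>i<jump_count H t \<omega>. Z i \<omega> \<noteq> Z (Suc i) \<omega>"
  using AE_rate_pos
proof (rule AE_mp, intro AE_I2 impI allI)
  fix \<omega> i assume *: "\<omega> \<in> space N" "\<forall>n. H n \<omega> < \<infinity> \<longrightarrow> Z n \<omega> \<noteq> Z (Suc n) \<omega>
      \<and> 0 < q (Z n \<omega>) (Z (Suc n) \<omega>)" "i < jump_count H t \<omega>"
  have "\<forall>i<jump_count H t \<omega>. H i \<omega> < \<infinity>"
    using jump_time_count_le[OF *(1) assms] unfolding jump_time_le_iff[OF *(1)] by (rule conjunct1)
  with * show "Z i \<omega> \<noteq> Z (Suc i) \<omega>" by blast
qed

lemma mixed_level_V':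
  assumes "\<forall>i<jump_count H t \<omega>. Z i \<omega> \<noteq> Z (Suc i) \<omega>"
  shows "mixed_level Z H X V' t \<omega> \<omega>' = mixed_level Z H X V t \<omega> \<omega>'"
  using assms unfolding mixed_level_def Let_def
      by (intro arg_cong2[of _ _ _ _ "(+)"] sum.cong refl) auto

lemma mixed_level_diag_V':
  assumes "\<omega> \<in> space N" "0 \<le> t" "\<forall>i<jump_count H t \<omega>. Z i \<omega> \<noteq> Z (Suc i) \<omega>"
  shows "mixed_level Z H X V' t \<omega> \<omega> = built_level Z H X V t \<omega>"
  unfolding mixed_level_V'[OF assms(3)] by (rule mixed_level_diag[OF assms(1,2)])

lemma mixed_level_path:
  assumes "\<forall>i<jump_count H t \<omega>. Z i \<omega> \<noteq> Z (Suc i) \<omega>" "n = jump_count H t \<omega>"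
    "\<tau> = (\<lambda>i. max 0 (if i < n then hold i \<omega> else t - real_of_ereal (jump_time H n \<omega>)))"
  shows "mixed_level Z H X V' t \<omega> \<omega>' = (\<Sum>i<n. X i (Z i \<omega>) (\<tau> i) \<omega>' + V i (Z i \<omega>) (Z (Suc i) \<omega>) \<omega>')
      + X n (Z n \<omega>) (\<tau> n) \<omega>'"
  unfolding mixed_level_V'[OF assms(1)] unfolding mixed_level_def Let_def assms(2)[symmetric]
  by (simp add: assms(3))

lemma path_weight_path:
  assumes "\<omega> \<in> space N" "0 \<le> t" "n = jump_count H t \<omega>"
    "\<tau> = (\<lambda>i. max 0 (if i < n then hold i \<omega> else t - real_of_ereal (jump_time H n \<omega>)))"
  shows "path_weight Z H g c t \<omega> = (\<Prod>i<n. g (Z i \<omega>) (\<tau> i) * c (Z i \<omega>) (Z (Suc i) \<omega>))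
      * g (Z n \<omega>) (\<tau> n)"
proof -
  have "jump_time H n \<omega> \<le> ereal t" unfolding assms(3) by (rule jump_time_count_le[OF assms(1,2)])
  then have "jump_time H n \<omega> \<noteq> \<infinity>" by auto
  moreover have "clock n \<omega> \<le> t"
    using jump_time_count_le[OF assms(1,2)] unfolding assms(3)[symmetric]
        by (simp add: jump_time_le_iff[OF assms(1)])
  ultimately have "0 \<le> t - real_of_ereal (jump_time H n \<omega>)" by (simp add: clock_eq[OF assms(1)])
  moreover have "0 \<le> real_of_ereal (H i \<omega>)" for i
      by (rule real_of_ereal_pos[OF H_nonneg[OF assms(1)]])
  ultimately show ?thesis
    unfolding path_weight_def Let_def assms(3)[symmetric] by (simp add: assms(4) max_def)
qed

text \<open>Freeze the chain, integrate the noise.  In this form no moment has to be finite, so it can be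
  used to find out which moments are.\<close>

lemma nn_integral_built_level:
  fixes \<sigma> :: real
  assumes t: "0 \<le> t"
    and g: "\<And>n \<beta> s. 0 \<le> s \<Longrightarrow> (\<integral>\<^sup>+\<omega>. ennreal (exp (\<sigma> * X n \<beta> s \<omega>)) \<partial>N) = g \<beta> s"
    and G: "\<And>n \<beta> \<gamma>. \<beta> \<noteq> \<gamma> \<Longrightarrow> (\<integral>\<^sup>+\<omega>. ennreal (exp (\<sigma> * V n \<beta> \<gamma> \<omega>)) \<partial>N) = G \<beta> \<gamma>"
  shows "(\<integral>\<^sup>+\<omega>. ennreal (exp (\<sigma> * built_level Z H X V t \<omega>)) \<partial>N)
      = (\<integral>\<^sup>+\<omega>. path_weight Z H g G t \<omega> \<partial>N)"
proof -
  let ?f = "\<lambda>\<omega> \<omega>'. ennreal (exp (\<sigma> * mixed_level Z H X V' t \<omega> \<omega>'))"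
  have "(\<integral>\<^sup>+\<omega>. ennreal (exp (\<sigma> * built_level Z H X V t \<omega>)) \<partial>N) = (\<integral>\<^sup>+\<omega>. ?f \<omega> \<omega> \<partial>N)"
    by (rule nn_integral_cong_AE, rule AE_mp[OF AE_proper_path[OF t]], intro AE_I2 impI)
      (simp add: mixed_level_diag_V'[OF _ t])
  also have "\<dots> = (\<integral>\<^sup>+\<omega>. \<integral>\<^sup>+\<omega>'. ?f \<omega> \<omega>' \<partial>N \<partial>N)"
  proof (rule nn_integral_chain_noise)
    note [measurable] = mixed_level_chain_noise
    show "case_prod ?f \<in> borel_measurable (chain_algebra \<Otimes>\<^sub>M noise_algebra)"
      unfolding split_beta' by measurable
  qed
  also have "\<dots> = (\<integral>\<^sup>+\<omega>. path_weight Z H g G t \<omega> \<partial>N)"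
  proof (rule nn_integral_cong_AE, rule AE_mp[OF AE_proper_path[OF t]], intro AE_I2 impI)
    fix \<omega> assume \<omega>: "\<omega> \<in> space N" and proper: "\<forall>i<jump_count H t \<omega>. Z i \<omega> \<noteq> Z (Suc i) \<omega>"
    define n where "n = jump_count H t \<omega>"
    define \<tau> where "\<tau> = (\<lambda>i. max 0 (if i < n then hold i \<omega> else t
        - real_of_ereal (jump_time H n \<omega>)))"
    have \<tau>0: "0 \<le> \<tau> i" for i by (simp add: \<tau>_def)
    have pr: "Z i \<omega> \<noteq> Z (Suc i) \<omega>" if "i < n" for i using proper that by (simp add: n_def)
    have "(\<integral>\<^sup>+\<omega>'. ?f \<omega> \<omega>' \<partial>N) = (\<integral>\<^sup>+\<omega>'. ennreal
        (exp (\<sigma> * ((\<Sum>i<n. X i (Z i \<omega>) (\<tau> i) \<omega>' + V i (Z i \<omega>) (Z (Suc i) \<omega>) \<omega>')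
            + X n (Z n \<omega>) (\<tau> n) \<omega>'))) \<partial>N)"
      by (simp only: mixed_level_path[OF proper n_def \<tau>_def])
    also have "\<dots> = (\<Prod>i<n. g (Z i \<omega>) (\<tau> i) * G (Z i \<omega>) (Z (Suc i) \<omega>)) * g (Z n \<omega>) (\<tau> n)"
      by (subst nn_integral_path[OF \<tau>0, where b = "\<lambda>i. Z i \<omega>"])
          (auto simp: pr g[OF \<tau>0] G intro!: prod.cong)
    finally show "(\<integral>\<^sup>+\<omega>'. ?f \<omega> \<omega>' \<partial>N) = path_weight Z H g G t \<omega>"
      by (simp only: path_weight_path[OF \<omega> t n_def \<tau>_def])
  qed
  finally show ?thesis .
qed

lemma integral_built_level:
  fixes z :: complex
  assumes t: "0 \<le> t"
    and int: "integrable N (\<lambda>\<omega>. exp (z * of_real (built_level Z H X V t \<omega>)))"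
    and iX: "\<And>i \<beta> s. 0 \<le> s \<Longrightarrow> integrable N (\<lambda>\<omega>. exp (z * of_real (X i \<beta> s \<omega>)))"
    and iV: "\<And>i \<beta> \<gamma>. \<beta> \<noteq> \<gamma> \<Longrightarrow> integrable N (\<lambda>\<omega>. exp (z * of_real (V i \<beta> \<gamma> \<omega>)))"
    and g: "\<And>n \<beta> s. 0 \<le> s \<Longrightarrow> (LINT \<omega>|N. exp (z * of_real (X n \<beta> s \<omega>))) = g \<beta> s"
    and G: "\<And>n \<beta> \<gamma>. \<beta> \<noteq> \<gamma> \<Longrightarrow> (LINT \<omega>|N. exp (z * of_real (V n \<beta> \<gamma> \<omega>))) = G \<beta> \<gamma>"
    and pw: "path_weight Z H g G t \<in> borel_measurable N"
  shows "(LINT \<omega>|N. exp (z * of_real (built_level Z H X V t \<omega>)))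
      = (LINT \<omega>|N. path_weight Z H g G t \<omega>)"
proof -
  let ?f = "\<lambda>\<omega> \<omega>'. exp (z * of_real (mixed_level Z H X V' t \<omega> \<omega>'))"
  note [measurable] = mixed_level_chain_noise
  have fm: "case_prod ?f \<in> borel_measurable (chain_algebra \<Otimes>\<^sub>M noise_algebra)"
    unfolding split_beta' by measurable
  have fd: "(\<lambda>\<omega>. ?f \<omega> \<omega>) \<in> borel_measurable N"
    using measurable_compose[OF measurable_Pair[OF measurable_chain_id measurable_noise_id] fm]
        by simp
  have ae: "AE \<omega> in N. exp (z * of_real (built_level Z H X V t \<omega>)) = ?f \<omega> \<omega>"
    by (rule AE_mp[OF AE_proper_path[OF t]], intro AE_I2 impI)
      (simp add: mixed_level_diag_V'[OF _ t])
  have "(LINT \<omega>|N. exp (z * of_real (built_level Z H X V t \<omega>))) = (LINT \<omega>|N. ?f \<omega> \<omega>)"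
    by (rule integral_cong_AE[OF borel_measurable_integrable[OF int] fd ae])
  also have "\<dots> = (LINT \<omega>|N. LINT \<omega>'|N. ?f \<omega> \<omega>')"
    by (rule integral_chain_noise[OF fm integrable_cong_AE_imp[OF int fd]]) (use ae in auto)
  also have "\<dots> = (LINT \<omega>|N. path_weight Z H g G t \<omega>)"
  proof (rule integral_cong_AE[OF _ pw])
    show "(\<lambda>\<omega>. LINT \<omega>'|N. ?f \<omega> \<omega>') \<in> borel_measurable N"
    proof -
      have "(\<lambda>x. (fst x, snd x)) \<in> N \<Otimes>\<^sub>M N \<rightarrow>\<^sub>M chain_algebra \<Otimes>\<^sub>M noise_algebra"
        by (intro measurable_Pair measurable_compose[OF measurable_fst measurable_chain_id]
            measurable_compose[OF measurable_snd measurable_noise_id])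
      from measurable_compose[OF this fm]
      have [measurable]: "case_prod ?f \<in> borel_measurable (N \<Otimes>\<^sub>M N)" by (simp add: split_beta')
      show ?thesis by measurable
    qed
    show "AE \<omega> in N. (LINT \<omega>'|N. ?f \<omega> \<omega>') = path_weight Z H g G t \<omega>"
    proof (rule AE_mp[OF AE_proper_path[OF t]], intro AE_I2 impI)
      fix \<omega> assume \<omega>: "\<omega> \<in> space N" and proper: "\<forall>i<jump_count H t \<omega>. Z i \<omega> \<noteq> Z (Suc i) \<omega>"
      define n where "n = jump_count H t \<omega>"
      define \<tau> where "\<tau> = (\<lambda>i. max 0 (if i < n then hold i \<omega> else t
          - real_of_ereal (jump_time H n \<omega>)))"
      have \<tau>0: "0 \<le> \<tau> i" for i by (simp add: \<tau>_def)
      have pr: "Z i \<omega> \<noteq> Z (Suc i) \<omega>" if "i < n" for i using proper that by (simp add: n_def)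
      have "(LINT \<omega>'|N. ?f \<omega> \<omega>') = (LINT \<omega>'|N. exp
          (z * of_real ((\<Sum>i<n. X i (Z i \<omega>) (\<tau> i) \<omega>' + V i (Z i \<omega>) (Z (Suc i) \<omega>) \<omega>')
              + X n (Z n \<omega>) (\<tau> n) \<omega>')))"
        by (simp only: mixed_level_path[OF proper n_def \<tau>_def])
      also have "\<dots> = (\<Prod>i<n. g (Z i \<omega>) (\<tau> i) * G (Z i \<omega>) (Z (Suc i) \<omega>)) * g (Z n \<omega>) (\<tau> n)"
        by (subst integral_path[OF \<tau>0, where b = "\<lambda>i. Z i \<omega>"])
          (auto simp: pr g[OF \<tau>0] G intro!: prod.cong iX iV simp del: of_real_sum)
      finally show "(LINT \<omega>'|N. ?f \<omega> \<omega>') = path_weight Z H g G t \<omega>"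
        by (simp only: path_weight_path[OF \<omega> t n_def \<tau>_def])
    qed
  qed
  finally show ?thesis .
qed

end

section \<open>Reachable states have finite moments\<close>

context jump_chain begin

lemma space_in_past[simp]: "space N \<in> sets (past n)"
  using sets.top[of "past n"] by simp

lemma fast_event_past:
  "{\<omega> \<in> space N. \<forall>i<n. H i \<omega> \<le> ereal \<epsilon>} \<in> sets (past n)"
proof -
  have "{\<omega> \<in> space (past n). H i \<omega> \<le> ereal \<epsilon>} \<in> sets (past n)" if "i < n" for i
    using H_past[OF that] by measurable
  then have "(\<Inter>i\<in>{..<n}. {\<omega> \<in> space (past n). H i \<omega> \<le> ereal \<epsilon>}) \<inter> space (past n) \<in> sets (past n)"
    by (cases "n = 0") (auto intro!: sets.Int sets.finite_INT)
  moreover have "(\<Inter>i\<in>{..<n}. {\<omega> \<in> space (past n). H i \<omega> \<le> ereal \<epsilon>}) \<inter> space (past n)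
      = {\<omega> \<in> space N. \<forall>i<n. H i \<omega> \<le> ereal \<epsilon>}"
    by auto
  ultimately show ?thesis by (simp only:)
qed

lemma jump_step_any_time:
  assumes A: "A \<in> sets (past n)"
  shows "prob (A \<inter> {\<omega> \<in> space N. Z n \<omega> = \<beta> \<and> Z (Suc n) \<omega> = \<gamma>}) = prob (A \<inter> {\<omega> \<in> space N. Z n \<omega> = \<beta>})
      * jump_prob q \<beta> \<gamma>"
proof -
  have AN: "A \<in> sets N" by (rule past_subset[OF A])
  have "prob (A \<inter> {\<omega> \<in> space N. Z n \<omega> = \<beta> \<and> Z (Suc n) \<omega> = \<gamma>})
      = prob (A \<inter> {\<omega> \<in> space N. Z n \<omega> = \<beta> \<and> Z (Suc n) \<omega> = \<gamma> \<and> ereal 0 < H n \<omega>})"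
  proof (rule finite_measure_eq_AE)
    show "AE \<omega> in N. \<omega> \<in> A \<inter> {\<omega> \<in> space N. Z n \<omega> = \<beta> \<and> Z (Suc n) \<omega> = \<gamma>}
        \<longleftrightarrow> \<omega> \<in> A \<inter> {\<omega> \<in> space N. Z n \<omega> = \<beta> \<and> Z (Suc n) \<omega> = \<gamma> \<and> ereal 0 < H n \<omega>}"
      by (rule AE_mp[OF AE_H_pos], intro AE_I2 impI) (simp flip: zero_ereal_def)
  qed (use AN in measurable)
  then show ?thesis using jump_step[OF A, of 0 \<beta> \<gamma>] by simp
qed

text \<open>A jump along a positive rate happens within any given time \<open>\<epsilon>\<close> with positive probability.\<close>

lemma fast_step:
  assumes pos: "0 < prob {\<omega> \<in> space N. Z n \<omega> = \<beta> \<and> (\<forall>i<n. H i \<omega> \<le> ereal \<epsilon>)}"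
    and \<epsilon>: "0 < \<epsilon>" and rate: "0 < rate \<beta> \<gamma>"
  shows "0 < prob {\<omega> \<in> space N. Z n \<omega> = \<beta> \<and> Z (Suc n) \<omega> = \<gamma> \<and> (\<forall>i<Suc n. H i \<omega> \<le> ereal \<epsilon>)}"
proof -
  let ?A = "{\<omega> \<in> space N. \<forall>i<n. H i \<omega> \<le> ereal \<epsilon>}"
  have A: "?A \<in> sets (past n)" by (rule fast_event_past)
  have AN: "?A \<in> sets N" by (rule past_subset[OF A])
  have eq: "{\<omega> \<in> space N. Z n \<omega> = \<beta> \<and> Z (Suc n) \<omega> = \<gamma> \<and> (\<forall>i<Suc n. H i \<omega> \<le> ereal \<epsilon>)}
     = ?A \<inter> {\<omega> \<in> space N. Z n \<omega> = \<beta> \<and> Z (Suc n) \<omega> = \<gamma>}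
         - ?A \<inter> {\<omega> \<in> space N. Z n \<omega> = \<beta> \<and> Z (Suc n) \<omega> = \<gamma> \<and> ereal \<epsilon> < H n \<omega>}"
    by (auto simp: less_Suc_eq not_less)
  have pq: "0 < jump_prob q \<beta> \<gamma> * exit_rate q \<beta>" using rate by (simp add: jump_prob_exit_rate)
  then have p: "0 < jump_prob q \<beta> \<gamma>" "0 < exit_rate q \<beta>"
    using jump_prob_nonneg[of \<beta> \<gamma>] exit_rate_nonneg[of \<beta>] by (auto simp: zero_less_mult_iff)
  have "prob {\<omega> \<in> space N. Z n \<omega> = \<beta> \<and> Z (Suc n) \<omega> = \<gamma> \<and> (\<forall>i<Suc n. H i \<omega> \<le> ereal \<epsilon>)}
     = prob (?A \<inter> {\<omega> \<in> space N. Z n \<omega> = \<beta> \<and> Z (Suc n) \<omega> = \<gamma>})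
         - prob (?A \<inter> {\<omega> \<in> space N. Z n \<omega> = \<beta> \<and> Z (Suc n) \<omega> = \<gamma> \<and> ereal \<epsilon> < H n \<omega>})"
    unfolding eq by (rule finite_measure_Diff) (use AN in auto)
  also have "\<dots> = prob (?A \<inter> {\<omega> \<in> space N. Z n \<omega> = \<beta>}) * jump_prob q \<beta> \<gamma>
      * (1 - exp (- exit_rate q \<beta> * \<epsilon>))"
    using jump_step_any_time[OF A, of \<beta> \<gamma>] jump_step[OF A, of \<epsilon> \<beta> \<gamma>] \<epsilon> by (simp add: algebra_simps)
  also have "?A \<inter> {\<omega> \<in> space N. Z n \<omega> = \<beta>} = {\<omega> \<in> space N. Z n \<omega> = \<beta> \<and> (\<forall>i<n. H i \<omega> \<le> ereal \<epsilon>)}"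
      by auto
  also have "0 < prob {\<omega> \<in> space N. Z n \<omega> = \<beta> \<and> (\<forall>i<n. H i \<omega> \<le> ereal \<epsilon>)} * jump_prob q \<beta> \<gamma>
      * (1 - exp (- exit_rate q \<beta> * \<epsilon>))"
    using pos p \<epsilon> by simp
  finally show ?thesis .
qed

text \<open>The number \<open>m\<close> of jumps must not depend on \<open>\<epsilon>\<close>: later \<open>\<epsilon>\<close> is chosen in terms of \<open>m\<close> so that all
  \<open>m\<close> jumps happen before a given time.  Steps in which the state is repeated are dropped, as they
  come from an absorbing state; therefore \<open>m\<close> may be smaller than \<open>n\<close>.\<close>

lemma reach_fast:
  assumes "0 < prob {\<omega> \<in> space N. Z n \<omega> = \<beta>}"
  shows "\<exists>m. \<forall>\<epsilon>>0. 0 < prob {\<omega> \<in> space N. Z m \<omega> = \<beta> \<and> (\<forall>i<m. H i \<omega> \<le> ereal \<epsilon>)}"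
  using assms
proof (induction n arbitrary: \<beta>)
  case 0
  then show ?case by (intro exI[of _ 0]) simp
next
  case (Suc n \<gamma>)
  let ?S = "\<lambda>\<beta>. {\<omega> \<in> space N. Z n \<omega> = \<beta> \<and> Z (Suc n) \<omega> = \<gamma>}"
  have "\<exists>\<beta>. 0 < prob (?S \<beta>)"
  proof (rule ccontr)
    assume "\<not> ?thesis"
    then have "prob (?S \<beta>) = 0" for \<beta> by (simp add: zero_less_measure_iff)
    moreover have "{\<omega> \<in> space N. Z (Suc n) \<omega> = \<gamma>} = (\<Union>\<beta>\<in>UNIV. ?S \<beta>)" by auto
    moreover have "prob (\<Union>\<beta>\<in>UNIV. ?S \<beta>) \<le> (\<Sum>\<beta>\<in>UNIV. prob (?S \<beta>))"
      by (rule finite_measure_subadditive_finite) auto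
    ultimately show False using Suc.prems by simp
  qed
  then obtain \<beta> where \<beta>: "0 < prob (?S \<beta>)" by blast
  have "prob (?S \<beta>) = prob {\<omega> \<in> space N. Z n \<omega> = \<beta>} * jump_prob q \<beta> \<gamma>"
    using jump_step_any_time[OF sets.top[of "past n"], of \<beta> \<gamma>]
        by (simp add: Int_absorb1 Int_def cong: conj_cong)
  with \<beta> have pos: "0 < prob {\<omega> \<in> space N. Z n \<omega> = \<beta>}" "0 < jump_prob q \<beta> \<gamma>"
    by (auto simp: zero_less_mult_iff not_less[symmetric] measure_nonneg dest: less_le_trans)
  obtain m where m: "\<forall>\<epsilon>>0. 0 < prob {\<omega> \<in> space N. Z m \<omega> = \<beta> \<and> (\<forall>i<m. H i \<omega> \<le> ereal \<epsilon>)}"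
    using Suc.IH[OF pos(1)] by blast
  show ?case
  proof (cases "\<beta> = \<gamma>")
    case True
    then show ?thesis using m by blast
  next
    case False
    have "0 < rate \<beta> \<gamma>"
      using pos(2) False exit_rate_nonneg[of \<beta>]
          by (auto simp: jump_prob_def rate_def zero_less_divide_iff split: if_splits)
    have "0 < prob {\<omega> \<in> space N. Z (Suc m) \<omega> = \<gamma> \<and> (\<forall>i<Suc m. H i \<omega> \<le> ereal \<epsilon>)}" if "0 < \<epsilon>" for \<epsilon>
    proof -
      have "0 < prob {\<omega> \<in> space N. Z m \<omega> = \<beta> \<and> Z (Suc m) \<omega> = \<gamma> \<and> (\<forall>i<Suc m. H i \<omega> \<le> ereal \<epsilon>)}"
        using m that \<open>0 < rate \<beta> \<gamma>\<close> by (intro fast_step) auto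
      also have "\<dots> \<le> prob {\<omega> \<in> space N. Z (Suc m) \<omega> = \<gamma> \<and> (\<forall>i<Suc m. H i \<omega> \<le> ereal \<epsilon>)}"
        by (rule finite_measure_mono) auto
      finally show ?thesis .
    qed
    then show ?thesis by blast
  qed
qed

lemma long_sojourn:
  assumes A: "A \<in> sets (past n)" and pos: "0 < prob (A \<inter> {\<omega> \<in> space N. Z n \<omega> = \<beta>})" and t: "0 \<le> t"
  shows "0 < prob (A \<inter> {\<omega> \<in> space N. Z n \<omega> = \<beta> \<and> ereal t < H n \<omega>})"
proof -
  obtain \<gamma> where \<gamma>: "0 < jump_prob q \<beta> \<gamma>"
  proof (rule ccontr)
    assume "\<not> thesis"
    then have "jump_prob q \<beta> \<gamma> \<le> 0" for \<gamma> using that by (meson not_less)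
    then have "(\<Sum>\<gamma>\<in>UNIV. jump_prob q \<beta> \<gamma>) \<le> 0" by (intro sum_nonpos)
    then show False by (simp add: sum_jump_prob)
  qed
  have "0 < prob (A \<inter> {\<omega> \<in> space N. Z n \<omega> = \<beta>}) * (jump_prob q \<beta> \<gamma> * exp (- exit_rate q \<beta> * t))"
    using pos \<gamma> by simp
  also have "\<dots> = prob (A \<inter> {\<omega> \<in> space N. Z n \<omega> = \<beta> \<and> Z (Suc n) \<omega> = \<gamma> \<and> ereal t < H n \<omega>})"
    by (rule jump_step[OF A t, symmetric])
  also have "\<dots> \<le> prob (A \<inter> {\<omega> \<in> space N. Z n \<omega> = \<beta> \<and> ereal t < H n \<omega>})"
    by (rule finite_measure_mono) (use past_subset[OF A] in auto)
  finally show ?thesis .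
qed

lemma few_jumps:
  assumes \<omega>: "\<omega> \<in> space N" and fast: "\<forall>i<n. H i \<omega>
      \<le> ereal (t / real (Suc n))" and last: "ereal t < H n \<omega>" and t: "0 < t"
  shows "jump_count H t \<omega> = n" and "0 < t - real_of_ereal (jump_time H n \<omega>)"
proof -
  have fin: "\<forall>i<n. H i \<omega> < \<infinity>" using fast
  proof (intro allI impI)
    fix i assume "i < n"
    with fast have "H i \<omega> \<le> ereal (t / real (Suc n))" by blast
    then show "H i \<omega> < \<infinity>" by (rule le_less_trans) simp
  qed
  have "clock n \<omega> \<le> (\<Sum>i<n. t / real (Suc n))"
    unfolding clock_def
  proof (rule sum_mono)
    fix i assume "i \<in> {..<n}"
    then have "H i \<omega> \<le> ereal (t / real (Suc n))" using fast by auto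
    with H_nonneg[OF \<omega>, of i] show "hold i \<omega> \<le> t / real (Suc n)" by (cases "H i \<omega>") auto
  qed
  also have "\<dots> < t" using t by (simp add: field_simps)
  finally have cl: "clock n \<omega> < t" .
  have jt: "jump_time H n \<omega> = ereal (clock n \<omega>)" using fin by (intro jump_time_eq_clock \<omega>) auto
  then show "0 < t - real_of_ereal (jump_time H n \<omega>)" using cl by simp
  have "jump_time H (Suc n) \<omega> = jump_time H n \<omega> + H n \<omega>" by (simp add: jump_time_def)
  moreover have "ereal t < ereal (clock n \<omega>) + H n \<omega>"
    using last clock_nonneg[OF \<omega>, of n] by (cases "H n \<omega>") auto
  ultimately show "jump_count H t \<omega> = n"
    using cl by (intro jump_count_eq \<omega>) (auto simp: jt)
qed

text \<open>A product of nonzero factors is infinite as soon as one factor is.  With positive probability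
  the path reaches \<open>\<beta>\<close> quickly and then stays beyond \<open>t\<close>, and then \<open>g \<beta>\<close> occurs in the weight at a
  positive time; with one more quick jump to \<open>\<gamma>\<close> the factor \<open>G \<beta> \<gamma>\<close> occurs as well.\<close>

lemma finite_factors:
  fixes g :: "'e \<Rightarrow> real \<Rightarrow> ennreal" and G :: "'e \<Rightarrow> 'e \<Rightarrow> ennreal"
  assumes t: "0 < t"
    and fin: "AE \<omega> in N. path_weight Z H g G t \<omega> \<noteq> \<top>"
    and g0: "\<And>\<beta> s. g \<beta> s \<noteq> 0" and G0: "\<And>\<beta> \<gamma>. G \<beta> \<gamma> \<noteq> 0"
    and reach: "0 < prob {\<omega> \<in> space N. Z n \<omega> = \<beta>}"
  shows "\<exists>s>0. g \<beta> s \<noteq> \<top>" and "0 < rate \<beta> \<gamma> \<Longrightarrow> G \<beta> \<gamma> \<noteq> \<top>"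
proof -
  obtain m where m: "\<And>\<epsilon>. 0 < \<epsilon> \<Longrightarrow> 0 < prob {\<omega> \<in> space N. Z m \<omega> = \<beta> \<and> (\<forall>i<m. H i \<omega> \<le> ereal \<epsilon>)}"
    using reach_fast[OF reach] by blast
  have p0: "(\<Prod>i<k. g (Z i \<omega>) (hold i \<omega>) * G (Z i \<omega>) (Z (Suc i) \<omega>)) \<noteq> 0" for k \<omega>
    using g0 G0 by simp
  show "\<exists>s>0. g \<beta> s \<noteq> \<top>"
  proof -
    let ?\<epsilon> = "t / real (Suc m)"
    let ?A = "{\<omega> \<in> space N. \<forall>i<m. H i \<omega> \<le> ereal ?\<epsilon>}"
    have "?A \<inter> {\<omega> \<in> space N. Z m \<omega> = \<beta>} = {\<omega> \<in> space N. Z m \<omega> = \<beta> \<and> (\<forall>i<m. H i \<omega> \<le> ereal ?\<epsilon>)}"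
        by auto
    then have "0 < prob (?A \<inter> {\<omega> \<in> space N. Z m \<omega> = \<beta> \<and> ereal t < H m \<omega>})"
      using m[of ?\<epsilon>] t by (intro long_sojourn fast_event_past) auto
    from AE_witness[OF fin this] obtain \<omega> where
      \<omega>: "\<omega> \<in> space N" "\<forall>i<m. H i \<omega> \<le> ereal ?\<epsilon>" "Z m \<omega>
          = \<beta>" "ereal t < H m \<omega>" "path_weight Z H g G t \<omega> \<noteq> \<top>"
      by blast
    note few = few_jumps[OF \<omega>(1,2,4) t]
    have "g \<beta> (t - real_of_ereal (jump_time H m \<omega>)) \<noteq> \<top>"
      using \<omega>(5) p0[of \<omega> m] g0 unfolding path_weight_def few(1) Let_def \<omega>(3)
      by (auto simp: ennreal_mult_eq_top_iff)
    then show ?thesis using few(2) by blast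
  qed
  assume rate: "0 < rate \<beta> \<gamma>"
  show "G \<beta> \<gamma> \<noteq> \<top>"
  proof -
    let ?\<epsilon> = "t / real (Suc (Suc m))"
    let ?A = "{\<omega> \<in> space N. \<forall>i<Suc m. H i \<omega> \<le> ereal ?\<epsilon>} \<inter> (Z m -` {\<beta>} \<inter> space (past (Suc m)))"
    have A: "?A \<in> sets (past (Suc m))"
      by (intro sets.Int fast_event_past measurable_sets[OF Z_past]) auto
    have "?A \<inter> {\<omega> \<in> space N. Z (Suc m) \<omega> = \<gamma>}
        = {\<omega> \<in> space N. Z m \<omega> = \<beta> \<and> Z (Suc m) \<omega> = \<gamma> \<and> (\<forall>i<Suc m. H i \<omega> \<le> ereal ?\<epsilon>)}" by auto
    moreover have "0 < ?\<epsilon>" using t by simp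
    ultimately have "0 < prob (?A \<inter> {\<omega> \<in> space N. Z (Suc m) \<omega> = \<gamma>})"
      using fast_step[OF m[of ?\<epsilon>], of \<gamma>] rate by simp
    then have "0 < prob (?A \<inter> {\<omega> \<in> space N. Z (Suc m) \<omega> = \<gamma> \<and> ereal t < H (Suc m) \<omega>})"
      using t by (intro long_sojourn A) auto
    from AE_witness[OF fin this] obtain \<omega> where
      \<omega>: "\<omega> \<in> space N" "\<forall>i<Suc m. H i \<omega> \<le> ereal ?\<epsilon>" "Z m \<omega> = \<beta>" "Z (Suc m) \<omega>
          = \<gamma>" "ereal t < H (Suc m) \<omega>" "path_weight Z H g G t \<omega> \<noteq> \<top>"
      by blast
    note few = few_jumps[OF \<omega>(1,2,5) t]
    have "(\<Prod>i<Suc m. g (Z i \<omega>) (hold i \<omega>) * G (Z i \<omega>) (Z (Suc i) \<omega>)) \<noteq> \<top>"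
      using \<omega>(6) g0 unfolding path_weight_def few(1) Let_def
          by (auto simp only: ennreal_mult_eq_top_iff)
    from prod_ennreal_finite[OF _ this, of m]
    have "g (Z m \<omega>) (hold m \<omega>) * G (Z m \<omega>) (Z (Suc m) \<omega>) \<noteq> \<top>"
      using g0 G0 by auto
    then show ?thesis using g0 \<omega>(3,4) by (auto simp: ennreal_mult_eq_top_iff)
  qed
qed

end

section \<open>Exponential moments of Levy processes\<close>

context levy_process begin

definition exp_moment :: "real \<Rightarrow> real \<Rightarrow> ennreal" where
  "exp_moment \<sigma> t = (\<integral>\<^sup>+\<omega>. ennreal (exp (\<sigma> * X t \<omega>)) \<partial>M)"

lemma exp_moment_nonzero: "0 \<le> t \<Longrightarrow> exp_moment \<sigma> t \<noteq> 0"
  unfolding exp_moment_def using random_variable_levy[of t]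
  by (subst nn_integral_0_iff_AE) (auto simp: AE_False)

lemma exp_moment_add:
  assumes "0 \<le> s" "0 \<le> t"
  shows "exp_moment \<sigma> (s + t) = exp_moment \<sigma> s * exp_moment \<sigma> t"
proof -
  note [measurable] = random_variable_levy
  \<comment> \<open>Two increments: from \<open>0\<close> to \<open>s\<close> and from \<open>s\<close> to \<open>s + t\<close>.\<close>
  define \<tau> where "\<tau> i = (if i = 0 then 0 else if i = 1 then s else s + t)" for i :: nat
  have \<tau>: "mono \<tau>" "0 \<le> \<tau> 0" using assms by (auto simp: mono_def \<tau>_def)
  have "indep_vars (\<lambda>_. borel) (\<lambda>i \<omega>. ennreal (exp (\<sigma> * (X (\<tau> (Suc i)) \<omega> - X (\<tau> i) \<omega>))))
      {..<2::nat}"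
    by (rule indep_vars_compose2[OF independent_increments[OF \<tau>]]) auto
  from indep_vars_nn_integral[OF _ this]
  have "(\<integral>\<^sup>+\<omega>. (\<Prod>i<2. ennreal (exp (\<sigma> * (X (\<tau> (Suc i)) \<omega> - X (\<tau> i) \<omega>)))) \<partial>M)
     = (\<Prod>i<2. \<integral>\<^sup>+\<omega>. ennreal (exp (\<sigma> * (X (\<tau> (Suc i)) \<omega> - X (\<tau> i) \<omega>))) \<partial>M)" by simp
  then have prod: "(\<integral>\<^sup>+\<omega>. ennreal (exp (\<sigma> * (X s \<omega> - X 0 \<omega>)))
      * ennreal (exp (\<sigma> * (X (s + t) \<omega> - X s \<omega>))) \<partial>M)
     = (\<integral>\<^sup>+\<omega>. ennreal (exp (\<sigma> * (X s \<omega> - X 0 \<omega>))) \<partial>M)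
         * (\<integral>\<^sup>+\<omega>. ennreal (exp (\<sigma> * (X (s + t) \<omega> - X s \<omega>))) \<partial>M)"
    by (simp add: numeral_2_eq_2 \<tau>_def)
  have "exp_moment \<sigma> (s + t) = (\<integral>\<^sup>+\<omega>. ennreal (exp (\<sigma> * (X s \<omega> - X 0 \<omega>)))
      * ennreal (exp (\<sigma> * (X (s + t) \<omega> - X s \<omega>))) \<partial>M)"
    unfolding exp_moment_def
    by (rule nn_integral_cong_AE, rule AE_mp[OF levy_zero], intro AE_I2 impI)
      (simp add: algebra_simps flip: ennreal_mult exp_add)
  moreover have "(\<integral>\<^sup>+\<omega>. ennreal (exp (\<sigma> * (X s \<omega> - X 0 \<omega>))) \<partial>M) = exp_moment \<sigma> s"
    unfolding exp_moment_def
    by (rule nn_integral_cong_AE, rule AE_mp[OF levy_zero], intro AE_I2 impI) simp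
  moreover have "(\<integral>\<^sup>+\<omega>. ennreal (exp (\<sigma> * (X (s + t) \<omega> - X s \<omega>))) \<partial>M) = exp_moment \<sigma> t"
  proof -
    have [measurable]: "X s \<in> borel_measurable M" "X t \<in> borel_measurable M" "X (s + t)
        \<in> borel_measurable M"
      using assms by (auto intro: random_variable_levy)
    have "(\<integral>\<^sup>+\<omega>. ennreal (exp (\<sigma> * (X (s + t) \<omega> - X s \<omega>))) \<partial>M)
        = (\<integral>\<^sup>+x. ennreal (exp (\<sigma> * x)) \<partial>distr M borel (\<lambda>\<omega>. X (s + t) \<omega> - X s \<omega>))"
      by (subst nn_integral_distr) auto
    also have "\<dots> = exp_moment \<sigma> t"
      unfolding stationary_increments[OF assms] exp_moment_def by (subst nn_integral_distr) auto
    finally show ?thesis .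
  qed
  ultimately show ?thesis using prod by simp
qed

text \<open>The moments form a multiplicative semigroup of nonzero values, so finiteness passes to smaller
  times as a factor and to larger times through powers.\<close>

lemma exp_moment_finite:
  assumes s: "0 < s" and fin: "exp_moment \<sigma> s \<noteq> \<top>" and t: "0 \<le> t"
  shows "exp_moment \<sigma> t \<noteq> \<top>"
proof -
  have mult: "exp_moment \<sigma> (real n * s) \<noteq> \<top>" for n
  proof (induction n)
    case 0
    have "exp_moment \<sigma> 0 = 1"
      unfolding exp_moment_def
      by (subst nn_integral_cong_AE[where v = "\<lambda>_. 1"]) (use levy_zero emeasure_space_1 in \<open>auto elim!: AE_mp\<close>)
    then show ?case by simp
  next
    case (Suc n)
    have "exp_moment \<sigma> (real (Suc n) * s) = exp_moment \<sigma> (real n * s) * exp_moment \<sigma> s"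
      using exp_moment_add[of "real n * s" s \<sigma>] s by (simp add: algebra_simps)
    then show ?case using Suc fin by (simp add: ennreal_mult_eq_top_iff)
  qed
  obtain n where n: "t / s \<le> real n" using real_arch_simple by blast
  then have "t \<le> real n * s" using s by (simp add: field_simps)
  then have "exp_moment \<sigma> (real n * s) = exp_moment \<sigma> t * exp_moment \<sigma> (real n * s - t)"
    using exp_moment_add[of t "real n * s - t" \<sigma>] t by simp
  then show ?thesis
    using mult[of n] exp_moment_nonzero[of "real n * s - t" \<sigma>] \<open>t \<le> real n * s\<close>
    by (auto simp: ennreal_mult_eq_top_iff)
qed

end

section \<open>Exponential moments of the additive component\<close>

lemma path_law_marginal:
  assumes "0 \<le> t" "\<And>t. 0 \<le> t \<Longrightarrow> X t \<in> N \<rightarrow>\<^sub>M S"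
  shows "distr (path_law N S X) S (\<lambda>p. p t) = distr N S (X t)"
proof -
  have "(\<lambda>\<omega>. \<lambda>t\<in>{0..}. X t \<omega>) \<in> N \<rightarrow>\<^sub>M Pi\<^sub>M {0..} (\<lambda>_. S)"
    by (rule measurable_restrict) (use assms in auto)
  moreover have "(\<lambda>p. p t) \<in> Pi\<^sub>M {0..} (\<lambda>_. S) \<rightarrow>\<^sub>M S"
    by (rule measurable_component_singleton) (use assms in auto)
  ultimately have "distr (path_law N S X) S (\<lambda>p. p t)
      = distr N S ((\<lambda>p. p t) \<circ> (\<lambda>\<omega>. \<lambda>t\<in>{0..}. X t \<omega>))"
    unfolding path_law_def by (subst distr_distr) auto
  then show ?thesis using assms(1) by (simp add: comp_def)
qed

context map_characteristics begin

lemma noisy_chain: "noisy_chain (N \<alpha>) q \<alpha> Z H X V"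
proof -
  interpret prob_space "N \<alpha>" by (rule prob_space_N)
  have "indep_sets (noise_sets (N \<alpha>) Z H X V) ({Chain} \<union> noise_index)"
    using independent[of \<alpha>] by (simp add: noise_index_def Un_assoc)
  then show ?thesis
    by unfold_locales (use rates_nonneg chain random_variable_X cadlag_X random_variable_V in auto)
qed

lemma prob_space_D: "prob_space D"
  using levy_L by (simp add: levy_process_def)

lemma L_measurable: "0 \<le> s \<Longrightarrow> L \<beta> s \<in> borel_measurable D"
  by (rule levy_process.random_variable_levy[OF levy_L])

lemma distr_X: "0 \<le> s \<Longrightarrow> distr (N \<alpha>) borel (X n \<beta> s) = distr D borel (L \<beta> s)"
  using path_law_marginal[of s "X n \<beta>" "N \<alpha>" borel] path_law_marginal[of s "L \<beta>" D borel]
  by (simp add: copy_X random_variable_X L_measurable)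

lemma nn_integral_X:
  assumes "0 \<le> s" "f \<in> borel_measurable borel"
  shows "(\<integral>\<^sup>+\<omega>. f (X n \<beta> s \<omega>) \<partial>N \<alpha>) = (\<integral>\<^sup>+\<omega>. f (L \<beta> s \<omega>) \<partial>D)"
  using nn_integral_distr[of "X n \<beta> s" "N \<alpha>" borel f] nn_integral_distr[of "L \<beta> s" D borel f]
    distr_X[OF assms(1), of \<alpha> n \<beta>] assms random_variable_X L_measurable by simp

lemma nn_integral_V:
  assumes "\<beta> \<noteq> \<gamma>" "f \<in> borel_measurable borel"
  shows "(\<integral>\<^sup>+\<omega>. f (V n \<beta> \<gamma> \<omega>) \<partial>N \<alpha>) = (\<integral>\<^sup>+\<omega>. f (U \<beta> \<gamma> \<omega>) \<partial>D)"
  using nn_integral_distr[of "V n \<beta> \<gamma>" "N \<alpha>" borel f] nn_integral_distr[of "U \<beta> \<gamma>" D borel f]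
    copy_V[OF assms(1), of \<alpha> n] assms random_variable_V random_variable_U by simp

lemma integral_X:
  fixes f :: "real \<Rightarrow> complex"
  assumes "0 \<le> s" "f \<in> borel_measurable borel"
  shows "(LINT \<omega>|N \<alpha>. f (X n \<beta> s \<omega>)) = (LINT \<omega>|D. f (L \<beta> s \<omega>))"
    and "integrable (N \<alpha>) (\<lambda>\<omega>. f (X n \<beta> s \<omega>)) \<longleftrightarrow> integrable D (\<lambda>\<omega>. f (L \<beta> s \<omega>))"
  using integral_distr[of "X n \<beta> s" "N \<alpha>" borel f] integral_distr[of "L \<beta> s" D borel f]
    integrable_distr_eq[of "X n \<beta> s" "N \<alpha>" borel f] integrable_distr_eq[of "L \<beta> s" D borel f]
    distr_X[OF assms(1), of \<alpha> n \<beta>] assms random_variable_X L_measurable by simp_all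

lemma integral_V:
  fixes f :: "real \<Rightarrow> complex"
  assumes "\<beta> \<noteq> \<gamma>" "f \<in> borel_measurable borel"
  shows "(LINT \<omega>|N \<alpha>. f (V n \<beta> \<gamma> \<omega>)) = (LINT \<omega>|D. f (U \<beta> \<gamma> \<omega>))"
    and "integrable (N \<alpha>) (\<lambda>\<omega>. f (V n \<beta> \<gamma> \<omega>)) \<longleftrightarrow> integrable D (\<lambda>\<omega>. f (U \<beta> \<gamma> \<omega>))"
  using integral_distr[of "V n \<beta> \<gamma>" "N \<alpha>" borel f] integral_distr[of "U \<beta> \<gamma>" D borel f]
    integrable_distr_eq[of "V n \<beta> \<gamma>" "N \<alpha>" borel f] integrable_distr_eq[of "U \<beta> \<gamma>" D borel f]
    copy_V[OF assms(1), of \<alpha> n] assms random_variable_V random_variable_U by simp_all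

text \<open>Finiteness of the single moment of the displacement from \<open>\<alpha>\<close> forces finiteness of all moments of
  the ingredients.  A transition jump along a zero rate is excluded from the path argument, but it
  vanishes almost surely.\<close>

lemma moments_finite:
  assumes irr: "\<And>\<beta>. \<exists>t\<ge>0. 0 < measure (N \<alpha>) {\<omega> \<in> space (N \<alpha>). built_chain Z H t \<omega> = \<beta>}"
    and T: "0 < T" and fin: "(\<integral>\<^sup>+\<omega>. ennreal (exp (\<sigma> * built_level Z H X V T \<omega>)) \<partial>N \<alpha>) < \<infinity>"
  shows "0 \<le> s \<Longrightarrow> (\<integral>\<^sup>+\<omega>. ennreal (exp (\<sigma> * L \<beta> s \<omega>)) \<partial>D) \<noteq> \<top>"
    and "\<beta> \<noteq> \<gamma> \<Longrightarrow> (\<integral>\<^sup>+\<omega>. ennreal (exp (\<sigma> * U \<beta> \<gamma> \<omega>)) \<partial>D) \<noteq> \<top>"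
proof -
  interpret noisy_chain "N \<alpha>" q \<alpha> Z H X V by (rule noisy_chain)
  interpret D: prob_space D by (rule prob_space_D)
  define g where "g \<beta> s = (\<integral>\<^sup>+\<omega>. ennreal (exp (\<sigma> * L \<beta> (max 0 s) \<omega>)) \<partial>D)" for \<beta> s
  define G where "G \<beta> \<gamma> = (if \<beta> = \<gamma> then 1 else \<integral>\<^sup>+\<omega>. ennreal (exp (\<sigma> * U \<beta> \<gamma> \<omega>)) \<partial>D)" for \<beta> \<gamma>
  have g0: "g \<beta> s \<noteq> 0" for \<beta> s
    using levy_process.exp_moment_nonzero[OF levy_L, of "max 0 s" \<beta> \<sigma>]
    by (simp add: g_def levy_process.exp_moment_def[OF levy_L])
  have G0: "G \<beta> \<gamma> \<noteq> 0" for \<beta> \<gamma>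
  proof (cases "\<beta> = \<gamma>")
    case False
    then show ?thesis
      using random_variable_U[OF False] unfolding G_def
      by simp (subst nn_integral_0_iff_AE, auto simp: D.AE_False)
  qed (simp add: G_def)
  have gm: "g \<beta> \<in> borel_measurable borel" for \<beta>
  proof -
    have [measurable]: "(\<lambda>(t, \<omega>). L \<beta> (max 0 t) \<omega>) \<in> borel_measurable (borel \<Otimes>\<^sub>M D)"
      by (rule cadlag_joint_measurable) (auto intro: L_measurable
          levy_process.levy_cadlag[OF levy_L])
    show ?thesis unfolding g_def by measurable
  qed
  have "(\<integral>\<^sup>+\<omega>. path_weight Z H g G T \<omega> \<partial>N \<alpha>) =
      (\<integral>\<^sup>+\<omega>. ennreal (exp (\<sigma> * built_level Z H X V T \<omega>)) \<partial>N \<alpha>)"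
    using T by (intro nn_integral_built_level[symmetric])
      (auto simp: g_def G_def nn_integral_X[where f = "\<lambda>x. ennreal (exp (\<sigma> * x))"]
          nn_integral_V[where f = "\<lambda>x. ennreal (exp (\<sigma> * x))"])
  moreover have "path_weight Z H g G T \<in> borel_measurable (N \<alpha>)"
    by (rule path_weight_measurable) (auto simp: gm)
  ultimately have ae: "AE \<omega> in N \<alpha>. path_weight Z H g G T \<omega> \<noteq> \<top>"
    using fin nn_integral_PInf_AE[of "path_weight Z H g G T" "N \<alpha>"] unfolding infinity_ennreal_def
        by auto
  have reach: "\<exists>n. 0 < prob {\<omega> \<in> space (N \<alpha>). Z n \<omega> = \<beta>}" for \<beta>
  proof (rule ccontr)
    assume no: "\<not> ?thesis"
    obtain t where "0 \<le> t" and t: "0 < prob {\<omega> \<in> space (N \<alpha>). built_chain Z H t \<omega> = \<beta>}" using irr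
        by blast
    have "AE \<omega> in N \<alpha>. \<forall>n. Z n \<omega> \<noteq> \<beta>"
      unfolding AE_all_countable
    proof
      fix n
      have "prob {\<omega> \<in> space (N \<alpha>). Z n \<omega> = \<beta>} = 0" using no by (simp add: zero_less_measure_iff)
      then have "{\<omega> \<in> space (N \<alpha>). Z n \<omega> = \<beta>} \<in> null_sets (N \<alpha>)"
          by (simp add: null_sets_def emeasure_eq_measure)
      then show "AE \<omega> in N \<alpha>. Z n \<omega> \<noteq> \<beta>" by (rule AE_I') auto
    qed
    from AE_witness[OF this t] show False by (auto simp: built_chain_def)
  qed
  show "(\<integral>\<^sup>+\<omega>. ennreal (exp (\<sigma> * L \<beta> s \<omega>)) \<partial>D) \<noteq> \<top>" if "0 \<le> s"
  proof -
    obtain n where "0 < prob {\<omega> \<in> space (N \<alpha>). Z n \<omega> = \<beta>}" using reach by blast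
    from finite_factors(1)[OF T ae g0 G0 this] obtain s' where "0 < s'" "g \<beta> s' \<noteq> \<top>" by blast
    then show ?thesis
      using levy_process.exp_moment_finite[OF levy_L, where \<sigma> = \<sigma> and s = s' and t = s] that
      by (simp add: g_def levy_process.exp_moment_def[OF levy_L])
  qed
  show "(\<integral>\<^sup>+\<omega>. ennreal (exp (\<sigma> * U \<beta> \<gamma> \<omega>)) \<partial>D) \<noteq> \<top>" if ne: "\<beta> \<noteq> \<gamma>"
  proof (cases "q \<beta> \<gamma> = 0")
    case True
    have "(\<integral>\<^sup>+\<omega>. ennreal (exp (\<sigma> * U \<beta> \<gamma> \<omega>)) \<partial>D) = (\<integral>\<^sup>+\<omega>. 1 \<partial>D)"
      using U_zero[OF ne True] by (intro nn_integral_cong_AE) auto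
    then show ?thesis by (simp add: D.emeasure_space_1)
  next
    case False
    then have "0 < rate \<beta> \<gamma>" using rates_nonneg[OF ne] ne by (simp add: rate_def)
    obtain n where "0 < prob {\<omega> \<in> space (N \<alpha>). Z n \<omega> = \<beta>}" using reach by blast
    from finite_factors(2)[OF T ae g0 G0 this \<open>0 < rate \<beta> \<gamma>\<close>] show ?thesis using ne by (simp add: G_def)
  qed
qed

text \<open>The real exponent \<open>Re z\<close> first yields integrability, through the nonnegative form of the
  reduction to path weights; then the complex form gives the value.\<close>

lemma built_level_exponential_moment:
  assumes psi: "\<And>\<alpha>. is_laplace_exponent D (L \<alpha>) (\<psi> \<alpha>)"
    and T: "0 \<le> T"
    and finL: "\<And>\<beta> s. 0 \<le> s \<Longrightarrow> (\<integral>\<^sup>+\<omega>. ennreal (exp (Re z * L \<beta> s \<omega>)) \<partial>D) \<noteq> \<top>"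
    and finU: "\<And>\<beta> \<gamma>. \<beta> \<noteq> \<gamma> \<Longrightarrow> (\<integral>\<^sup>+\<omega>. ennreal (exp (Re z * U \<beta> \<gamma> \<omega>)) \<partial>D) \<noteq> \<top>"
  shows "integrable (N \<alpha>) (\<lambda>\<omega>. exp (z * of_real (built_level Z H X V T \<omega>)))"
    and "(LINT \<omega>|N \<alpha>. exp (z * of_real (built_level Z H X V T \<omega>)))
        = (\<Sum>\<beta>\<in>UNIV. matrix_exp (T *\<^sub>R matrix_exponent q \<psi> D U z) $ \<alpha> $ \<beta>)"
proof -
  interpret noisy_chain "N \<alpha>" q \<alpha> Z H X V by (rule noisy_chain)
  interpret D: prob_space D by (rule prob_space_D)
  let ?\<sigma> = "Re z"
  have integrable_exp: "integrable K (\<lambda>\<omega>. exp (w * of_real (f \<omega>)))"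
    if [measurable]: "f \<in> borel_measurable K" and "(\<integral>\<^sup>+\<omega>. ennreal (exp (?\<sigma> * f \<omega>)) \<partial>K) \<noteq> \<top>" "Re w
        = ?\<sigma>"
    for K :: "'k measure" and f and w :: complex
    by (rule integrableI_bounded) (use that in \<open>auto simp: top.not_eq_extremum\<close>)
  have iL: "integrable D (\<lambda>\<omega>. exp (w * of_real (L \<beta> s \<omega>)))" if "0 \<le> s" "Re w = ?\<sigma>" for \<beta> s w
    using that by (intro integrable_exp L_measurable finL)
  have iU: "integrable D (\<lambda>\<omega>. exp (w * of_real (U \<beta> \<gamma> \<omega>)))" if "\<beta> \<noteq> \<gamma>" "Re w = ?\<sigma>" for \<beta> \<gamma> w
    using that by (intro integrable_exp random_variable_U finU)
  have intL: "(LINT \<omega>|D. exp (w * of_real (L \<beta> s \<omega>))) = exp (\<psi> \<beta> w * of_real s)" if "0 \<le> s" "Re w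
      = ?\<sigma>" for \<beta> s w
    using psi[of \<beta>] iL[OF that] that(1) unfolding is_laplace_exponent_def
        by (simp add: mult.commute)
  have re: "(\<integral>\<^sup>+\<omega>. ennreal (exp (?\<sigma> * f \<omega>)) \<partial>D)
      = ennreal (norm (LINT \<omega>|D. exp (of_real ?\<sigma> * of_real (f \<omega>) :: complex)))"
    if i: "integrable D (\<lambda>\<omega>. exp (of_real ?\<sigma> * of_real (f \<omega>) :: complex))" for f :: "_ \<Rightarrow> real"
  proof -
    have e: "exp (of_real ?\<sigma> * of_real (f \<omega>) :: complex) = of_real (exp (?\<sigma> * f \<omega>))" for \<omega>
        by (simp add: exp_of_real[symmetric])
    have i': "integrable D (\<lambda>\<omega>. exp (?\<sigma> * f \<omega>))" using integrable_Re[OF i[unfolded e]] by simp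
    have "(\<integral>\<^sup>+\<omega>. ennreal (exp (?\<sigma> * f \<omega>)) \<partial>D) = ennreal (LINT \<omega>|D. exp (?\<sigma> * f \<omega>))"
      by (rule nn_integral_eq_integral[OF i']) simp
    moreover have "0 \<le> (LINT \<omega>|D. exp (?\<sigma> * f \<omega>))"
        by (rule Bochner_Integration.integral_nonneg) simp
    ultimately show ?thesis unfolding e by simp
  qed
  define a where "a \<beta> = \<psi> \<beta> (of_real ?\<sigma>)" for \<beta>
  define c where "c \<beta> \<gamma> = (LINT \<omega>|D. exp (complex_of_real ?\<sigma> * of_real (U \<beta> \<gamma> \<omega>)))" for \<beta> \<gamma>
  let ?w = "path_weight Z H (\<lambda>\<beta> s. exp (a \<beta> * of_real s)) c T"
  have "(\<integral>\<^sup>+\<omega>. ennreal (exp (?\<sigma> * built_level Z H X V T \<omega>)) \<partial>N \<alpha>)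
      = (\<integral>\<^sup>+\<omega>. path_weight Z H (\<lambda>\<beta> s. ennreal (norm (exp (a \<beta> * of_real s))))
          (\<lambda>\<beta> \<gamma>. ennreal (norm (c \<beta> \<gamma>))) T \<omega> \<partial>N \<alpha>)"
  proof (rule nn_integral_built_level[OF T])
    show "(\<integral>\<^sup>+\<omega>. ennreal (exp (?\<sigma> * X n \<beta> s \<omega>)) \<partial>N \<alpha>)
        = ennreal (norm (exp (a \<beta> * of_real s)))" if "0 \<le> s" for n \<beta> s
      using that re[OF iL[of s "of_real ?\<sigma>" \<beta>]] intL[of s "of_real ?\<sigma>" \<beta>]
      by (simp add: nn_integral_X[where f = "\<lambda>x. ennreal (exp (?\<sigma> * x))"] a_def)
    show "(\<integral>\<^sup>+\<omega>. ennreal (exp (?\<sigma> * V n \<beta> \<gamma> \<omega>)) \<partial>N \<alpha>) = ennreal (norm (c \<beta> \<gamma>))" if "\<beta> \<noteq> \<gamma>" for n \<beta> \<gamma>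
      using that re[OF iU[of \<beta> \<gamma> "of_real ?\<sigma>"]]
      by (simp add: nn_integral_V[where f = "\<lambda>x. ennreal (exp (?\<sigma> * x))"] c_def)
  qed
  also have "\<dots> = (\<integral>\<^sup>+\<omega>. ennreal (norm (?w \<omega>)) \<partial>N \<alpha>)"
  proof -
    have "path_weight Z H (\<lambda>\<beta> s. ennreal (norm (exp (a \<beta> * of_real s))))
        (\<lambda>\<beta> \<gamma>. ennreal (norm (c \<beta> \<gamma>))) T \<omega> = ennreal (norm (?w \<omega>))" for \<omega>
      unfolding path_weight_def Let_def
      by (simp add: norm_mult prod_norm[symmetric] ennreal_mult prod_ennreal prod_nonneg)
        (simp add: prod_ennreal flip: ennreal_mult)
    then show ?thesis by simp
  qed
  also have "\<dots> \<noteq> \<top>"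
    using expectation_path_weight(1)[OF T, of a c] unfolding integrable_iff_bounded by simp
  finally have "(\<integral>\<^sup>+\<omega>. ennreal (exp (?\<sigma> * built_level Z H X V T \<omega>)) \<partial>N \<alpha>) \<noteq> \<top>" .
  then show int: "integrable (N \<alpha>) (\<lambda>\<omega>. exp (z * of_real (built_level Z H X V T \<omega>)))"
    by (intro integrable_exp built_level_measurable T) auto
  have "(LINT \<omega>|N \<alpha>. exp (z * of_real (built_level Z H X V T \<omega>)))
     = expectation (path_weight Z H (\<lambda>\<beta> s. exp (\<psi> \<beta> z * of_real s))
         (\<lambda>\<beta> \<gamma>. LINT \<omega>|D. exp (z * of_real (U \<beta> \<gamma> \<omega>))) T)"
  proof (rule integral_built_level[OF T int])
    show "integrable (N \<alpha>) (\<lambda>\<omega>. exp (z * of_real (X n \<beta> s \<omega>)))" if "0 \<le> s" for n \<beta> s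
      using that iL[of s z \<beta>] by (simp add: integral_X(2)[where f = "\<lambda>x. exp (z * of_real x)"])
    show "integrable (N \<alpha>) (\<lambda>\<omega>. exp (z * of_real (V n \<beta> \<gamma> \<omega>)))" if "\<beta> \<noteq> \<gamma>" for n \<beta> \<gamma>
      using that iU[of \<beta> \<gamma> z] by (simp add: integral_V(2)[where f = "\<lambda>x. exp (z * of_real x)"])
    show "(LINT \<omega>|N \<alpha>. exp (z * of_real (X n \<beta> s \<omega>))) = exp (\<psi> \<beta> z * of_real s)" if "0
        \<le> s" for n \<beta> s
      using that intL[of s z \<beta>] by (simp add: integral_X(1)[where f = "\<lambda>x. exp (z * of_real x)"])
    show "(LINT \<omega>|N \<alpha>. exp (z * of_real (V n \<beta> \<gamma> \<omega>)))
        = (LINT \<omega>|D. exp (z * of_real (U \<beta> \<gamma> \<omega>)))" if "\<beta> \<noteq> \<gamma>" for n \<beta> \<gamma>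
      using that by (simp add: integral_V(1)[where f = "\<lambda>x. exp (z * of_real x)"])
  qed (rule path_weight_borel)
  also have "\<dots> = (\<Sum>\<gamma>\<in>UNIV. matrix_exp (T *\<^sub>R generator (\<lambda>\<beta>. \<psi> \<beta> z)
      (\<lambda>\<beta> \<gamma>. LINT \<omega>|D. exp (z * of_real (U \<beta> \<gamma> \<omega>)))) $ \<alpha> $ \<gamma>)"
    by (rule expectation_path_weight(2)[OF T])
  also have "generator (\<lambda>\<beta>. \<psi> \<beta> z) (\<lambda>\<beta> \<gamma>. LINT \<omega>|D. exp (z * of_real (U \<beta> \<gamma> \<omega>)))
      = matrix_exponent q \<psi> D U z"
    by (simp add: generator_def matrix_exponent_def)
  finally show "(LINT \<omega>|N \<alpha>. exp (z * of_real (built_level Z H X V T \<omega>)))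
      = (\<Sum>\<beta>\<in>UNIV. matrix_exp (T *\<^sub>R matrix_exponent q \<psi> D U z) $ \<alpha> $ \<beta>)" .
qed

end

section \<open>Mellin transforms and the option price\<close>

text \<open>For each \<open>\<omega>\<close> the substitution \<open>x = y * exp (B \<omega>)\<close> gives \<open>exp (- z * B \<omega>)\<close> times the Mellin
  transform of \<open>h\<close>, and the same computation with norms justifies Fubini.\<close>

lemma mellin_multiplicative_shift:
  fixes h :: "real \<Rightarrow> real" and B :: "'v \<Rightarrow> real"
  assumes "prob_space K" and B: "B \<in> borel_measurable K"
    and h: "mellin_exists h (of_real (Re z))"
    and int: "integrable K (\<lambda>\<omega>. exp (- z * of_real (B \<omega>)))"
  shows "mellin_exists (\<lambda>y. C * (LINT \<omega>|K. h (y * exp (B \<omega>)))) z"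
    and "mellin (\<lambda>y. C * (LINT \<omega>|K. h (y * exp (B \<omega>)))) z
      = of_real C * mellin h z * (LINT \<omega>|K. exp (- z * of_real (B \<omega>)))"
proof -
  interpret prob_space K by fact
  interpret KL: pair_sigma_finite K lborel ..
  note [measurable] = B
  have powr: "complex_of_real x powr w = exp (w * of_real (ln x))" if "0 < x" for x w
    using that by (simp add: powr_def Ln_of_real)
  define \<phi> where "\<phi> x = indicator {0<..} x *\<^sub>R (complex_of_real x powr (z - 1) * of_real (h x))" for
      x
  define \<phi>s where "\<phi>s x = indicator {0<..} x *\<^sub>R (complex_of_real x powr (of_real (Re z) - 1)
      * of_real (h x))" for x
  have \<phi>s: "integrable lborel \<phi>s"
    using h unfolding mellin_exists_def set_integrable_def \<phi>s_def[abs_def] .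
  have \<phi>_eq: "\<phi> x = (if 0 < x then exp (of_real (Im z * ln x) * \<i>) else 0) * \<phi>s x" for x
  proof (cases "0 < x")
    case True
    have "(z - 1) * of_real (ln x) = of_real (Im z * ln x) * \<i> + (of_real (Re z) - 1)
        * of_real (ln x)"
      by (simp add: complex_eq_iff algebra_simps)
    then have "exp ((z - 1) * of_real (ln x)) = exp (of_real (Im z * ln x) * \<i>)
        * exp ((of_real (Re z) - 1) * of_real (ln x))"
      by (simp only: exp_add)
    with True show ?thesis by (simp add: \<phi>_def \<phi>s_def powr)
  qed (simp add: \<phi>_def \<phi>s_def)
  have [measurable]: "\<phi>s \<in> borel_measurable borel" using borel_measurable_integrable[OF \<phi>s] by simp
  have \<phi>m[measurable]: "\<phi> \<in> borel_measurable borel" unfolding \<phi>_eq[abs_def] by measurable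
  have \<phi>: "integrable lborel \<phi>"
    by (rule Bochner_Integration.integrable_bound[OF \<phi>s]) (auto simp: \<phi>_eq norm_mult)
  have mellin_h: "mellin h z = (LINT x|lborel. \<phi> x)"
    unfolding mellin_def set_lebesgue_integral_def \<phi>_def ..
  \<comment> \<open>The integrand of the double integral, written through \<open>\<phi>\<close> so that the substitution applies;
    \<open>\<Psi>_eq\<close> shows its original form on the positive half-line.\<close>
  define \<Psi> where "\<Psi> \<omega> y = exp (- (z - 1) * of_real (B \<omega>)) * \<phi> (y * exp (B \<omega>))" for \<omega> y
  have \<Psi>_eq: "\<Psi> \<omega> y = indicator {0<..} y *\<^sub>R (complex_of_real y powr (z - 1)
      * of_real (h (y * exp (B \<omega>))))" for \<omega> y
  proof (cases "0 < y")
    case True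
    then have "exp (- (z - 1) * of_real (B \<omega>)) * complex_of_real (y * exp (B \<omega>)) powr (z - 1)
        = complex_of_real y powr (z - 1)"
      by (subst (1 2) powr) (auto simp: ln_mult algebra_simps simp flip: exp_add)
    then show ?thesis using True by (simp add: \<Psi>_def \<phi>_def mult.assoc[symmetric])
  next
    case False
    then show ?thesis by (simp add: \<Psi>_def \<phi>_def zero_less_mult_iff)
  qed
  have scale: "(LINT y|lborel. f (y * exp b))
      = exp (- b) *\<^sub>R (LINT x|lborel. f x)" for f :: "real \<Rightarrow> 'b::euclidean_space" and b
    using lborel_integral_real_affine[of "exp b" f 0]
        by (simp add: mult.commute exp_minus field_simps)
  have scale_i: "integrable lborel f \<Longrightarrow> integrable lborel (\<lambda>y. f (y * exp b))" for f :: "real \<Rightarrow>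
      complex" and b
    using lborel_integrable_real_affine[of f "exp b" 0] by (simp add: mult.commute)
  have inner: "(LINT y|lborel. \<Psi> \<omega> y) = exp (- z * of_real (B \<omega>)) * mellin h z" for \<omega>
  proof -
    have "(LINT y|lborel. \<Psi> \<omega> y) = exp (- (z - 1) * of_real (B \<omega>))
        * (of_real (exp (- B \<omega>)) * mellin h z)"
      unfolding \<Psi>_def mellin_h by (simp add: scale scaleR_conv_of_real)
    also have "exp (- (z - 1) * of_real (B \<omega>)) * (of_real (exp (- B \<omega>)) * mellin h z)
        = exp (- z * of_real (B \<omega>)) * mellin h z"
      unfolding exp_of_real[symmetric] mult.assoc[symmetric] exp_add[symmetric]
          by (simp add: algebra_simps)
    finally show ?thesis .
  qed
  have inner_norm: "(LINT y|lborel. norm (\<Psi> \<omega> y)) = norm (exp (- z * of_real (B \<omega>)))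
      * (LINT x|lborel. norm (\<phi> x))" for \<omega>
  proof -
    have "(LINT y|lborel. norm (\<Psi> \<omega> y)) = exp (- (Re z - 1) * B \<omega>)
        * (exp (- B \<omega>) * (LINT x|lborel. norm (\<phi> x)))"
      unfolding \<Psi>_def norm_mult using scale[of "\<lambda>x. norm (\<phi> x)" "B \<omega>"] by simp
    also have "\<dots> = norm (exp (- z * of_real (B \<omega>))) * (LINT x|lborel. norm (\<phi> x))"
      unfolding mult.assoc[symmetric] exp_add[symmetric] by (simp add: algebra_simps)
    finally show ?thesis .
  qed
  have \<Psi>: "integrable (K \<Otimes>\<^sub>M lborel) (case_prod \<Psi>)"
  proof (rule KL.Fubini_integrable)
    show "case_prod \<Psi> \<in> borel_measurable (K \<Otimes>\<^sub>M lborel)" unfolding \<Psi>_def by measurable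
    show "integrable K (\<lambda>\<omega>. LINT y|lborel. norm (case_prod \<Psi> (\<omega>, y)))"
      unfolding prod.case inner_norm by (intro integrable_mult_left integrable_norm int)
    show "AE \<omega> in K. integrable lborel (\<lambda>y. case_prod \<Psi> (\<omega>, y))"
      unfolding prod.case \<Psi>_def by (intro AE_I2 integrable_mult_right scale_i \<phi>)
  qed
  have outer: "(LINT \<omega>|K. \<Psi> \<omega> y) = indicator {0<..} y *\<^sub>R (complex_of_real y powr (z - 1)
      * of_real (LINT \<omega>|K. h (y * exp (B \<omega>))))" for y
    unfolding \<Psi>_eq by simp
  have i: "integrable lborel (\<lambda>y. of_real C * (LINT \<omega>|K. \<Psi> \<omega> y))"
    by (intro integrable_mult_right KL.integrable_snd \<Psi>)
  have eq: "indicator {0<..} y *\<^sub>R (complex_of_real y powr (z - 1)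
      * of_real (C * (LINT \<omega>|K. h (y * exp (B \<omega>)))))
     = of_real C * (LINT \<omega>|K. \<Psi> \<omega> y)" for y
    unfolding outer by (simp add: mult_ac)
  show "mellin_exists (\<lambda>y. C * (LINT \<omega>|K. h (y * exp (B \<omega>)))) z"
    unfolding mellin_exists_def set_integrable_def eq by (rule i)
  have "mellin (\<lambda>y. C * (LINT \<omega>|K. h (y * exp (B \<omega>)))) z = of_real C
      * (LINT y|lborel. LINT \<omega>|K. \<Psi> \<omega> y)"
    unfolding mellin_def set_lebesgue_integral_def eq by simp
  also have "(LINT y|lborel. LINT \<omega>|K. \<Psi> \<omega> y) = (LINT \<omega>|K. LINT y|lborel. \<Psi> \<omega> y)"
    by (rule KL.Fubini_integral[OF \<Psi>])
  also have "\<dots> = (LINT \<omega>|K. exp (- z * of_real (B \<omega>))) * mellin h z"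
    unfolding inner by simp
  finally show "mellin (\<lambda>y. C * (LINT \<omega>|K. h (y * exp (B \<omega>)))) z
      = of_real C * mellin h z * (LINT \<omega>|K. exp (- z * of_real (B \<omega>)))" by (simp add: mult_ac)
qed

lemma mellin_cong:
  assumes "\<And>y. 0 < y \<Longrightarrow> f y = g y"
  shows "mellin_exists f z \<longleftrightarrow> mellin_exists g z" "mellin f z = mellin g z"
proof -
  have "indicator {0<..} y *\<^sub>R (complex_of_real y powr (z - 1) * of_real (f y))
      = indicator {0<..} y *\<^sub>R (complex_of_real y powr (z - 1) * of_real (g y))" for y
    using assms[of y] by (auto simp: indicator_def)
  then show "mellin_exists f z \<longleftrightarrow> mellin_exists g z" "mellin f z = mellin g z"
    by (simp_all only: mellin_exists_def mellin_def set_integrable_def set_lebesgue_integral_def)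
qed

text \<open>Existence of the Mellin transform makes \<open>h\<close> measurable on the positive half-line, after division
  by the nowhere vanishing power of \<open>x\<close>.\<close>

lemma mellin_exists_payoff_measurable:
  assumes "mellin_exists h u"
  shows "(\<lambda>x. h (exp x)) \<in> borel_measurable borel"
proof -
  define \<phi> where "\<phi> x = indicator {0<..} x *\<^sub>R (complex_of_real x powr (u - 1) * of_real (h x))" for
      x
  have [measurable]: "\<phi> \<in> borel_measurable borel"
    using assms borel_measurable_integrable[of lborel \<phi>]
    unfolding mellin_exists_def set_integrable_def \<phi>_def[abs_def] by simp
  have "h (exp x) = Re (\<phi> (exp x) * exp (- (u - 1) * of_real x))" for x
  proof -
    have "\<phi> (exp x) * exp (- (u - 1) * of_real x) = of_real (h (exp x))
        * exp ((u - 1) * of_real x + - (u - 1) * of_real x)"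
      unfolding exp_add by (simp add: \<phi>_def powr_def Ln_of_real)
    also have "\<dots> = of_real (h (exp x))" by (simp add: algebra_simps)
    finally have "\<phi> (exp x) * exp (- (u - 1) * of_real x) = of_real (h (exp x))" .
    from arg_cong[OF this, of Re] show ?thesis by (simp only: Re_complex_of_real)
  qed
  moreover have "(\<lambda>x. Re (\<phi> (exp x) * exp (- (u - 1) * of_real x))) \<in> borel_measurable borel"
    by measurable
  ultimately show ?thesis by simp
qed

context map_characteristics begin

text \<open>Equality of the path laws, evaluated at one time.\<close>

lemma law_at_time:
  assumes JX: "\<And>t. 0 \<le> t \<Longrightarrow> (\<lambda>\<omega>. (J t \<omega>, \<xi> t \<omega>)) \<in> P \<alpha> x \<rightarrow>\<^sub>M state_space" and t: "0 \<le> t"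
  shows "distr (P \<alpha> x) state_space (\<lambda>\<omega>. (J t \<omega>, \<xi> t \<omega>))
     = distr (N \<alpha>) state_space (\<lambda>\<omega>. (built_chain Z H t \<omega>, x + built_level Z H X V t \<omega>))"
proof -
  interpret noisy_chain "N \<alpha>" q \<alpha> Z H X V by (rule noisy_chain)
  have "(\<lambda>\<omega>. (built_chain Z H t \<omega>, x + built_level Z H X V t \<omega>)) \<in> N \<alpha> \<rightarrow>\<^sub>M state_space" if "0
      \<le> t" for t
    using built_chain_measurable[of t] built_level_measurable[OF that] by measurable
  then show ?thesis
    using path_law_marginal[OF t, of "\<lambda>t \<omega>. (built_chain Z H t \<omega>, x + built_level Z H X V t \<omega>)" "N
        \<alpha>" state_space]
      path_law_marginal[OF t, of "\<lambda>t \<omega>. (J t \<omega>, \<xi> t \<omega>)" "P \<alpha> x" state_space] JX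
    by (simp only: same_law)
qed

end

theorem proposition3p2:
  fixes M :: "'w measure" and P :: "'e::finite \<Rightarrow> real \<Rightarrow> 'w measure"
    and A :: "real \<Rightarrow> 'w measure"
    and J :: "real \<Rightarrow> 'w \<Rightarrow> 'e" and \<xi> :: "real \<Rightarrow> 'w \<Rightarrow> real"
    and q :: "'e \<Rightarrow> 'e \<Rightarrow> real"
    and D :: "'d measure"
    and L :: "'e \<Rightarrow> real \<Rightarrow> 'd \<Rightarrow> real" and U :: "'e \<Rightarrow> 'e \<Rightarrow> 'd \<Rightarrow> real"
    and N :: "'e \<Rightarrow> 'v measure"
    and Z :: "nat \<Rightarrow> 'v \<Rightarrow> 'e" and S :: "nat \<Rightarrow> 'v \<Rightarrow> ereal"
    and X :: "nat \<Rightarrow> 'e \<Rightarrow> real \<Rightarrow> 'v \<Rightarrow> real" and V :: "nat \<Rightarrow> 'e \<Rightarrow> 'e \<Rightarrow> 'v \<Rightarrow> real"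
    and \<psi> :: "'e \<Rightarrow> complex \<Rightarrow> complex" and F :: "complex \<Rightarrow> complex ^ 'e ^ 'e"
    and Y :: "real \<Rightarrow> 'w \<Rightarrow> real"
    and T r s x\<^sub>0 :: real and H :: "real \<Rightarrow> real" and \<mu> :: "'e pmf"
  assumes "markov_additive_process M P A J \<xi>"
    and "map_characteristics P J \<xi> q D L U N Z S X V"
    and "irreducible_chain P J"
    and "\<And>\<alpha>. is_laplace_exponent D (L \<alpha>) (\<psi> \<alpha>)"
    and "F = matrix_exponent q \<psi> D U"
    and "Y = (\<lambda>t \<omega>. exp (\<xi> t \<omega>))"
    and "0 < T"
    and "(\<integral>\<^sup>+\<omega>. ennreal (Y T \<omega> powr (- s)) \<partial>initial_law P \<mu> x\<^sub>0) < \<infinity>"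
    and "mellin_exists H (complex_of_real s)"
  shows "\<forall>\<alpha> z. Re z = s \<longrightarrow>
           mellin_exists (\<lambda>y. option_price P Y r H \<alpha> y T) z \<and>
           mellin (\<lambda>y. option_price P Y r H \<alpha> y T) z =
             complex_of_real (exp (- r * T)) * mellin H z *
               (\<Sum>\<beta>\<in>UNIV. matrix_exp (T *\<^sub>R F (- z)) $ \<alpha> $ \<beta>)"
proof (intro allI impI)
  fix \<alpha> z assume z: "Re z = s"
  interpret markov_additive_process M P A J \<xi> by fact
  interpret map_characteristics P J \<xi> q D L U N Z S X V by fact
  let ?B = "built_level Z S X V"
  have T: "0 \<le> T" using \<open>0 < T\<close> by simp
  have JXM: "(\<lambda>\<omega>. (J t \<omega>, \<xi> t \<omega>)) \<in> M \<rightarrow>\<^sub>M state_space" if "0 \<le> t" for t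
    using measurable_from_subalg[OF subalgebra_A[OF that] adapted[OF that]] .
  then have JX: "(\<lambda>\<omega>. (J t \<omega>, \<xi> t \<omega>)) \<in> P \<beta> x \<rightarrow>\<^sub>M state_space" if "0 \<le> t" for t \<beta> x
    using that measurable_cong_sets[OF sets_P refl] by blast
  have \<xi>M[measurable]: "\<xi> T \<in> borel_measurable M"
    using measurable_compose[OF JXM[OF T] measurable_snd] by simp
  have \<xi>P: "\<xi> T \<in> borel_measurable (P \<beta> x)" for \<beta> x
    using measurable_compose[OF JX[OF T] measurable_snd] by simp
  have Bm: "?B T \<in> borel_measurable (N \<beta>)" for \<beta>
    using noisy_chain.built_level_measurable[OF noisy_chain T] .
  have bc: "built_chain Z S t \<in> N \<beta> \<rightarrow>\<^sub>M count_space UNIV" for \<beta> t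
    by (rule noisy_chain.built_chain_measurable[OF noisy_chain])
  have law_JX: "distr (P \<beta> x) state_space (\<lambda>\<omega>. (J t \<omega>, \<xi> t \<omega>))
     = distr (N \<beta>) state_space (\<lambda>\<omega>. (built_chain Z S t \<omega>, x + ?B t \<omega>))" if "0 \<le> t" for \<beta> x t
    by (rule law_at_time[OF _ that]) (rule JX)
  have law: "distr (P \<beta> x) borel (\<xi> T) = distr (N \<beta>) borel (\<lambda>\<omega>. x + ?B T \<omega>)" for \<beta> x
  proof -
    have "distr (P \<beta> x) borel (\<xi> T) = distr (distr (P \<beta> x) state_space (\<lambda>\<omega>. (J T \<omega>, \<xi> T \<omega>))) borel
        snd"
      by (subst distr_distr[OF measurable_snd JX[OF T]]) (simp add: comp_def)
    also have "\<dots> = distr (N \<beta>) borel (\<lambda>\<omega>. x + ?B T \<omega>)"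
      unfolding law_JX[OF T] by (subst distr_distr) (use Bm bc in \<open>auto simp: comp_def\<close>)
    finally show ?thesis .
  qed
  \<comment> \<open>Any state that \<open>\<mu>\<close> charges inherits the finiteness; by irreducibility one such state is
    enough.\<close>
  obtain \<alpha>\<^sub>0 where \<alpha>0: "(\<integral>\<^sup>+\<omega>. ennreal (Y T \<omega> powr (- s)) \<partial>P \<alpha>\<^sub>0 x\<^sub>0) < \<infinity>"
  proof -
    have "(\<lambda>\<beta>. P \<beta> x\<^sub>0) \<in> count_space UNIV \<rightarrow>\<^sub>M subprob_algebra M"
      using prob_space_P sets_P by (auto simp: space_subprob_algebra intro:
          prob_space_imp_subprob_space)
    then have eq: "(\<integral>\<^sup>+\<omega>. ennreal (Y T \<omega> powr (- s)) \<partial>initial_law P \<mu> x\<^sub>0)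
        = (\<integral>\<^sup>+\<beta>. \<integral>\<^sup>+\<omega>. ennreal (Y T \<omega> powr (- s)) \<partial>P \<beta> x\<^sub>0 \<partial>measure_pmf \<mu>)"
      unfolding initial_law_def assms(6) by (intro nn_integral_bind[where B = M]) (measurable, simp)
    have "AE \<beta> in measure_pmf \<mu>. (\<integral>\<^sup>+\<omega>. ennreal (Y T \<omega> powr (- s)) \<partial>P \<beta> x\<^sub>0) \<noteq> \<infinity>"
      using assms(8) unfolding eq by (intro nn_integral_PInf_AE) auto
    moreover obtain \<beta> where "\<beta> \<in> set_pmf \<mu>" using set_pmf_not_empty[of \<mu>] by blast
    ultimately show thesis using that[of \<beta>] by (auto simp: AE_measure_pmf_iff less_top)
  qed
  have fin: "(\<integral>\<^sup>+\<omega>. ennreal (exp (- s * ?B T \<omega>)) \<partial>N \<alpha>\<^sub>0) < \<infinity>"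
  proof -
    have "(\<integral>\<^sup>+\<omega>. ennreal (Y T \<omega> powr (- s)) \<partial>P \<alpha>\<^sub>0 x\<^sub>0)
        = (\<integral>\<^sup>+x. ennreal (exp (- s * x)) \<partial>distr (P \<alpha>\<^sub>0 x\<^sub>0) borel (\<xi> T))"
      unfolding assms(6) by (subst nn_integral_distr[OF \<xi>P]) (auto simp: powr_def)
    also have "\<dots> = (\<integral>\<^sup>+\<omega>. ennreal (exp (- s * x\<^sub>0)) * ennreal (exp (- s * ?B T \<omega>)) \<partial>N \<alpha>\<^sub>0)"
      unfolding law by (subst nn_integral_distr) (use Bm in \<open>auto simp: algebra_simps intro!: nn_integral_cong simp flip: ennreal_mult exp_add\<close>)
    also have "\<dots> = ennreal (exp (- s * x\<^sub>0)) * (\<integral>\<^sup>+\<omega>. ennreal (exp (- s * ?B T \<omega>)) \<partial>N \<alpha>\<^sub>0)"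
      by (rule nn_integral_cmult) (use Bm[of \<alpha>\<^sub>0] in measurable)
    finally show ?thesis using \<alpha>0 by (auto simp: ennreal_mult_less_top less_top
        ennreal_mult_eq_top_iff)
  qed
  have irr: "\<exists>t\<ge>0. 0 < measure (N \<alpha>\<^sub>0) {\<omega> \<in> space (N \<alpha>\<^sub>0). built_chain Z S t \<omega> = \<beta>}" for \<beta>
  proof -
    obtain t where t: "0 \<le> t" and pos: "0 < measure (P \<alpha>\<^sub>0 0) {\<omega> \<in> space (P \<alpha>\<^sub>0 0). J t \<omega> = \<beta>}"
      using assms(3) unfolding irreducible_chain_def by blast
    have set: "{\<beta>} \<times> UNIV \<in> sets (state_space :: ('e \<times> real) measure)" by auto
    have Bt: "?B t \<in> borel_measurable (N \<alpha>\<^sub>0)"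
        by (rule noisy_chain.built_level_measurable[OF noisy_chain t])
    have "measure (P \<alpha>\<^sub>0 0) {\<omega> \<in> space (P \<alpha>\<^sub>0 0). J t \<omega> = \<beta>}
        = measure (distr (P \<alpha>\<^sub>0 0) state_space (\<lambda>\<omega>. (J t \<omega>, \<xi> t \<omega>))) ({\<beta>} \<times> UNIV)"
      by (subst measure_distr[OF JX[OF t] set]) (auto intro!: arg_cong[of _ _ "measure (P \<alpha>\<^sub>0 0)"])
    also have "\<dots> = measure (N \<alpha>\<^sub>0) {\<omega> \<in> space (N \<alpha>\<^sub>0). built_chain Z S t \<omega> = \<beta>}"
      unfolding law_JX[OF t]
      by (subst measure_distr[OF _ set]) (use Bt bc in \<open>auto intro!: arg_cong[of _ _ "measure (N \<alpha>\<^sub>0)"]\<close>)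
    finally show ?thesis using t pos by auto
  qed
  note moments = moments_finite[OF irr \<open>0 < T\<close> fin]
  have "integrable (N \<alpha>) (\<lambda>\<omega>. exp (- z * of_real (?B T \<omega>)))"
    and E: "(LINT \<omega>|N \<alpha>. exp (- z * of_real (?B T \<omega>)))
        = (\<Sum>\<beta>\<in>UNIV. matrix_exp (T *\<^sub>R F (- z)) $ \<alpha> $ \<beta>)"
    using built_level_exponential_moment[where \<psi> = \<psi> and z = "- z" and \<alpha> = \<alpha>, OF assms(4) T] moments
        z
    unfolding assms(5) by simp_all
  note shift = mellin_multiplicative_shift[OF prob_space_N Bm _ this(1), of H "exp (- r * T)",
      unfolded z, OF assms(9)]
  have price: "option_price P Y r H \<alpha> y T = exp (- r * T)
      * (LINT \<omega>|N \<alpha>. H (y * exp (?B T \<omega>)))" if "0 < y" for y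
  proof -
    have Hm: "(\<lambda>x. H (exp x)) \<in> borel_measurable borel"
        by (rule mellin_exists_payoff_measurable[OF assms(9)])
    have "(LINT \<omega>|P \<alpha> (ln y). H (Y T \<omega>)) = (LINT x|distr (P \<alpha> (ln y)) borel (\<xi> T). H (exp x))"
      unfolding assms(6) by (rule integral_distr[OF \<xi>P Hm, symmetric])
    also have "\<dots> = (LINT \<omega>|N \<alpha>. H (exp (ln y + ?B T \<omega>)))"
      unfolding law by (rule integral_distr[OF _ Hm]) (use Bm in measurable)
    finally show ?thesis using that by (simp add: option_price_def exp_add)
  qed
  have "mellin_exists (\<lambda>y. option_price P Y r H \<alpha> y T) z"
    by (rule mellin_cong(1)[THEN iffD2, OF _ shift(1)]) (rule price)
  moreover have "mellin (\<lambda>y. option_price P Y r H \<alpha> y T) z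
      = mellin (\<lambda>y. exp (- r * T) * (LINT \<omega>|N \<alpha>. H (y * exp (?B T \<omega>)))) z"
    by (rule mellin_cong(2)) (rule price)
  ultimately show "mellin_exists (\<lambda>y. option_price P Y r H \<alpha> y T) z \<and>
           mellin (\<lambda>y. option_price P Y r H \<alpha> y T) z =
             complex_of_real (exp (- r * T)) * mellin H z *
               (\<Sum>\<beta>\<in>UNIV. matrix_exp (T *\<^sub>R F (- z)) $ \<alpha> $ \<beta>)"
    unfolding shift(2) E by (rule conjI)
qed

end
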